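(* Let $L$ and $\mathfrak g$ be finite dimensional Lie algebras over an algebraically closed field $F$ of characteristic $0$. Suppose $\mathfrak g$ is semisimple and acting on $L$ by derivations. Then there exists a maximal semisimple subalgebra $B$ in $L$ such that $L=B\oplus R$ (direct sum of $\mathfrak g$-submodules), where $R$ is the solvable radical of $L$.
   Context: An action of $\mathfrak g$ on $L$ by derivations is a homomorphism of Lie algebras from $\mathfrak g$ to the Lie algebra of derivations of $L$. *)

theory Defs
  imports Complex_Main "HOL-Computational_Algebra.Polynomial"
begin

locale lie_algebra = vector_space scale
  for scale :: "'f::field \<Rightarrow> 'l::ab_group_add \<Rightarrow> 'l" +
  fixes bracket :: "'l \<Rightarrow> 'l \<Rightarrow> 'l"
  assumes bracket_add_left: "bracket (x + y) z = bracket x z + bracket y z"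
    and bracket_add_right: "bracket x (y + z) = bracket x y + bracket x z"
    and bracket_scale_left: "bracket (scale c x) y = scale c (bracket x y)"
    and bracket_scale_right: "bracket x (scale c y) = scale c (bracket x y)"
    and bracket_self: "bracket x x = 0"
    and jacobi: "bracket x (bracket y z) + bracket y (bracket z x) + bracket z (bracket x y) = 0"
begin

definition lie_subalgebra :: "'l set \<Rightarrow> bool"
  where "lie_subalgebra S \<longleftrightarrow> subspace S \<and> (\<forall>x\<in>S. \<forall>y\<in>S. bracket x y \<in> S)"

definition lie_ideal :: "'l set \<Rightarrow> 'l set \<Rightarrow> bool"
  where "lie_ideal I S \<longleftrightarrow> subspace I \<and> I \<subseteq> S \<and> (\<forall>x\<in>S. \<forall>y\<in>I. bracket x y \<in> I)"

primrec derived_series :: "'l set \<Rightarrow> nat \<Rightarrow> 'l set"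
  where
    "derived_series S 0 = S"
  | "derived_series S (Suc n) =
       span {bracket x y | x y. x \<in> derived_series S n \<and> y \<in> derived_series S n}"

definition solvable :: "'l set \<Rightarrow> bool"
  where "solvable S \<longleftrightarrow> (\<exists>n. derived_series S n = {0})"

text \<open>The radical of a subalgebra \<open>S\<close> is its largest solvable ideal with respect to inclusion.
  Lemma \<open>solvable_radical_greatest\<close> below shows that it exists in the finite dimensional case.\<close>

definition solvable_radical :: "'l set \<Rightarrow> 'l set"
  where "solvable_radical S = (GREATEST I. lie_ideal I S \<and> solvable I)"

text \<open>With this convention the zero algebra is semisimple, so that a solvable algebra
  also has a maximal semisimple subalgebra.\<close>

definition semisimple :: "'l set \<Rightarrow> bool"
  where "semisimple S \<longleftrightarrow> lie_subalgebra S \<and> solvable_radical S = {0}"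

definition maximal_semisimple_subalgebra :: "'l set \<Rightarrow> bool"
  where "maximal_semisimple_subalgebra B \<longleftrightarrow>
    semisimple B \<and> (\<forall>C. semisimple C \<and> B \<subseteq> C \<longrightarrow> C = B)"

definition derivation :: "('l \<Rightarrow> 'l) \<Rightarrow> bool"
  where "derivation D \<longleftrightarrow> Vector_Spaces.linear scale scale D \<and>
    (\<forall>x y. D (bracket x y) = bracket (D x) y + bracket x (D y))"

end

locale fin_dim_lie_algebra = lie_algebra +
  assumes finite_dimensional: "\<exists>S. finite S \<and> span S = UNIV"

text \<open>A homomorphism from \<open>\<gg>\<close> to the Lie algebra of derivations of \<open>L\<close>, whose vector space
  operations are pointwise and whose bracket is the commutator \<open>D \<circ> E - E \<circ> D\<close>.\<close>

locale lie_action_by_derivations =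
  \<gg>: lie_algebra scale\<^sub>\<gg> bracket\<^sub>\<gg> + L: lie_algebra scale\<^sub>L bracket\<^sub>L
  for scale\<^sub>\<gg> :: "'f::field \<Rightarrow> 'g::ab_group_add \<Rightarrow> 'g"
    and bracket\<^sub>\<gg> :: "'g \<Rightarrow> 'g \<Rightarrow> 'g"
    and scale\<^sub>L :: "'f \<Rightarrow> 'l::ab_group_add \<Rightarrow> 'l"
    and bracket\<^sub>L :: "'l \<Rightarrow> 'l \<Rightarrow> 'l" +
  fixes act :: "'g \<Rightarrow> 'l \<Rightarrow> 'l"
  assumes act_derivation: "L.derivation (act g)"
    and act_add: "act (g + h) x = act g x + act h x"
    and act_scale: "act (scale\<^sub>\<gg> c g) x = scale\<^sub>L c (act g x)"
    and act_bracket: "act (bracket\<^sub>\<gg> g h) x = act g (act h x) - act h (act g x)"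
begin

definition submodule :: "'l set \<Rightarrow> bool"
  where "submodule M \<longleftrightarrow> L.subspace M \<and> (\<forall>g. \<forall>x\<in>M. act g x \<in> M)"

definition direct_sum_of_submodules :: "'l set \<Rightarrow> 'l set \<Rightarrow> bool"
  where "direct_sum_of_submodules M N \<longleftrightarrow> submodule M \<and> submodule N \<and>
    {x + y | x y. x \<in> M \<and> y \<in> N} = UNIV \<and> M \<inter> N = {0}"

end

context lie_algebra
begin

lemma bracket_zero_right: "bracket x 0 = 0"
  using bracket_add_right[of x 0 0] by simp

lemma bracket_skew: "bracket x y = - bracket y x"
  using bracket_self[of "x + y"] bracket_self[of x] bracket_self[of y]
  by (simp add: bracket_add_left bracket_add_right eq_neg_iff_add_eq_0 add.commute)

lemma derived_series_subset:
  assumes "lie_subalgebra S"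
  shows "derived_series S n \<subseteq> S"
proof (induction n)
  case (Suc n)
  have "span {bracket x y | x y. x \<in> derived_series S n \<and> y \<in> derived_series S n} \<subseteq> S"
    by (rule span_minimal) (use Suc assms in \<open>auto simp: lie_subalgebra_def\<close>)
  then show ?case by simp
qed simp

lemma derived_series_mono:
  assumes "S \<subseteq> T"
  shows "derived_series S n \<subseteq> derived_series T n"
proof (induction n)
  case (Suc n)
  then show ?case by (auto intro!: span_mono)
qed (use assms in simp)

lemma derived_series_add: "derived_series S (m + n) = derived_series (derived_series S m) n"
  by (induction n) auto

lemma subspace_derived_series:
  assumes "subspace S"
  shows "subspace (derived_series S n)"
  using assms by (cases n) auto

lemma lie_ideal_imp_subalgebra: "lie_ideal I S \<Longrightarrow> lie_subalgebra I"
  by (auto simp: lie_ideal_def lie_subalgebra_def)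

lemma lie_ideal_bracket_left:
  assumes "lie_ideal I S" "x \<in> I" "y \<in> S"
  shows "bracket x y \<in> I"
  using assms bracket_skew[of x y] by (auto simp: lie_ideal_def intro: subspace_neg)

lemma lie_ideal_sum:
  assumes "lie_subalgebra S" "lie_ideal I S" "lie_ideal J S"
  shows "lie_ideal {x + y | x y. x \<in> I \<and> y \<in> J} S"
  unfolding lie_ideal_def
proof (intro conjI ballI)
  show "subspace {x + y | x y. x \<in> I \<and> y \<in> J}"
    using assms by (intro subspace_sums) (auto simp: lie_ideal_def)
  show "{x + y | x y. x \<in> I \<and> y \<in> J} \<subseteq> S"
    using assms by (auto simp: lie_ideal_def lie_subalgebra_def intro!: subspace_add)
next
  fix s z assume s: "s \<in> S" and "z \<in> {x + y | x y. x \<in> I \<and> y \<in> J}"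
  then obtain x y where "z = x + y" "x \<in> I" "y \<in> J" by auto
  with s assms have "bracket s z = bracket s x + bracket s y" "bracket s x \<in> I" "bracket s y \<in> J"
    by (auto simp: bracket_add_right lie_ideal_def)
  then show "bracket s z \<in> {x + y | x y. x \<in> I \<and> y \<in> J}" by blast
qed

lemma derived_series_sum:
  assumes S: "lie_subalgebra S" and I: "lie_ideal I S" and J: "lie_ideal J S"
  shows "derived_series {x + y | x y. x \<in> I \<and> y \<in> J} n \<subseteq>
    {x + y | x y. x \<in> derived_series I n \<and> y \<in> J}"
proof (induction n)
  case (Suc n)
  let ?D = "derived_series I n" and ?D' = "derived_series I (Suc n)"
  let ?T = "{x + y | x y. x \<in> ?D' \<and> y \<in> J}"
  have DS: "?D \<subseteq> S"
    using derived_series_subset[OF lie_ideal_imp_subalgebra[OF I]] I by (auto simp: lie_ideal_def)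
  have JS: "J \<subseteq> S" and J': "subspace J" using J by (auto simp: lie_ideal_def)
  have T: "bracket (a + b) (c + d) \<in> ?T" if "a \<in> ?D" "b \<in> J" "c \<in> ?D" "d \<in> J" for a b c d
  proof -
    have "bracket (a + b) (c + d) = bracket a c + (bracket a d + bracket b (c + d))"
      by (simp add: bracket_add_left bracket_add_right algebra_simps)
    moreover have "bracket a c \<in> ?D'" using that by (auto intro: span_base)
    moreover have "bracket a d \<in> J" using that DS J by (auto simp: lie_ideal_def)
    moreover have "bracket b (c + d) \<in> J"
      using that DS JS S by (intro lie_ideal_bracket_left[OF J])
        (auto simp: lie_subalgebra_def intro!: subspace_add)
    ultimately show ?thesis using J' by (blast intro: subspace_add)
  qed
  have "subspace ?T"
    using J' I by (intro subspace_sums subspace_derived_series) (auto simp: lie_ideal_def)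
  moreover have "bracket u v \<in> ?T"
    if uv: "u \<in> derived_series {x + y | x y. x \<in> I \<and> y \<in> J} n"
      "v \<in> derived_series {x + y | x y. x \<in> I \<and> y \<in> J} n" for u v
  proof -
    obtain a b c d where "u = a + b" "v = c + d" "a \<in> ?D" "b \<in> J" "c \<in> ?D" "d \<in> J"
      using subsetD[OF Suc uv(1)] subsetD[OF Suc uv(2)] by blast
    then show ?thesis using T by blast
  qed
  ultimately show ?case
    unfolding derived_series.simps(2)[of "{x + y | x y. x \<in> I \<and> y \<in> J}"]
    by (intro span_minimal subsetI) blast+
qed simp

lemma solvable_sum:
  assumes S: "lie_subalgebra S" and I: "lie_ideal I S" "solvable I" and J: "lie_ideal J S" "solvable J"
  shows "solvable {x + y | x y. x \<in> I \<and> y \<in> J}"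
proof -
  let ?K = "{x + y | x y. x \<in> I \<and> y \<in> J}"
  obtain m n where m: "derived_series I m = {0}" and n: "derived_series J n = {0}"
    using I J by (auto simp: solvable_def)
  have "derived_series ?K m \<subseteq> J"
    using derived_series_sum[OF S I(1) J(1), of m] m by auto
  then have "derived_series ?K (m + n) \<subseteq> {0}"
    using derived_series_mono[of "derived_series ?K m" J n] n by (simp add: derived_series_add)
  moreover have "0 \<in> derived_series ?K (m + n)"
    using lie_ideal_sum[OF S I(1) J(1)]
    by (intro subspace_0 subspace_derived_series) (simp add: lie_ideal_def)
  ultimately show ?thesis by (auto simp: solvable_def)
qed

end

lemma (in fin_dim_lie_algebra) solvable_radical_greatest:
  assumes S: "lie_subalgebra S"
  shows "lie_ideal (solvable_radical S) S" "solvable (solvable_radical S)"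
    and "\<And>I. lie_ideal I S \<Longrightarrow> solvable I \<Longrightarrow> I \<subseteq> solvable_radical S"
proof -
  obtain A where A: "finite A" "span A = UNIV" using finite_dimensional by blast
  obtain B where B: "B \<subseteq> A" "independent B" "A \<subseteq> span B"
    using maximal_independent_subset[of A] by blast
  have "span B = UNIV" using span_minimal[OF B(3) subspace_span] A(2) by auto
  moreover have "finite B" using A(1) B(1) by (rule rev_finite_subset)
  ultimately interpret finite_dimensional_vector_space scale B
    using B(2) by unfold_locales
  let ?P = "\<lambda>I. lie_ideal I S \<and> solvable I"
  have P0: "?P {0}"
    using S by (auto simp: lie_ideal_def lie_subalgebra_def solvable_def subspace_0 bracket_zero_right
        intro: exI[of _ "0::nat"])
  obtain R where R: "?P R" and R_max: "\<And>I. ?P I \<Longrightarrow> dim I \<le> dim R"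
    using ex_has_greatest_nat[of ?P "{0}" dim "Suc dimension", OF P0] dim_subset_UNIV
    by (auto simp: less_Suc_eq_le)
  have le: "I \<subseteq> R" if "?P I" for I
  proof -
    let ?K = "{x + y | x y. x \<in> R \<and> y \<in> I}"
    have K: "?P ?K" using lie_ideal_sum solvable_sum S R that by blast
    have sub: "subspace R" "subspace I" using R that by (auto simp: lie_ideal_def)
    have "R \<subseteq> ?K" "I \<subseteq> ?K"
      using subspace_0[OF sub(1)] subspace_0[OF sub(2)] by (metis (mono_tags, lifting) add.right_neutral mem_Collect_eq subsetI, metis (mono_tags, lifting) add.left_neutral mem_Collect_eq subsetI)
    moreover have "R = ?K"
      using K R_max[OF K] sub \<open>R \<subseteq> ?K\<close> by (intro subspace_dim_equal) (auto simp: lie_ideal_def)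
    ultimately show ?thesis by blast
  qed
  have "solvable_radical S = R"
    unfolding solvable_radical_def using R le by (intro Greatest_equality)
  with R le show "lie_ideal (solvable_radical S) S" "solvable (solvable_radical S)"
    "\<And>I. lie_ideal I S \<Longrightarrow> solvable I \<Longrightarrow> I \<subseteq> solvable_radical S" by auto
qed

end

theory Submission
  imports Defs "HOL-Library.Function_Algebras" "HOL-Library.Product_Plus"
begin

text \<open>
  Let \<open>M = \<gg> \<times> L\<close> be the semidirect product. Its radical lies in \<open>L\<close>, because \<open>\<gg>\<close> is semisimple.
  If \<open>S\<close> is a Levi subalgebra of \<open>M\<close> that contains \<open>\<gg>\<close>, then \<open>B = S \<inter> L\<close> is \<open>\<gg>\<close>-stable and, by the
  modular law, complements the radical of \<open>M\<close> in \<open>L\<close>. Moreover \<open>B\<close> is an ideal of the semisimple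
  algebra \<open>S\<close>, hence semisimple (\<open>ideal_of_semisimple\<close>). So \<open>B\<close> meets the radical \<open>R\<close> of \<open>L\<close> only in
  \<open>0\<close>, which forces \<open>R\<close> to be the radical of \<open>M\<close>; in particular \<open>R\<close> is \<open>\<gg>\<close>-stable. A semisimple
  \<open>C \<supseteq> B\<close> also meets \<open>R\<close> only in \<open>0\<close>, so it equals \<open>B\<close>. What has to be shown is therefore the
  theorem of Levi together with that of Malcev: every semisimple subalgebra \<open>G\<close> of \<open>M\<close> lies in a
  Levi subalgebra (\<open>ex_levi_subalgebra\<close>).

  Among the subalgebras \<open>S \<supseteq> G\<close> that supplement the radical take one of least dimension, and
  suppose that its radical \<open>Q\<close> is not zero. Choose an ideal \<open>Q'\<close> of \<open>S\<close> with \<open>[Q, Q] \<subseteq> Q' \<subset> Q\<close> and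
  \<open>Q/Q'\<close> irreducible. The second Whitehead lemma gives a subalgebra \<open>T\<close> with \<open>T + Q = S\<close> and
  \<open>T \<inter> Q = Q'\<close>, and the first one (\<open>whitehead_first\<close>) conjugates \<open>T\<close> so that it contains \<open>G\<close>, which
  contradicts minimality. The second lemma is proved as \<open>ex_complement_if_trivial\<close> and
  \<open>ex_complement_if_nontrivial\<close>, according to the action of \<open>S\<close> on \<open>Q/Q'\<close>. Everything rests on a
  Casimir operator \<open>c\<close> that commutes with \<open>S\<close>. If \<open>c\<close> is invertible on the module in question,
  contraction with the invariant tensor that defines \<open>c\<close> exhibits \<open>c\<close> times a cocycle as a
  coboundary; if \<open>Q/Q'\<close> is trivial, the image of \<open>c\<close> on \<open>S/Q'\<close> is the complement itself.

  Casimir operators need nondegenerate trace forms, and these come from Cartan's criterion: if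
  the trace form of a representation vanishes on \<open>S\<close>, then \<open>S\<close> acts through a solvable algebra
  (\<open>cartan_criterion\<close>). Orthogonality to the trace form makes every element of \<open>[S, S]\<close> act
  nilpotently (\<open>nilpotent_if_trace_orthogonal\<close>, where the field must be algebraically closed and of
  characteristic \<open>0\<close>), and Engel's theorem does the rest.

  All modules that occur are subquotients \<open>W/P\<close> of \<open>M\<close> itself, and an algebra \<open>S/Q\<close> is represented
  by \<open>S\<close> with all statements read modulo \<open>Q\<close>; so no quotient has to be formed as a type.
\<close>

section \<open>Generalised eigenvectors\<close>

locale linear_endomorphisms = vector_space scale
  for scale :: "'f::field \<Rightarrow> 'v::ab_group_add \<Rightarrow> 'v"
begin

abbreviation lin :: "('v \<Rightarrow> 'v) \<Rightarrow> bool"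
  where "lin f \<equiv> Vector_Spaces.linear scale scale f"

lemma linI:
  assumes "\<And>x y. f (x + y) = f x + f y" "\<And>c x. f (scale c x) = scale c (f x)"
  shows "lin f"
  using assms vector_space_axioms by (simp add: Vector_Spaces.linear_iff)

lemma lin_add: "lin f \<Longrightarrow> f (x + y) = f x + f y"
  and lin_scale: "lin f \<Longrightarrow> f (scale c x) = scale c (f x)"
  by (simp_all add: Vector_Spaces.linear_iff)

lemma lin_0: "lin f \<Longrightarrow> f 0 = 0"
  using lin_scale[of f 0 0] by simp

lemma lin_diff: "lin f \<Longrightarrow> f (x - y) = f x - f y"
  using lin_add[of f "x - y" y] by (simp add: algebra_simps)

lemma lin_neg: "lin f \<Longrightarrow> f (- x) = - f x"
  using lin_diff[of f 0 x] by (simp add: lin_0)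

lemma lin_sum: "lin f \<Longrightarrow> f (sum g A) = (\<Sum>a\<in>A. f (g a))"
  by (induction A rule: infinite_finite_induct) (auto simp: lin_0 lin_add)

lemma lin_comp: "lin f \<Longrightarrow> lin g \<Longrightarrow> lin (f \<circ> g)"
  by (intro linI) (simp_all add: lin_add lin_scale)

lemma lin_funpow: "lin f \<Longrightarrow> lin (f ^^ n)"
  by (induction n) (auto intro: lin_comp linI)

lemma subspace_lin_preimage:
  assumes f: "lin f" and "subspace T"
  shows "subspace {v. f v \<in> T}"
  unfolding subspace_def using assms(2)
  by (simp add: lin_add[OF f] lin_scale[OF f] lin_0[OF f] subspace_0 subspace_add subspace_scale)

lemma subspace_image_modulo:
  assumes f: "lin f" and A: "subspace A" and P: "subspace P"
  shows "subspace {y. \<exists>x\<in>A. f x - y \<in> P}"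
  unfolding subspace_def
proof (intro conjI ballI allI)
  show "0 \<in> {y. \<exists>x\<in>A. f x - y \<in> P}"
    using subspace_0[OF A] subspace_0[OF P] by (auto simp: lin_0[OF f] intro!: bexI[of _ 0])
  fix y z assume "y \<in> {y. \<exists>x\<in>A. f x - y \<in> P}" "z \<in> {y. \<exists>x\<in>A. f x - y \<in> P}"
  then obtain a b where ab: "a \<in> A" "f a - y \<in> P" "b \<in> A" "f b - z \<in> P" by blast
  have "f (a + b) - (y + z) \<in> P"
    using subspace_add[OF P ab(2,4)] by (simp add: lin_add[OF f] algebra_simps)
  then show "y + z \<in> {y. \<exists>x\<in>A. f x - y \<in> P}" using subspace_add[OF A ab(1,3)] by blast
next
  fix c y assume "y \<in> {y. \<exists>x\<in>A. f x - y \<in> P}"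
  then obtain a where a: "a \<in> A" "f a - y \<in> P" by blast
  have "f (scale c a) - scale c y \<in> P"
    using subspace_scale[OF P a(2), of c] by (simp add: lin_scale[OF f] algebra_simps)
  then show "scale c y \<in> {y. \<exists>x\<in>A. f x - y \<in> P}" using subspace_scale[OF A a(1)] by blast
qed

abbreviation shift :: "('v \<Rightarrow> 'v) \<Rightarrow> 'f \<Rightarrow> 'v \<Rightarrow> 'v"
  where "shift T a \<equiv> (\<lambda>w. T w - scale a w)"

lemma lin_shift: "lin T \<Longrightarrow> lin (shift T a)"
  by (intro linI) (simp_all add: lin_add lin_scale algebra_simps)

lemma shift_commute:
  fixes a b :: 'f
  shows "lin T \<Longrightarrow> shift T a (shift T b v) = shift T b (shift T a v)"
  by (simp add: lin_diff lin_scale algebra_simps)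

lemma funpow_commute_map:
  assumes "\<And>v. f (g v) = g (f v)"
  shows "(f ^^ n) (g v) = g ((f ^^ n) v)"
  by (induction n) (auto simp: assms)

lemma shift_pow_commute:
  assumes "lin T"
  shows "(shift T a ^^ k) ((shift T b ^^ m) v) = (shift T b ^^ m) ((shift T a ^^ k) v)"
  by (rule funpow_commute_map, rule funpow_commute_map[symmetric], rule shift_commute[OF assms])

lemma funpow_eq_0_mono:
  assumes "lin f" "(f ^^ m) v = 0" "m \<le> n"
  shows "(f ^^ n) v = 0"
proof -
  have "(f ^^ n) v = (f ^^ (n - m)) ((f ^^ m) v)"
    using assms(3) by (simp flip: funpow_add o_apply[of "f ^^ (n-m)" "f ^^ m"])
  then show ?thesis using assms by (simp add: lin_0 lin_funpow)
qed

text \<open>An invariant subspace cannot separate a generalised eigenvector from its image under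
  \<open>T - b\<close> for a wrong eigenvalue \<open>b\<close>, because \<open>T - b\<close> is \<open>a - b\<close> plus the locally nilpotent
  \<open>T - a\<close>. With \<open>X = 0\<close> this is the independence of the generalised eigenspaces.\<close>

lemma mem_if_shift_mem:
  assumes T: "lin T" and X: "subspace X" "\<And>v. v \<in> X \<Longrightarrow> T v \<in> X"
    and ab: "a \<noteq> b" and "(shift T a ^^ k) v = 0" "shift T b v \<in> X"
  shows "v \<in> X"
  using assms(5,6)
proof (induction k arbitrary: v)
  case 0
  then show ?case using X by (simp add: subspace_0)
next
  case (Suc k)
  have "shift T b (shift T a v) \<in> X"
    using shift_commute[OF T, where a = b and b = a and v = v] Suc.prems(2) X
      by (auto intro: subspace_diff subspace_scale)
  moreover have "(shift T a ^^ k) (shift T a v) = 0"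
    using Suc.prems(1) by (simp only: funpow_Suc_right o_apply)
  ultimately have "shift T a v \<in> X" using Suc.IH by blast
  then have "scale (a - b) v \<in> X"
    using subspace_diff[OF X(1) Suc.prems(2), of "shift T a v"] by (simp add: algebra_simps)
  then have "scale (inverse (a - b)) (scale (a - b) v) \<in> X" using X by (blast intro: subspace_scale)
  then show ?case using ab by simp
qed

lemma mem_if_shift_pow_mem:
  assumes T: "lin T" and X: "subspace X" "\<And>v. v \<in> X \<Longrightarrow> T v \<in> X"
    and "a \<noteq> b" and v: "(shift T a ^^ k) v = 0" and "(shift T b ^^ m) v \<in> X"
  shows "v \<in> X"
  using assms(6)
proof (induction m)
  case (Suc m)
  have "(shift T a ^^ k) ((shift T b ^^ m) v) = (shift T b ^^ m) ((shift T a ^^ k) v)"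
    by (rule shift_pow_commute[OF T])
  then have "(shift T a ^^ k) ((shift T b ^^ m) v) = 0"
    using v by (simp add: lin_0 lin_funpow lin_shift T)
  then have "(shift T b ^^ m) v \<in> X"
    using Suc.prems mem_if_shift_mem[OF T X \<open>a \<noteq> b\<close>] by simp
  then show ?case by (rule Suc.IH)
qed simp

lemma components_mem:
  assumes T: "lin T" and X: "subspace X" "\<And>v. v \<in> X \<Longrightarrow> T v \<in> X"
    and "finite E" "\<And>a. a \<in> E \<Longrightarrow> (shift T a ^^ k) (z a) = 0" "(\<Sum>a\<in>E. z a) \<in> X" "a \<in> E"
  shows "z a \<in> X"
  using assms(4-)
proof (induction E arbitrary: z a)
  case (insert b E)
  let ?g = "shift T b ^^ k"
  have g: "lin ?g" by (intro lin_funpow lin_shift T)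
  have gX: "(shift T b ^^ n) v \<in> X" if "v \<in> X" for v n
    using that X by (induction n) (auto intro: subspace_diff subspace_scale)
  have "?g (\<Sum>a\<in>insert b E. z a) = (\<Sum>a\<in>E. ?g (z a))"
    using insert by (simp add: lin_add[OF g] lin_sum[OF g])
  then have sum: "(\<Sum>a\<in>E. ?g (z a)) \<in> X" using gX insert.prems(2) by metis
  have kill: "(shift T a ^^ k) (?g (z a)) = 0" if "a \<in> E" for a
  proof -
    have "(shift T a ^^ k) (?g (z a)) = ?g ((shift T a ^^ k) (z a))"
      by (rule shift_pow_commute[OF T])
    then show ?thesis using insert.prems(1)[of a] that by (simp add: lin_0[OF g])
  qed
  have E: "z c \<in> X" if c: "c \<in> E" for c
  proof -
    have "c \<noteq> b" using c insert.hyps by blast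
    moreover have "?g (z c) \<in> X" using insert.IH[OF kill sum c] .
    ultimately show ?thesis
      using insert.prems(1)[of c] c mem_if_shift_pow_mem[OF T X] by blast
  qed
  have "(\<Sum>a\<in>insert b E. z a) - (\<Sum>a\<in>E. z a) \<in> X"
    by (rule subspace_diff[OF X(1) insert.prems(2) subspace_sum[OF X(1)]]) (rule E)
  then have "z b \<in> X" unfolding sum.insert[OF insert.hyps] by simp
  then show ?case using E insert.prems(3) by blast
qed simp

text \<open>The operator that multiplies the generalised \<open>a\<close>-eigenspace by \<open>h a\<close>, where \<open>h 0 = 0\<close>, is a
  polynomial in \<open>T\<close> without constant term; so it maps \<open>B\<close> into \<open>A\<close> because \<open>T\<close> does. Directly, the
  component of a vector of \<open>B\<close> for an eigenvalue \<open>a \<noteq> 0\<close> lies in \<open>B\<close>, its image under \<open>T\<close>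
  lies in \<open>A\<close>, and hence so does the component itself.\<close>

lemma weighted_sum_mem:
  assumes T: "lin T" and A: "subspace A" and B: "subspace B" and "A \<subseteq> B"
    and TB: "\<And>b. b \<in> B \<Longrightarrow> T b \<in> A" and I: "finite I"
    and z: "\<And>i. i \<in> I \<Longrightarrow> (shift T (c i) ^^ k) (z i) = 0" and "(\<Sum>i\<in>I. z i) \<in> B"
    and h: "h 0 = (0::'f)"
  shows "(\<Sum>i\<in>I. scale (h (c i)) (z i)) \<in> A"
proof -
  define y where "y a = (\<Sum>i | i \<in> I \<and> c i = a. z i)" for a
  have y: "(shift T a ^^ k) (y a) = 0" for a
  proof -
    have "(shift T a ^^ k) (y a) = (\<Sum>i | i \<in> I \<and> c i = a. (shift T a ^^ k) (z i))"
      unfolding y_def by (intro lin_sum lin_funpow lin_shift T)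
    also have "\<dots> = 0" by (intro sum.neutral) (use z in auto)
    finally show ?thesis .
  qed
  have "(\<Sum>a\<in>c ` I. y a) = (\<Sum>i\<in>I. z i)"
    unfolding y_def by (rule sum.image_gen[OF I, symmetric])
  then have yB: "y a \<in> B" if "a \<in> c ` I" for a
    by (intro components_mem[OF T B, of "c ` I" k y]) (use that assms y in auto)
  have yA: "scale (h a) (y a) \<in> A" if "a \<in> c ` I" for a
  proof (cases "a = 0")
    case True
    then show ?thesis using h A by (simp add: subspace_0)
  next
    case False
    have "y a \<in> A"
      by (rule mem_if_shift_mem[OF T A _ False y]) (use TB yB that \<open>A \<subseteq> B\<close> in auto)
    then show ?thesis using A by (blast intro: subspace_scale)
  qed
  have "(\<Sum>i\<in>I. scale (h (c i)) (z i)) =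
    (\<Sum>a\<in>c ` I. \<Sum>i | i \<in> I \<and> c i = a. scale (h (c i)) (z i))"
    by (rule sum.image_gen[OF I])
  also have "\<dots> = (\<Sum>a\<in>c ` I. scale (h a) (y a))"
    by (intro sum.cong refl) (simp add: y_def scale_sum_right)
  also have "\<dots> \<in> A" using yA A by (intro subspace_sum)
  finally show ?thesis .
qed

lemma shift_preimage:
  assumes T: "lin T" and ab: "a \<noteq> b" and "(shift T a ^^ k) w = 0"
  shows "\<exists>u. (shift T a ^^ k) u = 0 \<and> shift T b u = w"
  using assms(3)
proof (induction k arbitrary: w)
  case 0
  then show ?case by (intro exI[of _ 0]) (simp add: lin_0[OF T])
next
  case (Suc k)
  let ?c = "inverse (a - b)"
  have "(shift T a ^^ k) (shift T a w) = 0"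
    using Suc.prems by (simp only: funpow_Suc_right o_apply)
  then obtain u where u: "(shift T a ^^ k) u = 0" "shift T b u = shift T a w"
    using Suc.IH by blast
  have p: "lin (shift T a ^^ Suc k)" by (intro lin_funpow lin_shift T)
  have "(shift T a ^^ Suc k) u = 0"
    using funpow_eq_0_mono[OF lin_shift[OF T] u(1), of "Suc k"] by simp
  then have 1: "(shift T a ^^ Suc k) (scale ?c (w - u)) = 0"
    using Suc.prems by (simp only: lin_scale[OF p] lin_diff[OF p]) simp
  have "T w - scale a w + scale (a - b) w = T w - scale b w" by (simp add: algebra_simps)
  then have "shift T b (w - u) = scale (a - b) w"
    using u(2) by (simp add: lin_diff[OF T] algebra_simps)
  moreover have "shift T b (scale ?c (w - u)) = scale ?c (shift T b (w - u))"
    by (rule lin_scale[OF lin_shift[OF T]])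
  ultimately have "shift T b (scale ?c (w - u)) = w" using ab by simp
  with 1 show ?case by blast
qed

definition gen_eigenvectors :: "('v \<Rightarrow> 'v) \<Rightarrow> 'v set"
  where "gen_eigenvectors T = {v. \<exists>a k. (shift T a ^^ k) v = 0}"

text \<open>\<open>T - b\<close> is bijective on the generalised eigenspaces for \<open>a \<noteq> b\<close>. So a preimage of a sum of
  generalised eigenvectors can be chosen up to one summand, which then belongs to \<open>b\<close>.\<close>

lemma span_gen_eigenvectors_if_shift:
  assumes T: "lin T" and v: "shift T b v \<in> span (gen_eigenvectors T)"
  shows "v \<in> span (gen_eigenvectors T)"
proof -
  define G where "G = span (gen_eigenvectors T)"
  have "\<exists>u\<in>G. \<exists>k. (shift T b ^^ k) (w - shift T b u) = 0"
    if "w \<in> span (gen_eigenvectors T)" for w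
    using that
  proof (induction rule: span_induct_alt)
    case base
    show ?case by (intro bexI[of _ 0] exI[of _ 0]) (auto simp: G_def lin_0[OF T] span_zero)
  next
    case (step c x y)
    from step.IH obtain u k where u: "u \<in> G" "(shift T b ^^ k) (y - shift T b u) = 0" by blast
    from step.hyps obtain a m where x: "(shift T a ^^ m) x = 0" by (auto simp: gen_eigenvectors_def)
    show ?case
    proof (cases "a = b")
      case True
      let ?n = "max k m"
      have p: "lin (shift T b ^^ ?n)" by (intro lin_funpow lin_shift T)
      have "(shift T b ^^ ?n) x = 0" "(shift T b ^^ ?n) (y - shift T b u) = 0"
        using x True u(2) funpow_eq_0_mono[OF lin_shift[OF T, of b], of m x ?n]
          funpow_eq_0_mono[OF lin_shift[OF T, of b], of k "y - shift T b u" ?n] by auto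
      then have "(shift T b ^^ ?n) (scale c x + (y - shift T b u)) = 0"
        by (simp only: lin_add[OF p] lin_scale[OF p]) simp
      moreover have "scale c x + (y - shift T b u) = scale c x + y - shift T b u"
        by (simp add: algebra_simps)
      ultimately show ?thesis using u(1) by metis
    next
      case False
      obtain x' where x': "(shift T a ^^ m) x' = 0" "shift T b x' = x"
        using shift_preimage[OF T False x] by blast
      have "scale c x' + u \<in> G"
        using u(1) x'(1) unfolding G_def
        by (auto simp: gen_eigenvectors_def intro!: span_add span_scale intro: span_base)
      moreover have "shift T b (scale c x' + u) = scale c x + shift T b u"
        by (simp only: lin_add[OF lin_shift[OF T]] lin_scale[OF lin_shift[OF T]] x'(2))
      then have "scale c x + y - shift T b (scale c x' + u) = y - shift T b u" by simp
      ultimately show ?thesis using u(2) by metis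
    qed
  qed
  from this[OF v] obtain u k where u: "u \<in> G" "(shift T b ^^ k) (shift T b v - shift T b u) = 0"
    by blast
  have "(shift T b ^^ Suc k) (v - u) = 0"
    unfolding funpow_Suc_right o_apply using u(2) by (simp only: lin_diff[OF lin_shift[OF T]])
  then have "v - u \<in> G" unfolding G_def gen_eigenvectors_def by (intro span_base) blast
  then have "(v - u) + u \<in> G" using u(1) unfolding G_def by (intro span_add)
  then show ?thesis by (simp add: G_def)
qed

end

text \<open>The value at \<open>v\<close> of the operator \<open>p(T)\<close>, for a polynomial \<open>p\<close> of degree less than \<open>n\<close>; an
  explicit bound keeps the expression linear in \<open>p\<close>.\<close>

definition (in linear_endomorphisms) poly_op :: "nat \<Rightarrow> 'f poly \<Rightarrow> ('v \<Rightarrow> 'v) \<Rightarrow> 'v \<Rightarrow> 'v"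
  where "poly_op n p T v = (\<Sum>i<n. scale (coeff p i) ((T ^^ i) v))"

lemma (in linear_endomorphisms) poly_op_root_factor:
  assumes T: "lin T" and n: "degree q < n"
  shows "poly_op (Suc n) ([:- a, 1:] * q) T v = poly_op n q T (shift T a v)"
proof -
  have "poly_op (Suc n) ([:- a, 1:] * q) T v =
    poly_op (Suc n) (pCons 0 q) T v - scale a (poly_op (Suc n) q T v)"
    unfolding poly_op_def scale_sum_right
    by (subst sum_subtractf[symmetric], rule sum.cong) (simp_all add: scale_left_diff_distrib)
  also have "poly_op (Suc n) (pCons 0 q) T v = poly_op n q T (T v)"
    unfolding poly_op_def sum.lessThan_Suc_shift by (simp del: funpow.simps add: funpow_Suc_right)
  also have "poly_op (Suc n) q T v = poly_op n q T v"
    using n by (simp add: poly_op_def coeff_eq_0)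
  also have "poly_op n q T (T v) - scale a (poly_op n q T v) = poly_op n q T (shift T a v)"
    by (simp add: poly_op_def lin_diff[OF lin_funpow[OF T]] lin_scale[OF lin_funpow[OF T]]
        scale_sum_right sum_subtractf scale_right_diff_distrib mult.commute)
  finally show ?thesis .
qed

locale fin_dim_alg_closed = linear_endomorphisms scale + finite_dimensional_vector_space scale Basis
  for scale :: "'f::{alg_closed_field, field_char_0} \<Rightarrow> 'v::ab_group_add \<Rightarrow> 'v" and Basis
begin

lemma span_gen_eigenvectors_if_annihilated:
  assumes T: "lin T"
  shows "p \<noteq> 0 \<Longrightarrow> degree p < n \<Longrightarrow> poly_op n p T v = 0 \<Longrightarrow> v \<in> span (gen_eigenvectors T)"
proof (induction n arbitrary: p v)
  case (Suc n)
  show ?case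
  proof (cases "degree p = 0")
    case True
    then obtain c where c: "p = [:c:]" "c \<noteq> 0" using Suc.prems(1)
      by (metis degree_eq_zeroE pCons_eq_0_iff)
    have "poly_op (Suc n) p T v = scale c v"
      unfolding poly_op_def sum.lessThan_Suc_shift c(1) by simp
    then have "v = 0" using Suc.prems(3) c(2) by simp
    then show ?thesis by (simp add: span_zero)
  next
    case False
    then obtain a where "poly p a = 0" using alg_closed_imp_poly_has_root[of p] by auto
    then obtain q where q: "p = [:- a, 1:] * q" by (auto simp: poly_eq_0_iff_dvd dvd_def)
    have "q \<noteq> 0" using q Suc.prems(1) by auto
    then have "degree p = Suc (degree q)" unfolding q by (subst degree_mult_eq) auto
    then have deg: "degree q < n" using Suc.prems(2) by simp
    have "poly_op n q T (shift T a v) = 0"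
      using Suc.prems(3) unfolding q poly_op_root_factor[OF T deg] .
    then have "shift T a v \<in> span (gen_eigenvectors T)" using Suc.IH[OF \<open>q \<noteq> 0\<close> deg] by blast
    then show ?thesis by (rule span_gen_eigenvectors_if_shift[OF T])
  qed
qed simp

text \<open>The vectors \<open>T\<^sup>i v\<close>, for \<open>i\<close> up to the dimension, are too many to be independent; if two of
  them coincide, the difference of the two monomials annihilates \<open>v\<close>.\<close>

lemma annihilating_poly:
  assumes T: "lin T"
  shows "\<exists>p n. p \<noteq> 0 \<and> degree p < n \<and> poly_op n p T v = 0"
proof (cases "inj_on (\<lambda>i. (T ^^ i) v) {..dimension}")
  case False
  then obtain i j where ij: "(T ^^ i) v = (T ^^ j) v" "i < j" "j \<le> dimension"
    unfolding inj_on_def by (metis atMost_iff linorder_neq_iff)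
  let ?p = "monom 1 i - monom (1::'f) j"
  have c: "coeff ?p k = (if k = i then 1 else 0) - (if k = j then 1 else 0)" for k
    by (simp add: eq_commute)
  have "poly_op (Suc j) ?p T v = 
     (\<Sum>k<Suc j. if k = i then (T ^^ k) v else 0) - (\<Sum>k<Suc j. if k = j then (T ^^ k) v else 0)"
    unfolding poly_op_def c by (subst sum_subtractf[symmetric], rule sum.cong) auto
  also have "\<dots> = 0" using ij by (simp add: sum.delta' del: sum.lessThan_Suc)
  finally have "poly_op (Suc j) ?p T v = 0" .
  moreover have "coeff ?p i \<noteq> 0" using ij c[of i] by simp
  then have "?p \<noteq> 0" by (metis coeff_0)
  moreover have "degree ?p < Suc j"
    using ij by (intro le_imp_less_Suc degree_diff_le) (auto intro: order_trans[OF degree_monom_le])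
  ultimately show ?thesis by blast
next
  case True
  let ?S = "(\<lambda>i. (T ^^ i) v) ` {..dimension}"
  have "card ?S = Suc dimension" using card_image[OF True] by simp
  then have "dependent ?S"
    using independent_card_le_dim[of ?S UNIV] by (auto simp: dimension_def)
  then obtain u w where u: "(\<Sum>w\<in>?S. scale (u w) w) = 0" "w \<in> ?S" "u w \<noteq> 0"
    by (auto simp: dependent_finite)
  define p where "p = (\<Sum>i\<le>dimension. monom (u ((T ^^ i) v)) i)"
  have c: "coeff p k = (if k \<le> dimension then u ((T ^^ k) v) else 0)" for k
    unfolding p_def coeff_sum by (auto simp: eq_commute[of _ k])
  have "poly_op (Suc dimension) p T v = (\<Sum>i\<le>dimension. scale (u ((T ^^ i) v)) ((T ^^ i) v))"
    unfolding poly_op_def lessThan_Suc_atMost by (intro sum.cong) (auto simp: c)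
  also have "\<dots> = 0" using u(1) by (simp add: sum.reindex[OF True])
  finally have "poly_op (Suc dimension) p T v = 0" .
  moreover have "p \<noteq> 0" using u c by (metis (no_types, lifting) atMost_iff coeff_0 imageE)
  moreover have "degree p < Suc dimension" using c by (intro le_imp_less_Suc degree_le) auto
  ultimately show ?thesis by blast
qed

lemma span_gen_eigenvectors: "lin T \<Longrightarrow> span (gen_eigenvectors T) = UNIV"
  using annihilating_poly span_gen_eigenvectors_if_annihilated by blast

text \<open>The generalised eigenspace decomposition, as a resolution of the identity by projections.\<close>

lemma primary_decomposition:
  assumes T: "lin T"
  obtains E \<pi> N where "finite E" "\<And>a. lin (\<pi> a)" "\<And>v. (\<Sum>a\<in>E. \<pi> a v) = v"
    "\<And>a v. (shift T a ^^ N) (\<pi> a v) = 0"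
    "\<And>a v. \<pi> a (\<pi> a v) = \<pi> a v"
    "\<And>a v. a \<in> E \<Longrightarrow> \<pi> a (T v) = T (\<pi> a v)"
proof -
  obtain B where B: "B \<subseteq> gen_eigenvectors T" "independent B" "gen_eigenvectors T \<subseteq> span B"
    using maximal_independent_subset[of "gen_eigenvectors T"] by blast
  have BU: "span B = UNIV"
    using span_gen_eigenvectors[OF T] span_minimal[OF B(3)] by auto
  have fB: "finite B" using B(2) by (rule finiteI_independent)
  have "\<forall>b\<in>B. \<exists>a k. (shift T a ^^ k) b = 0" using B(1) by (auto simp: gen_eigenvectors_def)
  then obtain ev k where ev: "\<And>b. b \<in> B \<Longrightarrow> (shift T (ev b) ^^ k b) b = 0" by metis
  define N where "N = Max (insert 0 (k ` B))"
  have evN: "(shift T (ev b) ^^ N) b = 0" if "b \<in> B" for b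
    by (rule funpow_eq_0_mono[OF lin_shift[OF T] ev[OF that]]) (use fB that in \<open>simp add: N_def\<close>)
  define \<pi> where "\<pi> a v = (\<Sum>b | b \<in> B \<and> ev b = a. scale (representation B v b) b)" for a v
  have rep: "representation B (x + y) b = representation B x b + representation B y b"
    "representation B (scale c x) b = c * representation B x b" for x y c b
    using B(2) BU by (simp_all add: representation_add representation_scale)
  have lin\<pi>: "lin (\<pi> a)" for a
    by (rule linI) (simp_all add: \<pi>_def rep scale_left_distrib sum.distrib scale_sum_right)
  have sum: "(\<Sum>a\<in>ev ` B. \<pi> a v) = v" for v
  proof -
    have "(\<Sum>a\<in>ev ` B. \<pi> a v) = (\<Sum>b\<in>B. scale (representation B v b) b)"
      unfolding \<pi>_def by (rule sum.image_gen[OF fB, symmetric])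
    then show ?thesis using sum_representation_eq[of B v B] B(2) BU fB by simp
  qed
  have kill: "(shift T a ^^ N) (\<pi> a v) = 0" for a v
  proof -
    have p: "lin (shift T a ^^ N)" by (intro lin_funpow lin_shift T)
    show ?thesis unfolding \<pi>_def lin_sum[OF p] lin_scale[OF p]
      by (intro sum.neutral) (use evN in auto)
  qed
  have pb: "\<pi> a b = (if ev b = a then b else 0)" if "b \<in> B" for a b
  proof -
    have "\<pi> a b = (\<Sum>c | c \<in> B \<and> ev c = a. if c = b then b else 0)"
      unfolding \<pi>_def by (intro sum.cong) (use that B(2) in \<open>auto simp: representation_basis\<close>)
    then show ?thesis using that fB by simp
  qed
  have idem: "\<pi> a (\<pi> a v) = \<pi> a v" for a v
  proof -
    have "\<pi> a (\<pi> a v) = (\<Sum>b | b \<in> B \<and> ev b = a. scale (representation B v b) (\<pi> a b))"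
      unfolding \<pi>_def[of a v] by (simp add: lin_sum[OF lin\<pi>] lin_scale[OF lin\<pi>])
    also have "\<dots> = \<pi> a v" unfolding \<pi>_def[of a v] by (intro sum.cong) (auto simp: pb)
    finally show ?thesis .
  qed
  \<comment> \<open>Both families \<open>\<pi> a (T v)\<close> and \<open>T (\<pi> a v)\<close> decompose \<open>T v\<close> into generalised eigenvectors.\<close>
  have comm: "\<pi> a (T v) = T (\<pi> a v)" if "a \<in> ev ` B" for a v
  proof -
    let ?z = "\<lambda>a. \<pi> a (T v) - T (\<pi> a v)"
    have z: "(shift T a ^^ N) (?z a) = 0" for a
    proof -
      have p: "lin (shift T a ^^ N)" by (intro lin_funpow lin_shift T)
      have "(shift T a ^^ N) (T (\<pi> a v)) = T ((shift T a ^^ N) (\<pi> a v))"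
        by (rule funpow_commute_map) (simp add: lin_diff[OF T] lin_scale[OF T])
      then show ?thesis by (simp add: lin_diff[OF p] kill lin_0[OF T])
    qed
    have "(\<Sum>a\<in>ev ` B. ?z a) = 0"
      unfolding sum_subtractf sum lin_sum[OF T, symmetric] by simp
    then have "(\<Sum>a\<in>ev ` B. ?z a) \<in> {0}" by blast
    then have "?z a \<in> {0}"
      using components_mem[OF T subspace_single_0 _ finite_imageI[OF fB] z _ that] lin_0[OF T]
      by blast
    then show ?thesis by simp
  qed
  show thesis by (rule that[of "ev ` B" \<pi> N]) (use fB lin\<pi> sum kill idem comm in auto)
qed

end

section \<open>Traces\<close>

lemma (in linear_endomorphisms) funpow_diff_eq_0:
  assumes L: "lin L" and R: "lin R" and LR: "\<And>z. L (R z) = R (L z)"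
  shows "(L ^^ i) z = 0 \<Longrightarrow> (R ^^ j) z = 0 \<Longrightarrow> ((\<lambda>z. L z - R z) ^^ (i + j)) z = 0"
proof (induction "i + j" arbitrary: i j z)
  case (Suc n)
  let ?D = "\<lambda>z. L z - R z"
  have D: "lin ?D" using L R by (intro linI) (simp_all add: lin_add lin_scale algebra_simps)
  show ?case
  proof (cases "i = 0 \<or> j = 0")
    case True
    then have "z = 0" using Suc.prems by auto
    then show ?thesis by (simp add: lin_0 lin_funpow[OF D])
  next
    case False
    then obtain i' j' where ij: "i = Suc i'" "j = Suc j'" by (metis not0_implies_Suc)
    have "(L ^^ i') (L z) = 0" "(R ^^ j') (R z) = 0"
      using Suc.prems unfolding ij by (simp_all only: funpow_Suc_right o_apply)
    moreover have "(R ^^ j) (L z) = 0" "(L ^^ i) (R z) = 0"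
      using Suc.prems LR by (simp_all only: funpow_commute_map[of R L] funpow_commute_map[of L R])
        (simp_all add: lin_0 L R)
    ultimately have "(?D ^^ n) (L z) = 0" "(?D ^^ n) (R z) = 0"
      using Suc.hyps(1)[of i' j "L z"] Suc.hyps(1)[of i j' "R z"] Suc.hyps(2) ij by auto
    moreover have "(?D ^^ (i + j)) z = (?D ^^ n) (?D z)"
      unfolding Suc.hyps(2)[symmetric] funpow_Suc_right by simp
    ultimately show ?thesis by (simp add: lin_diff[OF lin_funpow[OF D]])
  qed
qed simp

lemma ex_rat_linear_functional:
  fixes a :: "'f::field_char_0"
  assumes "a \<noteq> 0"
  obtains h :: "'f \<Rightarrow> rat" where "\<And>x y. h (x + y) = h x + h y"
    "\<And>q x. h (of_rat q * x) = q * h x" "h a \<noteq> 0"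
proof -
  interpret Q: vector_space "\<lambda>q (x::'f). of_rat q * x"
    by unfold_locales (simp_all add: algebra_simps of_rat_add of_rat_mult)
  have ind: "Q.independent {a}" using assms by simp
  define H where "H = Q.extend_basis {a}"
  have H: "Q.independent H" "Q.span H = UNIV" "a \<in> H"
    using Q.independent_extend_basis[OF ind] Q.span_extend_basis[OF ind]
      Q.extend_basis_superset[OF ind] unfolding H_def by auto
  define h where "h x = Q.representation H x a" for x
  show thesis
  proof (rule that[of h])
    show "h (x + y) = h x + h y" for x y
      unfolding h_def using H by (simp add: Q.representation_add)
    show "h (of_rat q * x) = q * h x" for q x
      unfolding h_def using H Q.representation_scale[of H x q] by simp
    show "h a \<noteq> 0" unfolding h_def using H Q.representation_basis[of H a] by simp
  qed
qed

context linear_endomorphisms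
begin

text \<open>The projections that model the quotient \<open>(A + B)/A\<close> by a complement of \<open>A\<close> inside \<open>B\<close>.\<close>

lemma ex_projection:
  assumes A: "subspace A" and B: "subspace B"
  obtains p where "lin p" "\<And>v. p v \<in> B" "\<And>a. a \<in> A \<Longrightarrow> p a = 0"
    "\<And>b. b \<in> B \<Longrightarrow> b - p b \<in> A" "\<And>v. p (p v) = p v"
proof -
  obtain B0 where B0: "B0 \<subseteq> A" "independent B0" "A \<subseteq> span B0"
    using maximal_independent_subset[of A] by blast
  have B0B: "B0 \<subseteq> B0 \<union> B" by blast
  obtain B1 where B1: "B0 \<subseteq> B1" "B1 \<subseteq> B0 \<union> B" "independent B1" "B0 \<union> B \<subseteq> span B1"
    using maximal_independent_subset_extend[OF B0B B0(2)] by blast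
  define C where "C = extend_basis B1"
  have C: "independent C" "span C = UNIV" "B1 \<subseteq> C"
    using independent_extend_basis[OF B1(3)] span_extend_basis[OF B1(3)]
      extend_basis_superset[OF B1(3)] unfolding C_def by auto
  interpret pr: vector_space_pair scale scale by unfold_locales
  define p where "p = pr.construct C (\<lambda>b. if b \<in> B1 - B0 then b else 0)"
  have p: "lin p" unfolding p_def using pr.linear_construct[OF C(1)] by blast
  have pC: "p b = (if b \<in> B1 - B0 then b else 0)" if "b \<in> C" for b
    unfolding p_def using pr.construct_basis[OF C(1) that] by simp
  have ind: "v \<in> T" if "v \<in> span S" "S \<subseteq> T" "subspace T" for v S T
    using that span_minimal by blast
  have sub_vimage: "subspace {v. p v \<in> T}" "subspace {v. v - p v \<in> T}"
    "subspace {v. p v = 0}" "subspace {v. p (p v) = p v}" if "subspace T" for T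
    using that unfolding subspace_def
    by (auto simp: lin_add[OF p] lin_scale[OF p] lin_0[OF p] add_diff_add
        simp flip: scale_right_diff_distrib)
  have pB: "p v \<in> B" for v
  proof -
    have "C \<subseteq> {v. p v \<in> B}" using B1(2) pC B by (auto simp: subspace_0)
    then have "v \<in> {v. p v \<in> B}" using C(2) sub_vimage(1)[OF B] ind by blast
    then show ?thesis by simp
  qed
  have pA: "p v = 0" if "v \<in> A" for v
  proof -
    have "B0 \<subseteq> {v. p v = 0}" using B1(1) C(3) pC by auto
    then have "v \<in> {v. p v = 0}" using ind[of v B0] B0(3) that sub_vimage(3)[OF A] by blast
    then show ?thesis by simp
  qed
  have pq: "v - p v \<in> A" if "v \<in> B" for v
  proof -
    have "b - p b \<in> A" if "b \<in> B1" for b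
      using pC[OF subsetD[OF C(3) that]] that B0(1) subspace_0[OF A] by auto
    then have "B1 \<subseteq> {v. v - p v \<in> A}" by blast
    then have "v \<in> {v. v - p v \<in> A}" using ind[of v B1] B1(4) that sub_vimage(2)[OF A] by blast
    then show ?thesis by simp
  qed
  have pp: "p (p v) = p v" for v
  proof -
    have "C \<subseteq> {v. p (p v) = p v}" using pC lin_0[OF p] by auto
    then have "v \<in> {v. p (p v) = p v}" using C(2) sub_vimage(4)[OF A] ind by blast
    then show ?thesis by simp
  qed
  show thesis by (rule that[OF p pB pA pq pp])
qed

end

context fin_dim_alg_closed
begin

definition trace :: "('v \<Rightarrow> 'v) \<Rightarrow> 'f"
  where "trace f = (\<Sum>b\<in>Basis. representation Basis (f b) b)"

lemma rep_add: "representation Basis (x + y) b = representation Basis x b +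
    representation Basis y b"
  and rep_scale: "representation Basis (scale c x) b = c * representation Basis x b"
  by (simp_all add: representation_add representation_scale independent_Basis span_Basis)

lemma rep_sum: "representation Basis (sum g A) b = (\<Sum>i\<in>A. representation Basis (g i) b)"
  by (simp add: representation_sum independent_Basis span_Basis)

lemma basis_expand: "(\<Sum>b\<in>Basis. scale (representation Basis x b) b) = x"
  by (rule sum_representation_eq) (auto simp: independent_Basis span_Basis finite_Basis)

lemma trace_add: "trace (\<lambda>v. f v + g v) = trace f + trace g"
  by (simp add: trace_def rep_add sum.distrib)

lemma trace_scale: "trace (\<lambda>v. scale c (f v)) = c * trace f"
  by (simp add: trace_def rep_scale sum_distrib_left)

lemma trace_diff: "trace (\<lambda>v. f v - g v) = trace f - trace g"
  using trace_add[of "\<lambda>v. f v - g v" g] by (simp add: algebra_simps)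

lemma trace_0: "trace (\<lambda>v. 0) = 0"
  using trace_diff[of id id] by simp

lemma trace_sum: "trace (\<lambda>v. \<Sum>i\<in>I. f i v) = (\<Sum>i\<in>I. trace (f i))"
  by (simp add: trace_def rep_sum sum.swap[of _ Basis])

lemma trace_comm:
  assumes f: "lin f" and g: "lin g"
  shows "trace (f \<circ> g) = trace (g \<circ> f)"
proof -
  have expand: "trace (f \<circ> g) =
    (\<Sum>b\<in>Basis. \<Sum>c\<in>Basis. representation Basis (g b) c * representation Basis (f c) b)"
    if f: "lin f" for f g
  proof -
    have "f (g b) = (\<Sum>c\<in>Basis. scale (representation Basis (g b) c) (f c))" for b
      by (subst basis_expand[of "g b", symmetric]) (simp only: lin_sum[OF f] lin_scale[OF f])
    then show ?thesis by (simp add: trace_def rep_sum rep_scale)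
  qed
  show ?thesis
    unfolding expand[OF f, of g] expand[OF g, of f]
    by (subst sum.swap) (simp add: mult.commute)
qed

lemma trace_rank_one:
  assumes "\<And>x y. \<phi> (x + y) = \<phi> x + \<phi> y" "\<And>c x. \<phi> (scale c x) = c * \<phi> x"
  shows "trace (\<lambda>v. scale (\<phi> v) u) = \<phi> u"
proof -
  have "\<phi> 0 = 0" using assms(2)[of 0 0] by simp
  then have sum: "\<phi> (sum g A) = (\<Sum>i\<in>A. \<phi> (g i))" for g A
    by (induction A rule: infinite_finite_induct) (auto simp: assms(1))
  have "\<phi> u = \<phi> (\<Sum>b\<in>Basis. scale (representation Basis u b) b)" by (simp add: basis_expand)
  also have "\<dots> = trace (\<lambda>v. scale (\<phi> v) u)"
    unfolding sum trace_def by (simp add: assms(2) rep_scale mult.commute)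
  finally show ?thesis by simp
qed

lemma trace_projection:
  assumes p: "lin p" and idem: "\<And>v. p (p v) = p v"
  obtains n where "trace p = of_nat n" "n = 0 \<Longrightarrow> \<forall>v. p v = 0"
proof -
  obtain C where C: "C \<subseteq> range p" "independent C" "range p \<subseteq> span C"
    using maximal_independent_subset[of "range p"] by blast
  have fC: "finite C" using C(2) by (rule finiteI_independent)
  have inC: "p v \<in> span C" for v using C(3) by blast
  have "p v = (\<Sum>c\<in>C. scale (representation C (p v) c) c)" for v
    by (rule sum_representation_eq[OF C(2) inC fC order.refl, symmetric])
  then have "trace p = trace (\<lambda>v. \<Sum>c\<in>C. scale (representation C (p v) c) c)"
    by (intro arg_cong[where f = trace] ext)
  also have "\<dots> = (\<Sum>c\<in>C. representation C (p c) c)"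
    unfolding trace_sum
    by (intro sum.cong trace_rank_one refl)
      (simp_all add: lin_add[OF p] lin_scale[OF p] representation_add representation_scale C(2) inC)
  also have "\<dots> = (\<Sum>c\<in>C. 1)"
  proof (intro sum.cong refl)
    fix c assume c: "c \<in> C"
    then have "p c = c" using C(1) idem by auto
    then show "representation C (p c) c = 1" using c C(2) by (simp add: representation_basis)
  qed
  finally have "trace p = of_nat (card C)" by simp
  moreover have "\<forall>v. p v = 0" if "card C = 0"
  proof -
    have "C = {}" using that card_0_eq[OF fC] by blast
    then show ?thesis using inC span_empty by blast
  qed
  ultimately show thesis by (rule that)
qed

text \<open>Restricting a nilpotent operator \<open>f\<close> to the image of a power of \<open>f\<close> does not change its
  trace, since \<open>f\<close> maps that image into itself, and eventually the image is zero.\<close>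

lemma trace_nilpotent:
  assumes f: "lin f" and nil: "\<And>v. (f ^^ n) v = 0"
  shows "trace f = 0"
proof -
  have sub: "subspace (range (f ^^ k))" for k
    unfolding subspace_def using lin_funpow[OF f, of k]
    by (auto simp flip: lin_add lin_scale) (metis lin_0 rangeI)
  have "\<exists>p. lin p \<and> (\<forall>v. p v \<in> range (f ^^ k)) \<and> (\<forall>b\<in>range (f ^^ k). p b = b)" for k
    using ex_projection[OF subspace_single_0 sub[of k]] by (metis eq_iff_diff_eq_0 singletonD)
  then obtain p where p: "\<And>k. lin (p k)" "\<And>k v. p k v \<in> range (f ^^ k)"
    "\<And>k v. p k ((f ^^ k) v) = (f ^^ k) v" by (metis rangeI)
  have "trace (f \<circ> p k) = trace (f \<circ> p (Suc k))" for k
  proof -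
    have "p (Suc k) (f (p k v)) = f (p k v)" for v
    proof -
      obtain u where "p k v = (f ^^ k) u" using p(2)[of k v] by blast
      then show ?thesis using p(3)[of "Suc k" u] by simp
    qed
    then have "f \<circ> p k = p (Suc k) \<circ> (f \<circ> p k)" by auto
    then have "trace (f \<circ> p k) = trace (p (Suc k) \<circ> (f \<circ> p k))" by (rule arg_cong)
    also have "\<dots> = trace ((f \<circ> p k) \<circ> p (Suc k))"
      by (intro trace_comm lin_comp f p(1))
    also have "(f \<circ> p k) \<circ> p (Suc k) = f \<circ> p (Suc k)"
    proof
      fix v
      obtain u where "p (Suc k) v = (f ^^ k) (f u)"
        using p(2)[of "Suc k" v] by (auto simp: funpow_swap1)
      then show "((f \<circ> p k) \<circ> p (Suc k)) v = (f \<circ> p (Suc k)) v" using p(3)[of k "f u"] by simp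
    qed
    finally show ?thesis .
  qed
  then have "trace (f \<circ> p k) = trace (f \<circ> p 0)" for k by (induction k) auto
  moreover have "f \<circ> p n = (\<lambda>v. 0)"
  proof
    fix v
    obtain u where "p n v = (f ^^ n) u" using p(2)[of n v] by blast
    then show "(f \<circ> p n) v = 0" using nil f by (simp add: lin_0)
  qed
  moreover have "f \<circ> p 0 = f" using p(3)[of 0] by auto
  ultimately show ?thesis using trace_0 by metis
qed

sublocale End: linear_endomorphisms "\<lambda>c (f::'v \<Rightarrow> 'v) v. scale c (f v)"
  by unfold_locales (auto simp: algebra_simps)

text \<open>The test operators \<open>y\<close> act on the generalised \<open>a\<close>-eigenspace of \<open>x\<close> as the rational number
  \<open>h a\<close>, for a \<open>\<rat>\<close>-linear functional \<open>h\<close>. They qualify because \<open>[y, \<cdot>]\<close> acts on the generalised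
  eigenspaces of \<open>[x, \<cdot>]\<close> as \<open>h\<close> of the eigenvalue. Then \<open>trace (x y)\<close> is the sum of the
  \<open>n\<^sub>a a h a\<close> with multiplicities \<open>n\<^sub>a\<close>, and \<open>h\<close> maps it to the sum of the \<open>n\<^sub>a (h a)\<^sup>2\<close>.\<close>

lemma nilpotent_if_trace_orthogonal:
  assumes x: "lin x" and A: "End.subspace A" and B: "End.subspace B" and "A \<subseteq> B"
    and linB: "\<And>b. b \<in> B \<Longrightarrow> lin b"
    and xB: "\<And>b. b \<in> B \<Longrightarrow> (x \<circ> b) - (b \<circ> x) \<in> A"
    and tr: "\<And>y. lin y \<Longrightarrow> (\<And>b. b \<in> B \<Longrightarrow> (y \<circ> b) - (b \<circ> y) \<in> A) \<Longrightarrow> trace (x \<circ> y) = 0"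
  shows "\<exists>n. \<forall>v. (x ^^ n) v = 0"
proof -
  obtain E \<pi> N where E: "finite E" and \<pi>: "\<And>a. lin (\<pi> a)" and sum: "\<And>v. (\<Sum>a\<in>E. \<pi> a v) = v"
    and kill: "\<And>a v. (shift x a ^^ N) (\<pi> a v) = 0"
    and idem: "\<And>a v. \<pi> a (\<pi> a v) = \<pi> a v"
    and comm: "\<And>a v. a \<in> E \<Longrightarrow> \<pi> a (x v) = x (\<pi> a v)"
    using primary_decomposition[OF x] by blast
  have trace_x\<pi>: "trace (x \<circ> \<pi> a) = a * trace (\<pi> a)" if "a \<in> E" for a
  proof -
    let ?n = "shift x a \<circ> \<pi> a"
    have n: "lin ?n" by (intro lin_comp lin_shift x \<pi>)
    have c: "\<pi> a (shift x a v) = shift x a (\<pi> a v)" for v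
      using comm[OF that] by (simp add: lin_diff[OF \<pi>] lin_scale[OF \<pi>])
    have "(?n ^^ k) (\<pi> a v) = (shift x a ^^ k) (\<pi> a v)" for k v
      by (induction k) (simp_all add: c[symmetric] idem funpow_commute_map[of "shift x a" "\<pi> a",
          OF c[symmetric]])
    moreover have "?n v = \<pi> a (shift x a v)" for v using c by simp
    ultimately have "(?n ^^ N) (?n v) = 0" for v using kill[of a "shift x a v"] by metis
    then have "(?n ^^ Suc N) v = 0" for v
      unfolding funpow_Suc_right o_apply[of "?n ^^ N"] .
    then have "trace ?n = 0" by (intro trace_nilpotent[OF n])
    moreover have "x \<circ> \<pi> a = (\<lambda>v. ?n v + scale a (\<pi> a v))" by auto
    ultimately show ?thesis by (simp only: trace_add trace_scale) simp
  qed
  have zero: "\<pi> a v = 0" if a: "a \<in> E" "a \<noteq> 0" for a v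
  proof -
    obtain h :: "'f \<Rightarrow> rat" where h: "\<And>x y. h (x + y) = h x + h y"
      "\<And>q x. h (of_rat q * x) = q * h x" "h a \<noteq> 0"
      by (rule ex_rat_linear_functional[OF a(2)]) (rule that)
    have h0: "h 0 = 0" using h(1)[of 0 0] by simp
    have hd: "h (x - y) = h x - h y" for x y using h(1)[of "x - y" y] by simp
    have hs: "h (sum g I) = (\<Sum>i\<in>I. h (g i))" for g :: "'f \<Rightarrow> 'f" and I
      by (induction I rule: infinite_finite_induct) (auto simp: h0 h(1))
    define y where "y v = (\<Sum>a\<in>E. scale (of_rat (h a)) (\<pi> a v))" for v
    have y: "lin y"
      by (rule linI) (simp_all add: y_def lin_add[OF \<pi>] lin_scale[OF \<pi>] sum.distrib algebra_simps
          scale_sum_right)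
    have "(y \<circ> b) - (b \<circ> y) \<in> A" if b: "b \<in> B" for b
    proof -
      let ?T = "\<lambda>z. (x \<circ> z) - (z \<circ> x)"
      define z where "z i = \<pi> (fst i) \<circ> b \<circ> \<pi> (snd i)" for i
      have T: "End.lin ?T"
        by (rule End.linI) (simp_all add: fun_eq_iff lin_add[OF x] lin_scale[OF x] lin_0[OF x]
            algebra_simps)
      have lb: "lin b" using linB b .
      have zk: "(End.shift ?T (fst i - snd i) ^^ (N + N)) (z i) = 0" if i: "i \<in> E \<times> E" for i
      proof -
        let ?L = "\<lambda>z. shift x (fst i) \<circ> z" and ?R = "\<lambda>z. (z \<circ> x) - (\<lambda>v. scale (snd i) (z v))"
        have lz: "lin (z i)" unfolding z_def by (intro lin_comp \<pi> lb)
        have Lk: "(?L ^^ k) w = (shift x (fst i) ^^ k) \<circ> w" for k w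
          by (induction k) auto
        have Rk: "(?R ^^ k) (z i) = z i \<circ> (shift x (snd i) ^^ k)" for k
        proof (induction k)
          case (Suc k)
          have "(?R ^^ Suc k) (z i) = ?R (z i \<circ> (shift x (snd i) ^^ k))"
            by (simp only: funpow.simps o_apply[of ?R] Suc)
          also have "\<dots> = z i \<circ> (shift x (snd i) ^^ Suc k)"
          proof
            fix v
            have "(shift x (snd i) ^^ Suc k) v = (shift x (snd i) ^^ k) (x v) - scale (snd i)
                ((shift x (snd i) ^^ k) v)"
              unfolding funpow_Suc_right o_apply using lin_funpow[OF lin_shift[OF x]]
              by (simp add: lin_diff lin_scale)
            then have "z i ((shift x (snd i) ^^ Suc k) v) = z i ((shift x (snd i) ^^ k) (x v)) -
                scale (snd i) (z i ((shift x (snd i) ^^ k) v))"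
              by (simp only: lin_diff[OF lz] lin_scale[OF lz])
            then show "?R (z i \<circ> (shift x (snd i) ^^ k)) v = (z i \<circ> (shift x (snd i) ^^ Suc k)) v"
              by (simp only: o_apply minus_apply)
          qed
          finally show ?case .
        qed simp
        have \<pi>R: "\<pi> (snd i) ((shift x (snd i) ^^ N) v) = 0" for v
        proof -
          have "\<pi> (snd i) (shift x (snd i) u) = shift x (snd i) (\<pi> (snd i) u)" for u
            using comm[of "snd i" u] i by (auto simp: lin_diff[OF \<pi>] lin_scale[OF \<pi>])
          then have "\<pi> (snd i) ((shift x (snd i) ^^ N) v) = (shift x (snd i) ^^ N) (\<pi> (snd i) v)"
            by (intro funpow_commute_map[symmetric]) simp
          then show ?thesis using kill by simp
        qed
        have DLR: "End.shift ?T (fst i - snd i) = (\<lambda>z. ?L z - ?R z)"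
          by (rule ext, rule ext) (simp add: algebra_simps)
        show ?thesis unfolding DLR
        proof (rule End.funpow_diff_eq_0)
          show "End.lin ?L" "End.lin ?R"
            by (rule End.linI; simp add: fun_eq_iff lin_add[OF x] lin_scale[OF x] lin_0[OF x]
                algebra_simps)+
          show "?L (?R w) = ?R (?L w)" for w
            by (simp add: fun_eq_iff lin_diff[OF x] lin_scale[OF x] algebra_simps)
          show "(?L ^^ N) (z i) = 0" unfolding Lk by (auto simp: z_def kill)
          show "(?R ^^ N) (z i) = 0" unfolding Rk
            using \<pi>R by (auto simp: z_def lin_0[OF \<pi>] lin_0[OF lb])
        qed
      qed
      have sumEE: "(\<Sum>i\<in>E \<times> E. f (fst i) (snd i)) = (\<Sum>a\<in>E. \<Sum>a'\<in>E. f a a')"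
        for f :: "'f \<Rightarrow> 'f \<Rightarrow> 'v"
        by (simp add: sum.cartesian_product case_prod_beta)
      have app: "(\<Sum>i\<in>I. g i) v = (\<Sum>i\<in>I. g i v)" for I and g :: "'f \<times> 'f \<Rightarrow> 'v \<Rightarrow> 'v" and v
        by (induction I rule: infinite_finite_induct) auto
      have "(\<Sum>i\<in>E \<times> E. z i) v = b v" for v
        unfolding app z_def o_apply sumEE[of "\<lambda>a a'. \<pi> a (b (\<pi> a' v))"]
        by (simp only: sum lin_sum[OF \<pi>, symmetric] lin_sum[OF lb, symmetric])
      then have "(\<Sum>i\<in>E \<times> E. z i) = b" by (rule ext)
      then have "(\<Sum>i\<in>E \<times> E. z i) \<in> B" using b by (simp only:)
      then have "(\<Sum>i\<in>E \<times> E. (\<lambda>v. scale (of_rat (h (fst i - snd i))) (z i v))) \<in> A"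
        by (intro End.weighted_sum_mem[OF T A B \<open>A \<subseteq> B\<close> xB _ zk, where h = "\<lambda>a. of_rat (h a)"])
          (auto simp: E h0)
      moreover
      have "(\<Sum>i\<in>E \<times> E. (\<lambda>v. scale (of_rat (h (fst i - snd i))) (z i v))) v
        = ((y \<circ> b) - (b \<circ> y)) v" for v
      proof -
        have "(\<Sum>i\<in>E \<times> E. (\<lambda>v. scale (of_rat (h (fst i - snd i))) (z i v))) v =
          (\<Sum>a\<in>E. \<Sum>a'\<in>E. scale (of_rat (h a)) (\<pi> a (b (\<pi> a' v)))) -
          (\<Sum>a\<in>E. \<Sum>a'\<in>E. scale (of_rat (h a')) (\<pi> a (b (\<pi> a' v))))"
          unfolding app z_def o_apply
            sumEE[of "\<lambda>a a'. scale (of_rat (h (a - a'))) (\<pi> a (b (\<pi> a' v)))"]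
          by (simp add: hd of_rat_diff scale_left_diff_distrib sum_subtractf)
        also have "(\<Sum>a\<in>E. \<Sum>a'\<in>E. scale (of_rat (h a)) (\<pi> a (b (\<pi> a' v)))) = y (b v)"
          unfolding y_def
          by (simp only: sum lin_sum[OF \<pi>, symmetric] lin_sum[OF lb, symmetric]
              scale_sum_right[symmetric])
        also have "(\<Sum>a\<in>E. \<Sum>a'\<in>E. scale (of_rat (h a')) (\<pi> a (b (\<pi> a' v)))) = b (y v)"
          unfolding y_def lin_sum[OF lb] lin_scale[OF lb]
          by (subst sum.swap) (simp only: sum scale_sum_right[symmetric])
        finally show ?thesis by simp
      qed
      then have "(\<Sum>i\<in>E \<times> E. (\<lambda>v. scale (of_rat (h (fst i - snd i))) (z i v))) = (y \<circ> b) - (b \<circ> y)"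
        by (rule ext)
      ultimately show ?thesis by (simp only:)
    qed
    then have "trace (x \<circ> y) = 0" using tr y by blast
    have "x \<circ> y = (\<lambda>v. \<Sum>a\<in>E. scale (of_rat (h a)) ((x \<circ> \<pi> a) v))"
      by (auto simp: y_def lin_sum[OF x] lin_scale[OF x])
    then have "trace (x \<circ> y) = (\<Sum>a\<in>E. of_rat (h a) * trace (x \<circ> \<pi> a))"
      by (simp only: trace_sum trace_scale)
    then have "(\<Sum>a\<in>E. of_rat (h a) * (a * trace (\<pi> a))) = 0"
      using \<open>trace (x \<circ> y) = 0\<close> trace_x\<pi> by simp
    moreover have "\<forall>a. \<exists>n. trace (\<pi> a) = of_nat n \<and> (n = 0 \<longrightarrow> (\<forall>v. \<pi> a v = 0))"
      using trace_projection[OF \<pi> idem] by blast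
    then obtain n where n: "\<And>a. trace (\<pi> a) = of_nat (n a)" "\<And>a. n a = 0 \<Longrightarrow> \<forall>v. \<pi> a v = 0"
      unfolding choice_iff by blast
    ultimately have "h (\<Sum>a\<in>E. of_rat (of_nat (n a) * h a) * a) = 0"
      using h0 by (simp add: of_rat_mult mult_ac)
    then have "(\<Sum>a\<in>E. of_nat (n a) * (h a)\<^sup>2) = (0::rat)"
      by (simp add: hs h(2) power2_eq_square mult.assoc)
    then have "of_nat (n a) * (h a)\<^sup>2 = (0::rat)"
      using E a(1) by (subst (asm) sum_nonneg_eq_0_iff) auto
    then show ?thesis using h(3) n(2)[of a] by simp
  qed
  have "(x ^^ N) v = 0" for v
  proof -
    have "(x ^^ N) v = (\<Sum>a\<in>E. (x ^^ N) (\<pi> a v))"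
      by (subst sum[of v, symmetric]) (rule lin_sum[OF lin_funpow[OF x]])
    also have "\<dots> = 0"
    proof (intro sum.neutral ballI)
      fix a assume "a \<in> E"
      then show "(x ^^ N) (\<pi> a v) = 0"
        using zero[of a v] kill[of 0 v] by (cases "a = 0") (simp_all add: lin_0 lin_funpow[OF x])
    qed
    finally show ?thesis .
  qed
  then show ?thesis by blast
qed

end

section \<open>The theorems of Engel and Cartan\<close>

lemma (in linear_endomorphisms) lin_span_mem:
  assumes f: "lin f" and X: "subspace X" and S: "\<And>s. s \<in> S \<Longrightarrow> f s \<in> X" and v: "v \<in> span S"
  shows "f v \<in> X"
  using v
proof (induction rule: span_induct_alt)
  case base
  show ?case using X by (simp add: lin_0[OF f] subspace_0)
next
  case (step c x y)
  then show ?case using X S by (simp add: lin_add[OF f] lin_scale[OF f] subspace_add subspace_scale)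
qed

locale based_lie_algebra = lie_algebra scale bracket + fin_dim_alg_closed scale Basis
  for scale :: "'f::{alg_closed_field, field_char_0} \<Rightarrow> 'm::ab_group_add \<Rightarrow> 'm"
    and bracket and Basis
begin

sublocale fin_dim_lie_algebra scale bracket
  by unfold_locales (use finite_Basis span_Basis in blast)

lemma bracket_zero_left: "bracket 0 x = 0"
  using bracket_add_left[of 0 0 x] by simp

lemma bracket_diff_left: "bracket (x - y) z = bracket x z - bracket y z"
  using bracket_add_left[of "x - y" y z] by (simp add: algebra_simps)

lemma bracket_diff_right: "bracket x (y - z) = bracket x y - bracket x z"
  using bracket_add_right[of x "y - z" z] by (simp add: algebra_simps)

lemma bracket_neg_right: "bracket x (- y) = - bracket x y"
  using bracket_diff_right[of x 0 y] by (simp add: bracket_zero_right)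

lemma lin_bracket: "lin (bracket x)"
  by (rule linI) (simp_all add: bracket_add_right bracket_scale_right)

lemma bracket_sum_right: "bracket x (sum g A) = (\<Sum>i\<in>A. bracket x (g i))"
  by (rule lin_sum[OF lin_bracket])

text \<open>The Jacobi identity in the form in which it says that \<open>ad\<close> is a representation.\<close>

lemma bracket_bracket: "bracket (bracket x y) z = bracket x (bracket y z) - bracket y (bracket x z)"
proof -
  have "bracket y (bracket z x) = - bracket y (bracket x z)"
    using bracket_skew[of z x] by (simp add: bracket_neg_right)
  moreover have "bracket z (bracket x y) = - bracket (bracket x y) z" by (rule bracket_skew)
  ultimately show ?thesis using jacobi[of x y z] by (simp add: algebra_simps)
qed

lemma lie_subalgebra_derived:
  assumes "lie_subalgebra S"
  shows "lie_subalgebra (derived_series S (Suc n))"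
  unfolding lie_subalgebra_def
proof (intro conjI ballI)
  show "subspace (derived_series S (Suc n))" by simp
  fix x y assume xy: "x \<in> derived_series S (Suc n)" "y \<in> derived_series S (Suc n)"
  have "derived_series S (Suc n) \<subseteq> derived_series S n"
    using derived_series_subset[OF assms] derived_series_mono[of "derived_series S 1" S n]
      derived_series_subset[OF assms, of 1] derived_series_add[of S 1 n] by simp
  with xy show "bracket x y \<in> derived_series S (Suc n)" by (auto intro: span_base)
qed

end

locale lie_algebra_and_space = based_lie_algebra scale bracket Basis + V: fin_dim_alg_closed scale\<^sub>V
    Basis\<^sub>V
  for scale :: "'f::{alg_closed_field, field_char_0} \<Rightarrow> 'm::ab_group_add \<Rightarrow> 'm"
    and bracket and Basis
    and scale\<^sub>V :: "'f \<Rightarrow> 'v::ab_group_add \<Rightarrow> 'v" and Basis\<^sub>V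
begin

definition is_representation :: "'m set \<Rightarrow> ('m \<Rightarrow> 'v \<Rightarrow> 'v) \<Rightarrow> bool"
  where "is_representation S \<rho> \<longleftrightarrow> (\<forall>x\<in>S. V.lin (\<rho> x)) \<and>
    (\<forall>x\<in>S. \<forall>y\<in>S. \<forall>v. \<rho> (x + y) v = \<rho> x v + \<rho> y v) \<and>
    (\<forall>c. \<forall>x\<in>S. \<forall>v. \<rho> (scale c x) v = scale\<^sub>V c (\<rho> x v)) \<and>
    (\<forall>x\<in>S. \<forall>y\<in>S. \<forall>v. \<rho> (bracket x y) v = \<rho> x (\<rho> y v) - \<rho> y (\<rho> x v))"

lemma rep_lin: "is_representation S \<rho> \<Longrightarrow> x \<in> S \<Longrightarrow> V.lin (\<rho> x)"
  and rep_plus: "is_representation S \<rho> \<Longrightarrow> x \<in> S \<Longrightarrow> y \<in> S \<Longrightarrow> \<rho> (x + y) v = \<rho> x v + \<rho> y v"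
  and rep_times: "is_representation S \<rho> \<Longrightarrow> x \<in> S \<Longrightarrow> \<rho> (scale c x) v = scale\<^sub>V c (\<rho> x v)"
  and rep_bracket: "is_representation S \<rho> \<Longrightarrow> x \<in> S \<Longrightarrow> y \<in> S \<Longrightarrow>
    \<rho> (bracket x y) v = \<rho> x (\<rho> y v) - \<rho> y (\<rho> x v)"
  by (simp_all add: is_representation_def)

lemma rep_subset: "is_representation S \<rho> \<Longrightarrow> T \<subseteq> S \<Longrightarrow> is_representation T \<rho>"
  unfolding is_representation_def by blast

lemma rep_zero: "is_representation S \<rho> \<Longrightarrow> x \<in> S \<Longrightarrow> \<rho> 0 v = 0"
  using rep_times[of S \<rho> x 0 v] by simp

text \<open>Nilpotency of the associative algebra generated by \<open>\<rho> U\<close> means that this flag reaches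
  zero; \<open>annihilator \<rho> U n\<close> is the dual flag of vectors killed by all products of \<open>n\<close> factors.\<close>

primrec flag :: "('m \<Rightarrow> 'v \<Rightarrow> 'v) \<Rightarrow> 'm set \<Rightarrow> nat \<Rightarrow> 'v set"
  where
    "flag \<rho> U 0 = UNIV"
  | "flag \<rho> U (Suc n) = V.span {\<rho> u w | u w. u \<in> U \<and> w \<in> flag \<rho> U n}"

primrec annihilator :: "('m \<Rightarrow> 'v \<Rightarrow> 'v) \<Rightarrow> 'm set \<Rightarrow> nat \<Rightarrow> 'v set"
  where
    "annihilator \<rho> U 0 = {0}"
  | "annihilator \<rho> U (Suc n) = {v. \<forall>u\<in>U. \<rho> u v \<in> annihilator \<rho> U n}"

lemma subspace_flag: "V.subspace (flag \<rho> U n)"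
  by (cases n) auto

lemma flag_step: "u \<in> U \<Longrightarrow> w \<in> flag \<rho> U n \<Longrightarrow> \<rho> u w \<in> flag \<rho> U (Suc n)"
  by (auto intro: V.span_base)

lemma flag_Suc_subset: "flag \<rho> U (Suc n) \<subseteq> flag \<rho> U n"
proof (induction n)
  case (Suc n)
  show ?case unfolding flag.simps(2)[of \<rho> U "Suc n"]
    by (rule V.span_minimal[OF _ subspace_flag]) (use Suc flag_step in blast)
qed simp

lemma flag_antimono: "m \<le> n \<Longrightarrow> flag \<rho> U n \<subseteq> flag \<rho> U m"
  by (rule lift_Suc_antimono_le[of "flag \<rho> U"]) (rule flag_Suc_subset)

lemma subspace_annihilator:
  assumes "is_representation S \<rho>" "U \<subseteq> S"
  shows "V.subspace (annihilator \<rho> U n)"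
proof (induction n)
  case (Suc n)
  then show ?case
    using assms rep_lin[OF assms(1)] unfolding V.subspace_def
    by (simp add: subset_iff V.lin_add V.lin_scale V.lin_0)
qed simp

lemma annihilator_eq_UNIV:
  assumes rep: "is_representation S \<rho>" "U \<subseteq> S" and "flag \<rho> U N = {0}" and "N \<le> n"
  shows "annihilator \<rho> U n = UNIV"
proof -
  have "flag \<rho> U j \<subseteq> annihilator \<rho> U i" if "N \<le> i + j" for i j
    using that
  proof (induction i arbitrary: j)
    case 0
    then show ?case using flag_antimono[of N j \<rho> U] assms(3) by simp
  next
    case (Suc i)
    then show ?case using flag_step[of _ U _ \<rho> j] Suc.IH[of "Suc j"] by fastforce
  qed
  from this[of n 0] show ?thesis using \<open>N \<le> n\<close> by auto
qed

text \<open>The adjoint action of \<open>U\<close> on operators is a difference of left and right multiplications.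
  If every product of \<open>N\<close> elements of \<open>\<rho> U\<close> vanishes, then so does every \<open>2 N\<close>-fold commutator
  of such elements with any operator. A chain of commutators that starts outside \<open>U\<close> therefore ends
  in \<open>U\<close>, and its last member outside \<open>U\<close> normalizes \<open>U\<close>.\<close>

lemma ex_normalizing_element:
  assumes rep: "is_representation T \<rho>" and T: "lie_subalgebra T" and U: "lie_subalgebra U" "U \<subset> T"
    and ker: "\<And>z. z \<in> T \<Longrightarrow> (\<And>v. \<rho> z v = 0) \<Longrightarrow> z \<in> U" and N: "flag \<rho> U N = {0}"
  shows "\<exists>y\<in>T - U. \<forall>u\<in>U. bracket u y \<in> U"
proof (rule ccontr)
  assume *: "\<not> ?thesis"
  have UT: "U \<subseteq> T" using U by blast
  \<comment> \<open>\<open>Z m f\<close>: any product of \<open>f\<close> with altogether \<open>m\<close> factors from \<open>\<rho> U\<close>, left and right, is zero.\<close>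
  define Z where "Z m f \<longleftrightarrow> (\<forall>a b. a + b = m \<longrightarrow> (\<forall>w\<in>flag \<rho> U b. f w \<in> annihilator \<rho> U a))"
    for m and f :: "'v \<Rightarrow> 'v"
  have Z0: "z = 0" if "z \<in> flag \<rho> U b" "N \<le> b" for z b
    using that flag_antimono[of N b \<rho> U] N by auto
  have "\<exists>z\<in>T - U. Z (2 * N - m) (\<rho> z)" for m
  proof (induction m)
    case 0
    obtain x where x: "x \<in> T - U" using U by blast
    have "Z (2 * N) (\<rho> x)" unfolding Z_def
    proof (intro allI impI ballI)
      fix a b w assume ab: "a + b = 2 * N" and w: "w \<in> flag \<rho> U b"
      show "\<rho> x w \<in> annihilator \<rho> U a"
      proof (cases "N \<le> a")
        case True
        then show ?thesis using annihilator_eq_UNIV[OF rep UT N] by simp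
      next
        case False
        then have "w = 0" using Z0 w ab by simp
        then have "\<rho> x w = 0" using V.lin_0 rep_lin[OF rep] x by blast
        then show ?thesis using V.subspace_0[OF subspace_annihilator[OF rep UT]] by simp
      qed
    qed
    then show ?case using x by auto
  next
    case (Suc m)
    then obtain z where z: "z \<in> T" "z \<notin> U" "Z (2 * N - m) (\<rho> z)" by blast
    obtain u where u: "u \<in> U" "bracket u z \<notin> U" using * z(1,2) by blast
    have "Z (2 * N - Suc m) (\<rho> (bracket u z))" unfolding Z_def
    proof (intro allI impI ballI)
      fix a b w assume ab: "a + b = 2 * N - Suc m" and w: "w \<in> flag \<rho> U b"
      have "\<rho> u (\<rho> z w) \<in> annihilator \<rho> U a \<and> \<rho> z (\<rho> u w) \<in> annihilator \<rho> U a"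
      proof (cases "Suc m \<le> 2 * N")
        case True
        then have "Suc a + b = 2 * N - m" "a + Suc b = 2 * N - m" using ab by auto
        then have "\<rho> z w \<in> annihilator \<rho> U (Suc a)" "\<rho> z (\<rho> u w) \<in> annihilator \<rho> U a"
          using z(3) w flag_step[of u U w \<rho> b] u(1) unfolding Z_def by blast+
        then show ?thesis using u(1) by simp
      next
        case False
        then have zz: "\<rho> z w = 0" for w using z(3) unfolding Z_def by (auto dest!: spec[of _ 0])
        have "\<rho> u 0 = 0" using V.lin_0 rep_lin[OF rep] u UT by blast
        then show ?thesis using zz V.subspace_0[OF subspace_annihilator[OF rep UT]] by simp
      qed
      then show "\<rho> (bracket u z) w \<in> annihilator \<rho> U a"
        using rep_bracket[OF rep, of u z w] u UT z(1)
          V.subspace_diff[OF subspace_annihilator[OF rep UT]] by auto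
    qed
    moreover have "bracket u z \<in> T" using T u UT z(1) by (auto simp: lie_subalgebra_def)
    ultimately show ?case using u(2) by blast
  qed
  from this[of "2 * N"] obtain z where z: "z \<in> T" "z \<notin> U" "Z 0 (\<rho> z)" by auto
  then have "\<rho> z w = 0" for w unfolding Z_def by (auto dest!: spec[of _ 0])
  then show False using ker z by blast
qed

text \<open>Adjoining to \<open>U\<close> one nilpotent element \<open>y\<close> that normalizes \<open>U\<close> keeps the flag finite: each
  step of the flag of \<open>U\<close> is \<open>y\<close>-stable, and modulo the next step only the powers of \<open>y\<close> act.\<close>

lemma flag_insert:
  assumes rep: "is_representation T \<rho>" and T: "subspace T" and U: "subspace U" "U \<subseteq> T"
    and y: "y \<in> T"
    and norm: "\<And>u. u \<in> U \<Longrightarrow> bracket y u \<in> U" and nil: "\<And>v. (\<rho> y ^^ n) v = 0"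
    and N: "flag \<rho> U N = {0}" and U': "U' \<subseteq> T" "\<And>x. x \<in> U' \<Longrightarrow> \<exists>c. x - scale c y \<in> U"
  shows "flag \<rho> U' (N * n) = {0}"
proof -
  have ly: "V.lin (\<rho> y)" using rep_lin[OF rep y] .
  have ystable: "\<rho> y w \<in> flag \<rho> U j" if "w \<in> flag \<rho> U j" for w j
    using that
  proof (induction j arbitrary: w)
    case (Suc j)
    have gen: "\<rho> y s \<in> flag \<rho> U (Suc j)" if gen: "s \<in> {\<rho> u w | u w. u \<in> U \<and> w \<in> flag \<rho> U j}" for s
    proof -
      obtain u w where s: "s = \<rho> u w" "u \<in> U" "w \<in> flag \<rho> U j" using gen by blast
      have "\<rho> y (\<rho> u w) = \<rho> (bracket y u) w + \<rho> u (\<rho> y w)"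
        using rep_bracket[OF rep y, of u w] s(2) U(2) by auto
      moreover have "\<rho> (bracket y u) w \<in> flag \<rho> U (Suc j)" "\<rho> u (\<rho> y w) \<in> flag \<rho> U (Suc j)"
        using flag_step[of _ U _ \<rho> j] norm s Suc.IH by blast+
      ultimately show ?thesis using V.subspace_add[OF subspace_flag] s(1) by metis
    qed
    show ?case
      by (rule V.lin_span_mem[OF ly subspace_flag gen Suc.prems[unfolded flag.simps(2)]])
  qed simp
  have powstable: "(\<rho> y ^^ i) w \<in> flag \<rho> U j" if "w \<in> flag \<rho> U j" for w i j
    using that ystable by (induction i) auto
  have "flag \<rho> U' (j * n) \<subseteq> flag \<rho> U j" for j
  proof (induction j)
    case (Suc j)
    \<comment> \<open>Modulo the next step of the flag, \<open>i\<close> factors from \<open>U'\<close> act as a multiple of \<open>\<rho> y ^^ i\<close>.\<close>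
    define X where "X i = {a + (\<rho> y ^^ i) b | a b. a \<in> flag \<rho> U (Suc j) \<and> b \<in> flag \<rho> U j}" for i
    have subX: "V.subspace (X i)" for i
    proof -
      have "V.subspace ((\<rho> y ^^ i) ` flag \<rho> U j)"
        using subspace_flag[of \<rho> U j] V.lin_funpow[OF ly, of i] unfolding V.subspace_def
        by (auto simp flip: V.lin_add V.lin_scale intro: image_eqI[OF V.lin_0[symmetric]])
      then have "V.subspace {a + b | a b. a \<in> flag \<rho> U (Suc j) \<and> b \<in> (\<rho> y ^^ i) ` flag \<rho> U j}"
        by (rule V.subspace_sums[OF subspace_flag])
      moreover have "{a + b | a b. a \<in> flag \<rho> U (Suc j) \<and> b \<in> (\<rho> y ^^ i) ` flag \<rho> U j} = X i"
        unfolding X_def by blast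
      ultimately show ?thesis by simp
    qed
    have "flag \<rho> U' (j * n + i) \<subseteq> X i" for i
    proof (induction i)
      case 0
      have "b \<in> X 0" if "b \<in> flag \<rho> U j" for b
      proof -
        have "b = 0 + (\<rho> y ^^ 0) b" by simp
        then show ?thesis unfolding X_def using that V.subspace_0[OF subspace_flag] by blast
      qed
      then have "flag \<rho> U j \<subseteq> X 0" by blast
      then show ?case using \<open>flag \<rho> U' (j * n) \<subseteq> flag \<rho> U j\<close> by simp
    next
      case (Suc i)
      have "\<rho> x w \<in> X (Suc i)" if x: "x \<in> U'" and w: "w \<in> flag \<rho> U' (j * n + i)" for x w
      proof -
        obtain a b where ab: "w = a + (\<rho> y ^^ i) b" "a \<in> flag \<rho> U (Suc j)" "b \<in> flag \<rho> U j"
          using w Suc unfolding X_def by blast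
        obtain c where c: "x - scale c y \<in> U" using U'(2)[OF x] by blast
        let ?u = "x - scale c y"
        have xT: "x \<in> T" using U'(1) x by blast
        have uT: "?u \<in> T" using c U(2) by blast
        have *: "\<rho> x v = \<rho> ?u v + scale\<^sub>V c (\<rho> y v)" for v
          using rep_plus[OF rep uT subspace_scale[OF T y], of c v] rep_times[OF rep y, of c v]
            by simp
        have "\<rho> x w = (\<rho> ?u a + scale\<^sub>V c (\<rho> y a) + \<rho> ?u ((\<rho> y ^^ i) b))
            + (\<rho> y ^^ Suc i) (scale\<^sub>V c b)"
          unfolding * ab(1) V.lin_scale[OF V.lin_funpow[OF ly]]
          using V.lin_add[OF rep_lin[OF rep uT]] V.lin_add[OF ly]
          by (simp add: V.scale_right_distrib algebra_simps)
        moreover have "\<rho> ?u a \<in> flag \<rho> U (Suc j)"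
          using flag_step[OF c ab(2)] flag_Suc_subset by blast
        moreover have "scale\<^sub>V c (\<rho> y a) \<in> flag \<rho> U (Suc j)"
          using ystable[OF ab(2)] V.subspace_scale[OF subspace_flag] by blast
        moreover have "\<rho> ?u ((\<rho> y ^^ i) b) \<in> flag \<rho> U (Suc j)"
          using flag_step[OF c powstable[OF ab(3)]] .
        moreover have "scale\<^sub>V c b \<in> flag \<rho> U j" using ab(3) V.subspace_scale[OF subspace_flag]
          by blast
        ultimately show ?thesis unfolding X_def using V.subspace_add[OF subspace_flag] by blast
      qed
      then show ?case
        unfolding add_Suc_right flag.simps(2)
        by (intro V.span_minimal[OF _ subX]) blast
    qed
    moreover have "X n \<subseteq> flag \<rho> U (Suc j)" unfolding X_def using nil by auto
    ultimately show ?case by (simp add: add.commute) blast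
  qed simp
  then show ?thesis using N V.subspace_0[OF subspace_flag] by blast
qed

text \<open>Engel's theorem. Among the subalgebras with finite flag that contain the kernel of \<open>\<rho>\<close>, one of
  maximal dimension is everything, since otherwise a normalizing element could be adjoined to it.
  The kernel is included because iterated commutators are only known to vanish under \<open>\<rho>\<close>.\<close>

theorem engel:
  assumes rep: "is_representation T \<rho>" and T: "lie_subalgebra T"
    and nil: "\<And>x. x \<in> T \<Longrightarrow> \<exists>n. \<forall>v. (\<rho> x ^^ n) v = 0"
  shows "\<exists>N. flag \<rho> T N = {0}"
proof -
  define K where "K = {z \<in> T. \<forall>v. \<rho> z v = 0}"
  define P where "P U \<longleftrightarrow> lie_subalgebra U \<and> U \<subseteq> T \<and> K \<subseteq> U \<and> (\<exists>N. flag \<rho> U N = {0})" for U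
  have Tsub: "subspace T" and Tbr: "\<And>x y. x \<in> T \<Longrightarrow> y \<in> T \<Longrightarrow> bracket x y \<in> T"
    using T by (auto simp: lie_subalgebra_def)
  have T0: "0 \<in> T" using Tsub by (rule subspace_0)
  have "P K"
  proof -
    have "lie_subalgebra K" unfolding lie_subalgebra_def subspace_def K_def
      using T0 subspace_add[OF Tsub] subspace_scale[OF Tsub] Tbr rep_zero[OF rep T0]
        V.lin_0[OF rep_lin[OF rep]]
      by (simp add: rep_plus[OF rep] rep_times[OF rep] rep_bracket[OF rep])
    moreover have "flag \<rho> K (Suc 0) = {0}"
      using V.span_minimal[of "{\<rho> u w |u w. u \<in> K}" "{0}"] V.span_zero by (auto simp: K_def)
    ultimately show ?thesis unfolding P_def K_def by blast
  qed
  then obtain U where U: "P U" and max: "\<And>W. P W \<Longrightarrow> dim W \<le> dim U"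
    using ex_has_greatest_nat[of P K dim "Suc dimension"] dim_subset_UNIV
    by (auto simp: less_Suc_eq_le)
  obtain N where N: "flag \<rho> U N = {0}" using U by (auto simp: P_def)
  have Usub: "lie_subalgebra U" "subspace U" "U \<subseteq> T" "K \<subseteq> U"
    using U by (auto simp: P_def lie_subalgebra_def)
  have "U = T"
  proof (rule ccontr)
    assume "U \<noteq> T"
    then have UT: "U \<subset> T" using Usub by blast
    have ker: "\<And>z. z \<in> T \<Longrightarrow> (\<And>v. \<rho> z v = 0) \<Longrightarrow> z \<in> U" using Usub(4) by (auto simp: K_def)
    obtain y where y: "y \<in> T" "y \<notin> U" "\<And>u. u \<in> U \<Longrightarrow> bracket u y \<in> U"
      using ex_normalizing_element[OF rep T Usub(1) UT ker N] by blast
    have yu: "bracket y u \<in> U" if "u \<in> U" for u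
      using y(3)[OF that] bracket_skew[of y u] subspace_neg[OF Usub(2)] by simp
    obtain n where n: "\<And>v. (\<rho> y ^^ n) v = 0" using nil[OF y(1)] by blast
    define W where "W = span (insert y U)"
    have W: "x \<in> W \<longleftrightarrow> (\<exists>c. x - scale c y \<in> U)" for x
      unfolding W_def span_breakdown_eq using Usub(2) by (simp add: span_eq_iff[THEN iffD2])
    have WT: "W \<subseteq> T" unfolding W_def using y(1) Usub(3) Tsub by (intro span_minimal) auto
    have UW: "U \<subseteq> W" "y \<in> W" unfolding W_def by (auto intro: span_base)
    have "bracket a b \<in> W" if a: "a \<in> W" and b: "b \<in> W" for a b
    proof -
      obtain c d where c: "a - scale c y \<in> U" and d: "b - scale d y \<in> U" using a b W by blast
      let ?u = "a - scale c y" and ?v = "b - scale d y"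
      have "bracket a b = bracket (?u + scale c y) (?v + scale d y)" by simp
      also have "\<dots> = bracket ?u ?v + scale d (bracket ?u y) + scale c (bracket y ?v)"
        by (simp only: bracket_add_left bracket_add_right bracket_scale_left bracket_scale_right
            bracket_self scale_zero_right) (simp add: add_ac)
      also have "\<dots> \<in> U"
        using c d y(3) yu Usub(1,2)
        by (intro subspace_add subspace_scale) (auto simp: lie_subalgebra_def)
      finally show ?thesis using UW by blast
    qed
    then have "lie_subalgebra W" unfolding lie_subalgebra_def by (auto simp: W_def)
    moreover have "flag \<rho> W (N * n) = {0}"
      by (rule flag_insert[OF rep Tsub Usub(2,3) y(1) yu n N WT]) (simp_all only: W)
    ultimately have "P W" using WT UW Usub unfolding P_def by blast
    then have "dim W \<le> dim U" by (rule max)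
    then have "U = W"
      using Usub(2) UW by (intro subspace_dim_equal) (auto simp: W_def)
    then show False using UW y(2) by blast
  qed
  then show ?thesis using N by blast
qed

text \<open>An element of the \<open>k\<close>-th derived algebra moves vectors at least \<open>k + 1\<close> steps down the flag.\<close>

lemma derived_series_acts_trivially:
  assumes rep: "is_representation T \<rho>" and T: "lie_subalgebra T" and N: "flag \<rho> T N = {0}"
    and "x \<in> derived_series T N"
  shows "\<rho> x v = 0"
proof -
  have step: "\<rho> x w \<in> flag \<rho> T (j + k + 1)" if "x \<in> derived_series T k" "w \<in> flag \<rho> T j" for x w j k
    using that
  proof (induction k arbitrary: x w j)
    case 0
    then show ?case using flag_step by simp
  next
    case (Suc k)
    have DT: "derived_series T k \<subseteq> T" by (rule derived_series_subset[OF T])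
    have Tsub: "subspace T" using T by (simp add: lie_subalgebra_def)
    define Y where "Y = {x \<in> T. \<rho> x w \<in> flag \<rho> T (j + Suc k + 1)}"
    have "subspace Y" unfolding Y_def subspace_def
      using Tsub subspace_flag[of \<rho> T "j + Suc k + 1"] rep_plus[OF rep] rep_times[OF rep]
        rep_zero[OF rep subspace_0[OF Tsub]]
      by (auto simp: V.subspace_add V.subspace_scale V.subspace_0 subspace_add subspace_scale
          subspace_0
          simp del: flag.simps)
    moreover have "bracket a b \<in> Y" if ab: "a \<in> derived_series T k" "b \<in> derived_series T k" for a b
    proof -
      have abT: "a \<in> T" "b \<in> T" using ab DT by auto
      have "\<rho> a (\<rho> b w) \<in> flag \<rho> T (j + k + 1 + k + 1)" "\<rho> b (\<rho> a w) \<in> flag \<rho> T (j + k + 1 + k + 1)"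
        using Suc.IH ab Suc.prems(2) by blast+
      then have "\<rho> (bracket a b) w \<in> flag \<rho> T (j + k + 1 + k + 1)"
        unfolding rep_bracket[OF rep abT] by (rule V.subspace_diff[OF subspace_flag])
      moreover have "flag \<rho> T (j + k + 1 + k + 1) \<subseteq> flag \<rho> T (j + Suc k + 1)"
        by (rule flag_antimono) simp
      ultimately show ?thesis using T abT unfolding Y_def lie_subalgebra_def by blast
    qed
    ultimately have "derived_series T (Suc k) \<subseteq> Y"
      unfolding derived_series.simps(2) by (intro span_minimal) blast+
    then show ?case using Suc.prems(1) unfolding Y_def by blast
  qed
  have "\<rho> x v \<in> flag \<rho> T (0 + N + 1)" using step[of x N v 0] assms(4) by simp
  then show ?thesis using flag_antimono[of N "0 + N + 1" \<rho> T] N by auto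
qed

text \<open>Cartan's criterion. For \<open>x = [a, b]\<close> and an operator \<open>y\<close> with \<open>[y, \<rho> S] \<subseteq> \<rho> [S, S]\<close>,
  invariance of the trace moves the bracket to \<open>[\<rho> b, y]\<close>, which lies in \<open>\<rho> S\<close>; so \<open>\<rho> x\<close> is
  nilpotent for every \<open>x\<close> in \<open>[S, S]\<close>, and Engel's theorem applies.\<close>

theorem cartan_criterion:
  assumes rep: "is_representation S \<rho>" and S: "lie_subalgebra S"
    and tr: "\<And>x y. x \<in> S \<Longrightarrow> y \<in> S \<Longrightarrow> V.trace (\<rho> x \<circ> \<rho> y) = 0"
  shows "\<exists>n. \<forall>x\<in>derived_series S n. \<forall>v. \<rho> x v = 0"
proof -
  define T where "T = derived_series S (Suc 0)"
  have T: "lie_subalgebra T" unfolding T_def by (rule lie_subalgebra_derived[OF S])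
  have TS: "T \<subseteq> S" unfolding T_def by (rule derived_series_subset[OF S])
  have Ssub: "subspace S" using S by (simp add: lie_subalgebra_def)
  have repT: "is_representation T \<rho>" using rep_subset[OF rep TS] .
  have im: "V.End.subspace (\<rho> ` W)" if "subspace W" "W \<subseteq> S" for W
    unfolding V.End.subspace_def
  proof (intro conjI ballI allI)
    have "\<rho> 0 = 0" using rep_zero[OF rep subspace_0[OF Ssub]] by auto
    then show "0 \<in> \<rho> ` W" using subspace_0[OF that(1)] by (metis image_eqI)
    fix f g assume "f \<in> \<rho> ` W" "g \<in> \<rho> ` W"
    then obtain a b where ab: "f = \<rho> a" "g = \<rho> b" "a \<in> W" "b \<in> W" by blast
    then have "f + g = \<rho> (a + b)"
      using rep_plus[OF rep, of a b] subsetD[OF that(2)] by (simp add: fun_eq_iff)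
    then show "f + g \<in> \<rho> ` W" using ab subspace_add[OF that(1)] by blast
  next
    fix c f assume "f \<in> \<rho> ` W"
    then obtain a where a: "f = \<rho> a" "a \<in> W" by blast
    then have "(\<lambda>v. scale\<^sub>V c (f v)) = \<rho> (scale c a)"
      using rep_times[OF rep, of a c] subsetD[OF that(2)] by (simp add: fun_eq_iff)
    then show "(\<lambda>v. scale\<^sub>V c (f v)) \<in> \<rho> ` W" using a subspace_scale[OF that(1)] by blast
  qed
  have comm: "(\<rho> a \<circ> \<rho> b) - (\<rho> b \<circ> \<rho> a) = \<rho> (bracket a b)" if "a \<in> S" "b \<in> S" for a b
    using rep_bracket[OF rep that] by (auto simp: fun_eq_iff)
  have brT: "bracket a b \<in> T" if "a \<in> S" "b \<in> S" for a b
    using that unfolding T_def by (auto intro: span_base)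
  have "\<exists>n. \<forall>v. (\<rho> x ^^ n) v = 0" if x: "x \<in> T" for x
  proof (rule V.nilpotent_if_trace_orthogonal)
    show "V.lin (\<rho> x)" using rep_lin[OF repT x] .
    show "V.End.subspace (\<rho> ` T)" "V.End.subspace (\<rho> ` S)"
      using im T TS Ssub by (auto simp: lie_subalgebra_def)
    show "\<rho> ` T \<subseteq> \<rho> ` S" using TS by blast
    show "V.lin b" if "b \<in> \<rho> ` S" for b using that rep_lin[OF rep] by blast
    show "(\<rho> x \<circ> b) - (b \<circ> \<rho> x) \<in> \<rho> ` T" if "b \<in> \<rho> ` S" for b
      using that comm brT x TS by (auto simp: subset_iff)
  next
    fix y assume y: "V.lin y" and yS: "\<And>b. b \<in> \<rho> ` S \<Longrightarrow> (y \<circ> b) - (b \<circ> y) \<in> \<rho> ` T"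
    define Y where "Y = {z \<in> S. V.trace (\<rho> z \<circ> y) = 0}"
    have "subspace Y" unfolding subspace_def
    proof (intro conjI ballI allI)
      show "0 \<in> Y" using rep_zero[OF rep subspace_0[OF Ssub]] subspace_0[OF Ssub]
        by (simp add: Y_def comp_def V.trace_0)
      fix a b assume ab: "a \<in> Y" "b \<in> Y"
      have "\<rho> (a + b) \<circ> y = (\<lambda>v. (\<rho> a \<circ> y) v + (\<rho> b \<circ> y) v)"
        using ab rep_plus[OF rep] by (auto simp: Y_def)
      then show "a + b \<in> Y"
        using ab subspace_add[OF Ssub] V.trace_add[of "\<rho> a \<circ> y" "\<rho> b \<circ> y"]
        unfolding Y_def by simp
    next
      fix c a assume a: "a \<in> Y"
      have "\<rho> (scale c a) \<circ> y = (\<lambda>v. scale\<^sub>V c ((\<rho> a \<circ> y) v))"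
        using a rep_times[OF rep] by (auto simp: Y_def)
      then show "scale c a \<in> Y"
        using a subspace_scale[OF Ssub] V.trace_scale[of c "\<rho> a \<circ> y"] unfolding Y_def by simp
    qed
    moreover have "bracket a b \<in> Y" if a: "a \<in> S" and b: "b \<in> S" for a b
    proof -
      note la = rep_lin[OF rep a] and lb = rep_lin[OF rep b]
      obtain z where z: "z \<in> T" "(y \<circ> \<rho> b) - (\<rho> b \<circ> y) = \<rho> z" using yS[of "\<rho> b"] b by auto
      then have z': "y (\<rho> b v) - \<rho> b (y v) = \<rho> z v" for v by (metis minus_apply o_apply)
      have "V.trace (\<rho> (bracket a b) \<circ> y) =
        V.trace (\<lambda>v. (\<rho> a \<circ> \<rho> b \<circ> y) v - (\<rho> b \<circ> (\<rho> a \<circ> y)) v)"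
        by (rule arg_cong[where f = V.trace]) (simp add: fun_eq_iff rep_bracket[OF rep a b])
      also have "\<dots> = V.trace (\<rho> a \<circ> \<rho> b \<circ> y) - V.trace (\<rho> b \<circ> (\<rho> a \<circ> y))"
        by (rule V.trace_diff)
      also have "V.trace (\<rho> b \<circ> (\<rho> a \<circ> y)) = V.trace ((\<rho> a \<circ> y) \<circ> \<rho> b)"
        by (intro V.trace_comm V.lin_comp la lb y)
      also have "V.trace (\<rho> a \<circ> \<rho> b \<circ> y) - V.trace ((\<rho> a \<circ> y) \<circ> \<rho> b) =
        V.trace (\<lambda>v. (\<rho> a \<circ> \<rho> b \<circ> y) v - ((\<rho> a \<circ> y) \<circ> \<rho> b) v)"
        by (rule V.trace_diff[symmetric])
      also have "\<dots> = V.trace (\<lambda>v. scale\<^sub>V (- 1) ((\<rho> a \<circ> \<rho> z) v))"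
        by (rule arg_cong[where f = V.trace])
          (simp add: fun_eq_iff V.lin_diff[OF la] z'[symmetric])
      also have "\<dots> = 0"
        using V.trace_scale[of "- 1" "\<rho> a \<circ> \<rho> z"] tr[OF a, of z] z(1) TS by auto
      finally show ?thesis using S a b unfolding Y_def lie_subalgebra_def by blast
    qed
    ultimately have "T \<subseteq> Y" unfolding T_def derived_series.simps by (intro span_minimal) auto
    then show "V.trace (\<rho> x \<circ> y) = 0" using x by (auto simp: Y_def)
  qed
  then obtain N where N: "flag \<rho> T N = {0}" using engel[OF repT T] by blast
  have "\<forall>x\<in>derived_series S (Suc 0 + N). \<forall>v. \<rho> x v = 0"
    using derived_series_acts_trivially[OF repT T N]
    unfolding derived_series_add T_def[symmetric] by blast
  then show ?thesis by blast
qed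

end

section \<open>Dual bases and Casimir operators\<close>

context fin_dim_alg_closed
begin

lemma dim_kernel_functional:
  assumes U: "subspace U" and add: "\<And>x y. \<phi> (x + y) = \<phi> x + \<phi> y"
    and scale: "\<And>c x. \<phi> (scale c x) = c * (\<phi> x :: 'f)"
  shows "dim U \<le> Suc (dim {x \<in> U. \<phi> x = 0})"
proof (cases "\<exists>u\<in>U. \<phi> u \<noteq> 0")
  case True
  then obtain u where u: "u \<in> U" "\<phi> u \<noteq> 0" by blast
  have "x \<in> span (insert u {x \<in> U. \<phi> x = 0})" if "x \<in> U" for x
  proof -
    let ?k = "\<phi> x / \<phi> u"
    have "\<phi> (x - scale ?k u) = 0"
      using add[of "x - scale ?k u" "scale ?k u"] scale[of ?k u] u(2) by simp
    then have "x - scale ?k u \<in> span {x \<in> U. \<phi> x = 0}"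
      using that u(1) U by (auto intro: span_base subspace_diff subspace_scale)
    then show ?thesis unfolding span_breakdown_eq by blast
  qed
  then have "dim U \<le> dim (insert u {x \<in> U. \<phi> x = 0})"
    using dim_mono[of U "insert u {x \<in> U. \<phi> x = 0}"] by blast
  then show ?thesis by (simp add: dim_insert split: if_splits)
next
  case False
  then have "{x \<in> U. \<phi> x = 0} = U" by blast
  then show ?thesis by simp
qed

lemma dim_kernel_functionals:
  assumes "finite F" and K: "subspace K" and add: "\<And>f x y. \<phi> f (x + y) = \<phi> f x + \<phi> f y"
    and scale: "\<And>f c x. \<phi> f (scale c x) = c * (\<phi> f x :: 'f)"
  shows "subspace {x \<in> K. \<forall>f\<in>F. \<phi> f x = 0} \<and> dim K \<le> dim {x \<in> K. \<forall>f\<in>F. \<phi> f x = 0} + card F"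
  using assms(1)
proof (induction F rule: finite_induct)
  case (insert g F)
  let ?U = "{x \<in> K. \<forall>f\<in>F. \<phi> f x = 0}"
  have eq: "{x \<in> K. \<forall>f\<in>insert g F. \<phi> f x = 0} = {x \<in> ?U. \<phi> g x = 0}" by blast
  have "\<phi> g 0 = 0" using scale[of g 0 0] by simp
  then have "subspace {x \<in> ?U. \<phi> g x = 0}"
    using insert.IH unfolding subspace_def by (simp add: add scale)
  moreover have "dim ?U \<le> Suc (dim {x \<in> ?U. \<phi> g x = 0})"
    using insert.IH by (intro dim_kernel_functional add scale) blast
  ultimately show ?case unfolding eq using insert by simp
qed (use K in simp)

text \<open>A bilinear form on \<open>K\<close> whose kernel is \<open>Q\<close> identifies \<open>K/Q\<close> with its dual.\<close>

lemma ex_dual_basis: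
  assumes add: "\<And>x y z. \<beta> (x + y) z = \<beta> x z + \<beta> y z" "\<And>x y z. \<beta> x (y + z) = \<beta> x y + \<beta> x z"
    and scale: "\<And>c x y. \<beta> (scale c x) y = c * \<beta> x y" "\<And>c x y. \<beta> x (scale c y) = c * \<beta> x y"
    and K: "subspace K" and Q: "subspace Q" "Q \<subseteq> K"
    and \<beta>Q: "\<And>q y. q \<in> Q \<Longrightarrow> y \<in> K \<Longrightarrow> \<beta> y q = (0::'f)"
    and nondeg: "\<And>x. x \<in> K \<Longrightarrow> (\<And>y. y \<in> K \<Longrightarrow> \<beta> x y = 0) \<Longrightarrow> x \<in> Q"
  obtains E d where "finite E" "E \<subseteq> K" "\<And>e. e \<in> E \<Longrightarrow> d e \<in> K"
    "\<And>e f. e \<in> E \<Longrightarrow> f \<in> E \<Longrightarrow> \<beta> (d e) f = (if e = f then 1 else 0)"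
    "\<And>x. x \<in> K \<Longrightarrow> \<exists>c. x - (\<Sum>e\<in>E. scale (c e) e) \<in> Q"
proof -
  obtain B0 where B0: "B0 \<subseteq> Q" "independent B0" "Q \<subseteq> span B0"
    using maximal_independent_subset[of Q] by blast
  have "B0 \<subseteq> K" using B0(1) Q(2) by blast
  then obtain B1 where B1: "B0 \<subseteq> B1" "B1 \<subseteq> K" "independent B1" "K \<subseteq> span B1"
    using maximal_independent_subset_extend[OF _ B0(2)] by metis
  define E where "E = B1 - B0"
  have fB1: "finite B1" using B1(3) by (rule finiteI_independent)
  have fin: "finite E" "finite B0" using fB1 B1(1) unfolding E_def by (auto intro: finite_subset)
  have dimK: "dim K = card B1" using basis_card_eq_dim[OF B1(2,4,3)] by simp
  have dimQ: "dim Q = card B0" using basis_card_eq_dim[OF B0(1,3,2)] by simp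
  have cardE: "card E = dim K - dim Q" "dim Q \<le> dim K"
    unfolding dimK dimQ E_def
    using card_Diff_subset[OF fin(2) B1(1)] card_mono[OF fB1 B1(1)] by auto
  have expand: "\<exists>c. x - (\<Sum>e\<in>E. scale (c e) e) \<in> Q" if "x \<in> K" for x
  proof -
    have "x = (\<Sum>b\<in>B1. scale (representation B1 x b) b)"
      using B1(3,4) that fB1 by (intro sum_representation_eq[symmetric]) auto
    also have "\<dots> = (\<Sum>b\<in>B0. scale (representation B1 x b) b) +
        (\<Sum>b\<in>E. scale (representation B1 x b) b)"
      unfolding E_def using sum.subset_diff[OF B1(1) fB1] by (simp add: add.commute)
    finally have "x - (\<Sum>b\<in>E. scale (representation B1 x b) b) =
        (\<Sum>b\<in>B0. scale (representation B1 x b) b)"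
      by (simp add: algebra_simps)
    also have "\<dots> \<in> Q" using B0(1) Q(1) by (intro subspace_sum subspace_scale) auto
    finally show ?thesis by blast
  qed
  have \<beta>0: "\<beta> x 0 = 0" for x using scale(2)[of x 0 0] by simp
  have \<beta>sum: "\<beta> x (\<Sum>e\<in>I. g e) = (\<Sum>e\<in>I. \<beta> x (g e))" for x I and g :: "'v \<Rightarrow> 'v"
    by (induction I rule: infinite_finite_induct) (auto simp: \<beta>0 add)
  have "\<exists>d\<in>K. \<forall>f\<in>E. \<beta> d f = (if e = f then 1 else 0)" if e: "e \<in> E" for e
  proof -
    \<comment> \<open>One condition fewer than \<open>dim K - dim Q\<close> leaves a solution outside \<open>Q\<close>.\<close>
    let ?U = "{x \<in> K. \<forall>f\<in>E - {e}. \<beta> x f = 0}"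
    have U: "subspace ?U \<and> dim K \<le> dim ?U + card (E - {e})"
      by (rule dim_kernel_functionals[where \<phi> = "\<lambda>f x. \<beta> x f"]) (use fin K add scale in auto)
    have "card (E - {e}) < card E" using e fin(1) by (meson card_Diff1_less)
    then have "dim Q < dim ?U" using U cardE by linarith
    then have "\<not> ?U \<subseteq> Q" using dim_subset[of ?U Q] by linarith
    then obtain x where x: "x \<in> K" "x \<notin> Q" "\<forall>f\<in>E - {e}. \<beta> x f = 0" by blast
    have "\<beta> x e \<noteq> 0"
    proof
      assume xe: "\<beta> x e = 0"
      have "\<beta> x y = 0" if y: "y \<in> K" for y
      proof -
        obtain c where c: "y - (\<Sum>e\<in>E. scale (c e) e) \<in> Q" using expand[OF y] by blast
        have "\<beta> x y = \<beta> x (y - (\<Sum>e\<in>E. scale (c e) e)) + (\<Sum>f\<in>E. c f * \<beta> x f)"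
          using add(2)[of x "y - (\<Sum>e\<in>E. scale (c e) e)" "\<Sum>e\<in>E. scale (c e) e"]
          by (simp add: \<beta>sum scale)
        also have "\<dots> = 0" using \<beta>Q[OF c x(1)] x(3) xe by (auto intro!: sum.neutral)
        finally show ?thesis .
      qed
      then show False using nondeg x by blast
    qed
    then have "\<forall>f\<in>E. \<beta> (scale (inverse (\<beta> x e)) x) f = (if e = f then 1 else 0)"
      using x(3) by (auto simp: scale)
    moreover have "scale (inverse (\<beta> x e)) x \<in> K" using x(1) K by (intro subspace_scale)
    ultimately show ?thesis by blast
  qed
  then have "\<forall>e\<in>E. \<exists>d. d \<in> K \<and> (\<forall>f\<in>E. \<beta> d f = (if e = f then 1 else 0))" by blast
  from bchoice[OF this] obtain d
      where d: "\<forall>e\<in>E. d e \<in> K \<and> (\<forall>f\<in>E. \<beta> (d e) f = (if e = f then 1 else 0))" ..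
  have dK: "d e \<in> K" if "e \<in> E" for e using d that by simp
  have dd: "\<beta> (d e) f = (if e = f then 1 else 0)" if "e \<in> E" "f \<in> E" for e f using d that by simp
  have "E \<subseteq> K" using B1(2) unfolding E_def by blast
  then show thesis by (rule that[OF fin(1) _ dK dd expand])
qed

end

text \<open>An invariant form on the ideal \<open>J\<close> of \<open>S\<close>, with kernel \<open>Q\<close>, and bases \<open>E\<close> and \<open>d ` E\<close> of
  \<open>J\<close> modulo \<open>Q\<close> that are dual to each other.\<close>

locale dual_bases = based_lie_algebra scale bracket Basis
  for scale :: "'f::{alg_closed_field, field_char_0} \<Rightarrow> 'm::ab_group_add \<Rightarrow> 'm"
    and bracket and Basis +
  fixes \<beta> :: "'m \<Rightarrow> 'm \<Rightarrow> 'f" and S J Q :: "'m set" and E :: "'m set" and d :: "'m \<Rightarrow> 'm"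
  assumes form_add: "\<beta> (x + y) z = \<beta> x z + \<beta> y z"
    and form_scale: "\<beta> (scale c x) y = c * \<beta> x y"
    and form_sym: "\<beta> x y = \<beta> y x"
    and form_invariant: "x \<in> S \<Longrightarrow> y \<in> S \<Longrightarrow> z \<in> S \<Longrightarrow> \<beta> (bracket x y) z = \<beta> x (bracket y z)"
    and S: "lie_subalgebra S" and J: "lie_ideal J S" and Q: "lie_ideal Q S" and QJ: "Q \<subseteq> J"
    and form_kernel: "q \<in> Q \<Longrightarrow> \<beta> q y = 0"
    and nondegenerate: "x \<in> J \<Longrightarrow> (\<And>y. y \<in> J \<Longrightarrow> \<beta> x y = 0) \<Longrightarrow> x \<in> Q"
    and finite_E: "finite E" and EJ: "E \<subseteq> J" and dJ: "e \<in> E \<Longrightarrow> d e \<in> J"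
    and dual: "e \<in> E \<Longrightarrow> f \<in> E \<Longrightarrow> \<beta> (d e) f = (if e = f then 1 else 0)"
    and spanning: "x \<in> J \<Longrightarrow> \<exists>c. x - (\<Sum>e\<in>E. scale (c e) e) \<in> Q"
begin

lemma form_diff: "\<beta> (x - y) z = \<beta> x z - \<beta> y z"
  using form_add[of "x - y" y z] by simp

lemma form_0: "\<beta> 0 x = 0"
  using form_scale[of 0 0 x] by simp

lemma form_sum: "\<beta> (sum g I) y = (\<Sum>i\<in>I. \<beta> (g i) y)"
  by (induction I rule: infinite_finite_induct) (auto simp: form_0 form_add)

lemma form_diff_right: "\<beta> z (x - y) = \<beta> z x - \<beta> z y"
  using form_diff[of x y z] unfolding form_sym[of _ z] .

lemma form_sum_right: "\<beta> y (sum g I) = (\<Sum>i\<in>I. \<beta> y (g i))"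
  using form_sum[of g I y] unfolding form_sym[of _ y] .

lemma form_scale_right: "\<beta> y (scale c x) = c * \<beta> y x"
  using form_scale[of c x y] unfolding form_sym[of _ y] .

lemma form_neg: "\<beta> (- x) y = - \<beta> x y"
  using form_diff[of 0 x y] form_0[of y] by simp

lemma subspaces: "subspace S" "subspace J" "subspace Q"
  using S J Q by (auto simp: lie_subalgebra_def lie_ideal_def)

lemma JS: "x \<in> J \<Longrightarrow> x \<in> S"
  using J by (auto simp: lie_ideal_def)

lemma ES: "e \<in> E \<Longrightarrow> e \<in> S" "e \<in> E \<Longrightarrow> d e \<in> S"
  using EJ dJ JS by auto

lemma bracket_J: "x \<in> S \<Longrightarrow> y \<in> J \<Longrightarrow> bracket x y \<in> J"
  using J by (auto simp: lie_ideal_def)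

lemma expand: 
  assumes x: "x \<in> J"
  shows "x - (\<Sum>e\<in>E. scale (\<beta> (d e) x) e) \<in> Q"
proof -
  obtain c where c: "x - (\<Sum>e\<in>E. scale (c e) e) \<in> Q" using spanning[OF x] by blast
  have "\<beta> (d f) x = c f" if f: "f \<in> E" for f
  proof -
    have "\<beta> (d f) (x - (\<Sum>e\<in>E. scale (c e) e)) = 0"
      using form_kernel[OF c] form_sym[of "d f"] by simp
    then have "\<beta> (d f) x = (\<Sum>e\<in>E. c e * \<beta> (d f) e)"
      by (simp add: form_diff_right form_sum_right form_scale_right)
    also have "\<dots> = (\<Sum>e\<in>E. if f = e then c e else 0)"
      by (intro sum.cong refl) (simp add: dual f)
    also have "\<dots> = c f" using f finite_E by simp
    finally show ?thesis .
  qed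
  then have "(\<Sum>e\<in>E. scale (\<beta> (d e) x) e) = (\<Sum>e\<in>E. scale (c e) e)" by simp
  then show ?thesis using c by simp
qed

lemma orthogonal_remainder:
  assumes y: "y \<in> J"
  shows "\<beta> (x - (\<Sum>e\<in>E. scale (\<beta> x e) (d e))) y = 0"
proof -
  let ?z = "x - (\<Sum>e\<in>E. scale (\<beta> x e) (d e))"
  have zf: "\<beta> ?z f = 0" if f: "f \<in> E" for f
  proof -
    have "(\<Sum>e\<in>E. \<beta> x e * \<beta> (d e) f) = (\<Sum>e\<in>E. if e = f then \<beta> x e else 0)"
      by (intro sum.cong refl) (simp add: dual f)
    also have "\<dots> = \<beta> x f" using f finite_E by simp
    finally show ?thesis by (simp add: form_diff form_sum form_scale)
  qed
  have "\<beta> ?z (y - (\<Sum>e\<in>E. scale (\<beta> (d e) y) e)) = 0"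
    using form_kernel[OF expand[OF y]] form_sym[of ?z] by simp
  moreover have "(\<Sum>e\<in>E. \<beta> (d e) y * \<beta> ?z e) = 0"
    by (intro sum.neutral ballI) (simp only: zf mult_zero_right)
  ultimately show ?thesis
    by (simp only: form_diff_right[of ?z y] form_sum_right[of ?z] form_scale_right[of ?z] diff_zero)
qed

lemma expand_dual:
  assumes x: "x \<in> J"
  shows "x - (\<Sum>e\<in>E. scale (\<beta> x e) (d e)) \<in> Q"
proof (rule nondegenerate)
  show "x - (\<Sum>e\<in>E. scale (\<beta> x e) (d e)) \<in> J"
    using x dJ subspaces(2) by (intro subspace_diff subspace_sum subspace_scale) auto
qed (rule orthogonal_remainder)

text \<open>The tensor \<open>\<Sum>e. e \<otimes> d e\<close> is \<open>S\<close>-invariant modulo \<open>Q\<close>. It is tested here against a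
  bilinear map \<open>\<Phi>\<close> that is only defined modulo \<open>P\<close>.\<close>

lemma dual_tensor_invariant:
  assumes add: "\<And>a b c. \<Phi> (a + b) c = \<Phi> a c + \<Phi> b c" "\<And>a b c. \<Phi> a (b + c) = \<Phi> a b + \<Phi> a c"
    and scale: "\<And>r a b. \<Phi> (scale r a) b = scale r (\<Phi> a b)" "\<And>r a b. \<Phi> a (scale r b) =
        scale r (\<Phi> a b)"
    and P: "subspace P" and \<Phi>Q: "\<And>q b. q \<in> Q \<Longrightarrow> b \<in> J \<Longrightarrow> \<Phi> q b \<in> P" "\<And>a q. q \<in> Q \<Longrightarrow> a \<in> J \<Longrightarrow> \<Phi> a q \<in> P"
    and x: "x \<in> S"
  shows "(\<Sum>e\<in>E. \<Phi> (bracket x e) (d e) + \<Phi> e (bracket x (d e))) \<in> P"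
proof -
  have diff: "\<Phi> (a - b) c = \<Phi> a c - \<Phi> b c" "\<Phi> a (b - c) = \<Phi> a b - \<Phi> a c" for a b c
    using add(1)[of "a - b" b c] add(2)[of a "b - c" c] by (simp_all add: algebra_simps)
  have zero: "\<Phi> 0 c = 0" "\<Phi> c 0 = 0" for c
    using diff(1)[of 0 0 c] diff(2)[of c 0 0] by simp_all
  have sum: "\<Phi> (sum g I) c = (\<Sum>i\<in>I. \<Phi> (g i) c)" "\<Phi> c (sum g I) = (\<Sum>i\<in>I. \<Phi> c (g i))"
    for g :: "'m \<Rightarrow> 'm" and I c
    by (induction I rule: infinite_finite_induct; simp add: zero add)+
  have 1: "\<Phi> (bracket x e) (d e) - (\<Sum>f\<in>E. scale (\<beta> (d f) (bracket x e)) (\<Phi> f (d e))) \<in> P"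
      if "e \<in> E" for e
    using \<Phi>Q(1)[OF expand[OF bracket_J[OF x]] dJ[OF that], of e] that EJ
    by (auto simp: diff sum scale)
  have 2: "\<Phi> e (bracket x (d e)) - (\<Sum>f\<in>E. scale (\<beta> (bracket x (d e)) f) (\<Phi> e (d f))) \<in> P"
      if "e \<in> E" for e
    using \<Phi>Q(2)[OF expand_dual[OF bracket_J[OF x dJ[OF that]]], of e] that EJ
    by (auto simp: diff sum scale)
  have skew: "\<beta> (d f) (bracket x e) = - \<beta> (bracket x (d f)) e" if "e \<in> E" "f \<in> E" for e f
    using form_invariant[of "d f" x e] ES x that bracket_skew[of x "d f"] by (simp add: form_neg)
  have "(\<Sum>e\<in>E. \<Sum>f\<in>E. scale (\<beta> (d f) (bracket x e)) (\<Phi> f (d e))) =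
    - (\<Sum>e\<in>E. \<Sum>f\<in>E. scale (\<beta> (bracket x (d f)) e) (\<Phi> f (d e)))"
    by (simp add: skew flip: sum_negf)
  also have "(\<Sum>e\<in>E. \<Sum>f\<in>E. scale (\<beta> (bracket x (d f)) e) (\<Phi> f (d e))) =
    (\<Sum>e\<in>E. \<Sum>f\<in>E. scale (\<beta> (bracket x (d e)) f) (\<Phi> e (d f)))"
    by (rule sum.swap)
  finally have "(\<Sum>e\<in>E. \<Phi> (bracket x e) (d e) + \<Phi> e (bracket x (d e))) =
    (\<Sum>e\<in>E. (\<Phi> (bracket x e) (d e) - (\<Sum>f\<in>E. scale (\<beta> (d f) (bracket x e)) (\<Phi> f (d e)))) +
      (\<Phi> e (bracket x (d e)) - (\<Sum>f\<in>E. scale (\<beta> (bracket x (d e)) f) (\<Phi> e (d f)))))"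
    by (simp add: sum.distrib sum_subtractf)
  also have "\<dots> \<in> P" using 1 2 P by (intro subspace_sum subspace_add)
  finally show ?thesis .
qed

end

context based_lie_algebra
begin

definition stable :: "'m set \<Rightarrow> 'm set \<Rightarrow> bool"
  where "stable S W \<longleftrightarrow> subspace W \<and> (\<forall>x\<in>S. \<forall>w\<in>W. bracket x w \<in> W)"

definition casimir :: "'m set \<Rightarrow> ('m \<Rightarrow> 'm) \<Rightarrow> 'm \<Rightarrow> 'm"
  where "casimir E d v = (\<Sum>e\<in>E. bracket e (bracket (d e) v))"

lemma lin_casimir: "lin (casimir E d)"
  unfolding casimir_def
  by (rule linI) (simp_all add: bracket_add_right bracket_scale_right sum.distrib scale_sum_right)

lemma casimir_stable: "stable S W \<Longrightarrow> E \<subseteq> S \<Longrightarrow> d ` E \<subseteq> S \<Longrightarrow> w \<in> W \<Longrightarrow> casimir E d w \<in> W"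
  unfolding casimir_def stable_def
    by (intro subspace_sum) (simp_all add: image_subset_iff subset_iff)

lemma lie_ideal_stable: "lie_ideal I S \<Longrightarrow> stable S I"
  by (auto simp: lie_ideal_def stable_def)

end

lemma (in dual_bases) casimir_commutes:
  assumes W: "stable S W" and P: "stable S P" and QW: "\<And>q w. q \<in> Q \<Longrightarrow> w \<in> W \<Longrightarrow> bracket q w \<in> P"
    and x: "x \<in> S" and v: "v \<in> W"
  shows "bracket x (casimir E d v) - casimir E d (bracket x v) \<in> P"
proof -
  have "(\<Sum>e\<in>E. bracket (bracket x e) (bracket (d e) v) + bracket e (bracket (bracket x (d e)) v)) \<in>
      P"
    by (rule dual_tensor_invariant[where \<Phi> = "\<lambda>a b. bracket a (bracket b v)"])
      (use W P v x QW JS in \<open>auto simp: bracket_add_left bracket_add_right bracket_scale_left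
        bracket_scale_right stable_def\<close>)
  moreover have "bracket x (casimir E d v) - casimir E d (bracket x v) =
    (\<Sum>e\<in>E. bracket (bracket x e) (bracket (d e) v) + bracket e (bracket (bracket x (d e)) v))"
    unfolding casimir_def bracket_sum_right sum_subtractf[symmetric]
    by (intro sum.cong refl) (simp add: bracket_bracket bracket_diff_right)
  ultimately show ?thesis by simp
qed

section \<open>Trace forms of subquotients of the adjoint representation\<close>

text \<open>The quotient \<open>W/P\<close> is modelled by the range of \<open>\<pi>\<close>, a complement of \<open>P\<close> in \<open>W\<close>, on which \<open>S\<close>
  acts by compressed operators. This avoids a separate type for the quotient.\<close>

locale subquotient = based_lie_algebra scale bracket Basis
  for scale :: "'f::{alg_closed_field, field_char_0} \<Rightarrow> 'm::ab_group_add \<Rightarrow> 'm"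
    and bracket and Basis +
  fixes S W P :: "'m set" and \<pi> :: "'m \<Rightarrow> 'm"
  assumes S: "lie_subalgebra S" and W: "stable S W" and P: "stable S P"
    and lin_proj: "lin \<pi>" and proj_mem: "\<pi> v \<in> W" and proj_P: "a \<in> P \<Longrightarrow> \<pi> a = 0"
    and proj_mod: "b \<in> W \<Longrightarrow> b - \<pi> b \<in> P" and proj_idem: "\<pi> (\<pi> v) = \<pi> v"
begin

sublocale ad: lie_algebra_and_space scale bracket Basis scale Basis
  by unfold_locales

definition act_quot :: "'m \<Rightarrow> 'm \<Rightarrow> 'm"
  where "act_quot x = \<pi> \<circ> bracket x \<circ> \<pi>"

definition trace_form :: "'m \<Rightarrow> 'm \<Rightarrow> 'f"
  where "trace_form x y = trace (act_quot x \<circ> act_quot y)"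

lemma lin_act_quot: "lin (act_quot x)"
  unfolding act_quot_def by (intro lin_comp lin_proj lin_bracket)

lemma act_quot_add: "act_quot (x + y) v = act_quot x v + act_quot y v"
  and act_quot_scale: "act_quot (scale c x) v = scale c (act_quot x v)"
  by (simp_all add: act_quot_def bracket_add_left bracket_scale_left lin_add[OF lin_proj]
      lin_scale[OF lin_proj])

lemma proj_cong: "a - b \<in> P \<Longrightarrow> \<pi> a = \<pi> b"
  using proj_P[of "a - b"] by (simp add: lin_diff[OF lin_proj])

lemma act_quot_comp:
  assumes "x \<in> S" "y \<in> S"
  shows "act_quot x (act_quot y v) = \<pi> (bracket x (bracket y (\<pi> v)))"
proof -
  have "bracket y (\<pi> v) - \<pi> (bracket y (\<pi> v)) \<in> P"
    using proj_mod W assms proj_mem by (auto simp: stable_def)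
  then have "bracket x (bracket y (\<pi> v)) - bracket x (\<pi> (bracket y (\<pi> v))) \<in> P"
    using P assms(1) unfolding stable_def by (metis bracket_diff_right)
  from proj_cong[OF this] show ?thesis by (simp add: act_quot_def proj_idem)
qed

lemma act_quot_bracket:
  assumes "x \<in> S" "y \<in> S"
  shows "act_quot (bracket x y) v = act_quot x (act_quot y v) - act_quot y (act_quot x v)"
  unfolding act_quot_comp[OF assms] act_quot_comp[OF assms(2,1)]
  by (simp add: act_quot_def bracket_bracket lin_diff[OF lin_proj])

lemma representation_act_quot: "ad.is_representation S act_quot"
  unfolding ad.is_representation_def
  using lin_act_quot act_quot_add act_quot_scale act_quot_bracket by blast

lemma act_quot_eq_0_iff:
  assumes x: "x \<in> S"
  shows "(\<forall>v. act_quot x v = 0) \<longleftrightarrow> (\<forall>w\<in>W. bracket x w \<in> P)"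
proof
  assume 0: "\<forall>v. act_quot x v = 0"
  show "\<forall>w\<in>W. bracket x w \<in> P"
  proof
    fix w assume w: "w \<in> W"
    have "bracket x (\<pi> w) - \<pi> (bracket x (\<pi> w)) \<in> P"
      using proj_mod W x proj_mem by (auto simp: stable_def)
    then have "bracket x (\<pi> w) \<in> P" using 0 by (simp add: act_quot_def)
    moreover have "bracket x (w - \<pi> w) \<in> P" using proj_mod[OF w] P x by (auto simp: stable_def)
    ultimately have "bracket x (\<pi> w) + bracket x (w - \<pi> w) \<in> P"
      using P subspace_add by (auto simp: stable_def)
    then show "bracket x w \<in> P" by (simp flip: bracket_add_right)
  qed
next
  assume "\<forall>w\<in>W. bracket x w \<in> P"
  then show "\<forall>v. act_quot x v = 0" using proj_P proj_mem by (simp add: act_quot_def)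
qed

lemma trace_form_sym: "trace_form x y = trace_form y x"
  unfolding trace_form_def by (intro trace_comm lin_act_quot)

lemma trace_form_add: "trace_form (x + y) z = trace_form x z + trace_form y z"
  unfolding trace_form_def trace_add[symmetric] by (simp add: comp_def act_quot_add)

lemma trace_form_scale: "trace_form (scale c x) z = c * trace_form x z"
  unfolding trace_form_def trace_scale[symmetric] by (simp add: comp_def act_quot_scale)

lemma trace_form_add_right: "trace_form z (x + y) = trace_form z x + trace_form z y"
  and trace_form_scale_right: "trace_form z (scale c x) = c * trace_form z x"
  using trace_form_add[of x y z] trace_form_scale[of c x z] unfolding trace_form_sym[of _ z] .

lemma trace_form_invariant:
  assumes "x \<in> S" "y \<in> S" "z \<in> S"
  shows "trace_form (bracket x y) z = trace_form x (bracket y z)"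
proof -
  let ?a = act_quot
  have l: "?a (bracket x y) \<circ> ?a z = (\<lambda>v. (?a x \<circ> (?a y \<circ> ?a z)) v - (?a y \<circ> (?a x \<circ> ?a z)) v)"
    by (auto simp: act_quot_bracket[OF assms(1,2)])
  have r: "?a x \<circ> ?a (bracket y z) = (\<lambda>v. (?a x \<circ> (?a y \<circ> ?a z)) v - ((?a x \<circ> ?a z) \<circ> ?a y) v)"
    by (auto simp: act_quot_bracket[OF assms(2,3)] lin_diff[OF lin_act_quot])
  have "trace (?a y \<circ> (?a x \<circ> ?a z)) = trace ((?a x \<circ> ?a z) \<circ> ?a y)"
    by (intro trace_comm lin_comp lin_act_quot)
  then show ?thesis unfolding trace_form_def l r trace_diff by (simp only:)
qed

lemma trace_form_eq_0:
  assumes "x \<in> S" "\<And>w. w \<in> W \<Longrightarrow> bracket x w \<in> P"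
  shows "trace_form x y = 0"
proof -
  have "act_quot x \<circ> act_quot y = (\<lambda>v. 0)" using act_quot_eq_0_iff[OF assms(1)] assms(2) by auto
  then show ?thesis by (simp add: trace_form_def trace_0)
qed

lemma lie_ideal_orthogonal:
  assumes J: "lie_ideal J S" and K: "lie_ideal K S"
  shows "lie_ideal {x \<in> J. \<forall>y\<in>K. trace_form x y = 0} S"
  unfolding lie_ideal_def
proof (intro conjI ballI)
  have "subspace J" "J \<subseteq> S" using J by (auto simp: lie_ideal_def)
  then show "{x \<in> J. \<forall>y\<in>K. trace_form x y = 0} \<subseteq> S" by blast
  have "trace_form 0 y = 0" for y using trace_form_scale[of 0 0 y] by simp
  then show "subspace {x \<in> J. \<forall>y\<in>K. trace_form x y = 0}"
    using \<open>subspace J\<close> unfolding subspace_def by (simp add: trace_form_add trace_form_scale)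
  fix s x assume s: "s \<in> S" and x: "x \<in> {x \<in> J. \<forall>y\<in>K. trace_form x y = 0}"
  have "trace_form (bracket s x) y = 0" if y: "y \<in> K" for y
  proof -
    have xs: "x \<in> S" and ys: "y \<in> S" using x y \<open>J \<subseteq> S\<close> K by (auto simp: lie_ideal_def)
    have "trace_form (bracket s x) y = - trace_form (bracket x s) y"
      using bracket_skew[of s x] trace_form_scale[of "- 1" "bracket x s" y] by simp
    also have "\<dots> = - trace_form x (bracket s y)"
      using trace_form_invariant[OF xs s ys] by simp
    also have "\<dots> = 0" using x y s K by (auto simp: lie_ideal_def)
    finally show ?thesis .
  qed
  then show "bracket s x \<in> {x \<in> J. \<forall>y\<in>K. trace_form x y = 0}"
    using x s J by (auto simp: lie_ideal_def)
qed

lemma isotropic_acts_solvably: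
  assumes "lie_subalgebra I" "I \<subseteq> S" "\<And>x y. x \<in> I \<Longrightarrow> y \<in> I \<Longrightarrow> trace_form x y = 0"
  shows "\<exists>n. \<forall>x\<in>derived_series I n. \<forall>w\<in>W. bracket x w \<in> P"
proof -
  obtain n where "\<forall>x\<in>derived_series I n. \<forall>v. act_quot x v = 0"
    using ad.cartan_criterion[OF ad.rep_subset[OF representation_act_quot assms(2)] assms(1)]
        assms(3)
    unfolding trace_form_def by blast
  then show ?thesis
    using act_quot_eq_0_iff derived_series_subset[OF assms(1)] assms(2) by blast
qed

lemma ex_dual_bases:
  assumes J: "lie_ideal J S" and Q: "lie_ideal Q S" "Q \<subseteq> J"
    and QW: "\<And>q w. q \<in> Q \<Longrightarrow> w \<in> W \<Longrightarrow> bracket q w \<in> P"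
    and nondeg: "\<And>x. x \<in> J \<Longrightarrow> (\<And>y. y \<in> J \<Longrightarrow> trace_form x y = 0) \<Longrightarrow> x \<in> Q"
  obtains E d where "dual_bases scale bracket Basis trace_form S J Q E d"
proof -
  have ker: "trace_form q y = 0" if "q \<in> Q" for q y
    using trace_form_eq_0[of q y] QW that Q(1) by (auto simp: lie_ideal_def)
  have sub: "subspace J" "subspace Q" using J Q by (auto simp: lie_ideal_def)
  have ker': "trace_form y q = 0" if "q \<in> Q" "y \<in> J" for q y
    using ker[OF that(1), of y] trace_form_sym[of y q] by simp
  show thesis
  proof (rule ex_dual_basis[OF trace_form_add trace_form_add_right trace_form_scale
        trace_form_scale_right sub Q(2) ker' nondeg])
    fix E d assume Ed: "finite E" "E \<subseteq> J" "\<And>e. e \<in> E \<Longrightarrow> d e \<in> J"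
      "\<And>e f. e \<in> E \<Longrightarrow> f \<in> E \<Longrightarrow> trace_form (d e) f = (if e = f then 1 else 0)"
      "\<And>x. x \<in> J \<Longrightarrow> \<exists>c. x - (\<Sum>e\<in>E. scale (c e) e) \<in> Q"
    show thesis
      by (rule that[of E d], unfold_locales)
        (fact trace_form_add trace_form_scale trace_form_sym trace_form_invariant S J Q(1) Q(2)
          ker nondeg Ed)+
  qed
qed

end

lemma (in lie_algebra) solvableI:
  assumes "subspace I" "derived_series I n \<subseteq> {0}"
  shows "solvable I"
  using assms subspace_0[OF subspace_derived_series[OF assms(1), of n]]
  unfolding solvable_def by blast

lemma (in lie_algebra) solvable_subset:
  assumes "solvable I" "J \<subseteq> I" "subspace J"
  shows "solvable J"
  using assms derived_series_mono[OF assms(2)] unfolding solvable_def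
  by (metis solvableI solvable_def)

section \<open>Consequences of Cartan's criterion for semisimple quotients\<close>

context based_lie_algebra
begin

lemma subspace_subalgebra: "lie_subalgebra S \<Longrightarrow> subspace S"
  by (simp add: lie_subalgebra_def)

lemma bracket_subalgebra: "lie_subalgebra S \<Longrightarrow> x \<in> S \<Longrightarrow> y \<in> S \<Longrightarrow> bracket x y \<in> S"
  by (simp add: lie_subalgebra_def)

lemma stable_subalgebra: "lie_subalgebra S \<Longrightarrow> stable S S"
  by (simp add: lie_subalgebra_def stable_def)

lemma lie_ideal_self: "lie_subalgebra S \<Longrightarrow> lie_ideal S S"
  by (simp add: lie_subalgebra_def lie_ideal_def)

lemma stable_subset: "stable S W \<Longrightarrow> T \<subseteq> S \<Longrightarrow> stable T W"
  by (auto simp: stable_def)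

lemma stableD: "stable S W \<Longrightarrow> x \<in> S \<Longrightarrow> w \<in> W \<Longrightarrow> bracket x w \<in> W"
  and stable_subspace: "stable S W \<Longrightarrow> subspace W"
  by (simp_all add: stable_def)

lemma ex_subquotient:
  assumes "lie_subalgebra S" "stable S W" "stable S P"
  obtains \<pi> where "subquotient scale bracket Basis S W P \<pi>"
proof -
  obtain p where p: "lin p" "\<And>v. p v \<in> W" "\<And>a. a \<in> P \<Longrightarrow> p a = 0"
    "\<And>b. b \<in> W \<Longrightarrow> b - p b \<in> P" "\<And>v. p (p v) = p v"
    by (rule ex_projection[of P W]) (use assms in \<open>simp_all add: stable_def\<close>)
  show thesis
    by (rule that[of p], intro subquotient.intro subquotient_axioms.intro based_lie_algebra_axioms)
      (fact assms p)+
qed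

lemma subset_radical_if_derived_subset:
  assumes S: "lie_subalgebra S" and I: "lie_ideal I S" and "derived_series I n \<subseteq> solvable_radical S"
  shows "I \<subseteq> solvable_radical S"
proof -
  obtain m where "derived_series (solvable_radical S) m = {0}"
    using solvable_radical_greatest(2)[OF S] by (auto simp: solvable_def)
  then have "derived_series I (n + m) \<subseteq> {0}"
    using derived_series_mono[OF assms(3), of m] by (simp add: derived_series_add)
  then have "solvable I" using I by (intro solvableI) (auto simp: lie_ideal_def)
  then show ?thesis using solvable_radical_greatest(3)[OF S I] by blast
qed

lemma subset_radical_if_central_mod_radical:
  assumes S: "lie_subalgebra S" and I: "lie_ideal I S"
    and "\<And>x y. x \<in> derived_series I n \<Longrightarrow> y \<in> S \<Longrightarrow> bracket x y \<in> solvable_radical S"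
  shows "I \<subseteq> solvable_radical S"
proof (rule subset_radical_if_derived_subset[OF S I, of "Suc n"])
  have "derived_series I n \<subseteq> S"
    using derived_series_subset[OF lie_ideal_imp_subalgebra[OF I]] I by (auto simp: lie_ideal_def)
  then show "derived_series I (Suc n) \<subseteq> solvable_radical S"
    unfolding derived_series.simps using assms(3) solvable_radical_greatest(1)[OF S]
    by (intro span_minimal) (auto simp: lie_ideal_def)
qed

text \<open>For the Killing form of \<open>S\<close> modulo its radical, isotropic ideals are solvable by Cartan's
  criterion.\<close>

lemma isotropic_ideal_subset_radical:
  assumes "subquotient scale bracket Basis S S (solvable_radical S) \<pi>" and I: "lie_ideal I S"
    and 0: "\<And>x y. x \<in> I \<Longrightarrow> y \<in> I \<Longrightarrow> subquotient.trace_form scale bracket Basis \<pi> x y = 0"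
  shows "I \<subseteq> solvable_radical S"
proof -
  interpret subquotient scale bracket Basis S S "solvable_radical S" \<pi> by fact
  have "I \<subseteq> S" using I by (simp add: lie_ideal_def)
  then obtain n where "\<forall>x\<in>derived_series I n. \<forall>w\<in>S. bracket x w \<in> solvable_radical S"
    using isotropic_acts_solvably[OF lie_ideal_imp_subalgebra[OF I] _ 0] by blast
  then show ?thesis using subset_radical_if_central_mod_radical[OF S I] by blast
qed

text \<open>The complement is the orthogonal space of \<open>K\<close> for the Killing form of \<open>S\<close> modulo its radical;
  it meets \<open>K\<close> in an isotropic ideal.\<close>

lemma ex_ideal_complement:
  assumes S: "lie_subalgebra S" and K: "lie_ideal K S" and QK: "solvable_radical S \<subseteq> K"
  obtains J where "lie_ideal J S" "J \<inter> K = solvable_radical S" "\<And>x. x \<in> S \<Longrightarrow> \<exists>k\<in>K. x - k \<in> J"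
proof -
  let ?Q = "solvable_radical S"
  note Q = solvable_radical_greatest(1)[OF S]
  obtain \<pi> where sq: "subquotient scale bracket Basis S S ?Q \<pi>"
    using ex_subquotient[OF S stable_subalgebra[OF S] lie_ideal_stable[OF Q]] .
  interpret subquotient scale bracket Basis S S ?Q \<pi> by (fact sq)
  have QS: "bracket q w \<in> ?Q" if "q \<in> ?Q" "w \<in> S" for q w using lie_ideal_bracket_left[OF Q that] .
  have KS: "K \<subseteq> S" "subspace K" using K by (auto simp: lie_ideal_def)
  define J where "J = {x \<in> S. \<forall>y\<in>K. trace_form x y = 0}"
  have J: "lie_ideal J S" unfolding J_def by (rule lie_ideal_orthogonal[OF lie_ideal_self[OF S] K])
  have JK: "lie_ideal (J \<inter> K) S"
    using J K unfolding lie_ideal_def by (auto intro: subspace_inter)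
  have sub: "J \<inter> K \<subseteq> ?Q"
    by (rule isotropic_ideal_subset_radical[OF sq JK]) (auto simp: J_def)
  have QJ: "?Q \<subseteq> J"
    using trace_form_eq_0 QS QK KS by (auto simp: J_def)
  have "\<exists>k\<in>K. x - k \<in> J" if x: "x \<in> S" for x
  proof -
    have nondeg: "y \<in> ?Q" if "y \<in> K" "\<And>z. z \<in> K \<Longrightarrow> trace_form y z = 0" for y
      using that sub KS by (auto simp: J_def)
    obtain E d where "dual_bases scale bracket Basis trace_form S K ?Q E d"
      by (rule ex_dual_bases[OF K Q QK QS nondeg])
    then interpret D: dual_bases scale bracket Basis trace_form S K ?Q E d .
    let ?k = "\<Sum>e\<in>E. scale (trace_form x e) (d e)"
    have k: "?k \<in> K" using D.dJ KS(2) by (intro subspace_sum subspace_scale)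
    have "\<And>y. y \<in> K \<Longrightarrow> trace_form (x - ?k) y = 0" by (rule D.orthogonal_remainder)
    moreover have "x - ?k \<in> S" using x k KS subspace_subalgebra[OF S] by (auto intro: subspace_diff)
    ultimately show ?thesis using k unfolding J_def by blast
  qed
  then show thesis using that[OF J] sub QJ QK by blast
qed

text \<open>A complement of the derived algebra is an abelian ideal.\<close>

lemma semisimple_perfect:
  assumes S: "lie_subalgebra S" and ss: "solvable_radical S = {0}"
  shows "derived_series S 1 = S"
proof -
  let ?K = "derived_series S (Suc 0)"
  have KS: "?K \<subseteq> S" by (rule derived_series_subset[OF S])
  have K: "lie_ideal ?K S"
    using KS unfolding lie_ideal_def by (auto intro!: span_base)
  have "solvable_radical S \<subseteq> ?K" using ss by (auto intro: span_zero)
  then obtain J where J: "lie_ideal J S" "J \<inter> ?K = {0}" "\<And>x. x \<in> S \<Longrightarrow> \<exists>k\<in>?K. x - k \<in> J"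
    using ex_ideal_complement[OF S K] unfolding ss by blast
  have JS: "J \<subseteq> S" using J(1) by (simp add: lie_ideal_def)
  have "bracket x y = 0" if "x \<in> J" "y \<in> J" for x y
  proof -
    have "bracket x y \<in> J" using J(1) JS that by (auto simp: lie_ideal_def)
    moreover have "bracket x y \<in> ?K" using that JS by (auto intro: span_base)
    ultimately show ?thesis using J(2) by blast
  qed
  then have "derived_series J (Suc 0) \<subseteq> solvable_radical S"
    unfolding derived_series.simps ss by (intro span_minimal) auto
  then have "J \<subseteq> {0}" using subset_radical_if_derived_subset[OF S J(1)] ss by blast
  then have "S \<subseteq> ?K" using J(3) by fastforce
  then show ?thesis using KS by auto
qed

text \<open>Ideals of semisimple algebras are semisimple: an ideal of \<open>K\<close> is normalized by \<open>K\<close> and by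
  the complementary ideal, hence is an ideal of \<open>S\<close>.\<close>

lemma ideal_of_semisimple:
  assumes S: "lie_subalgebra S" and ss: "solvable_radical S = {0}" and K: "lie_ideal K S"
    and I: "lie_ideal I K" "solvable I"
  shows "I \<subseteq> {0}"
proof -
  have "solvable_radical S \<subseteq> K" using ss K subspace_0 by (auto simp: lie_ideal_def)
  then obtain J where J: "lie_ideal J S" "J \<inter> K = {0}" "\<And>x. x \<in> S \<Longrightarrow> \<exists>k\<in>K. x - k \<in> J"
    using ex_ideal_complement[OF S K] unfolding ss by blast
  have sub: "I \<subseteq> K" "K \<subseteq> S" "J \<subseteq> S" "subspace I" using I K J by (auto simp: lie_ideal_def)
  have "bracket x y \<in> I" if x: "x \<in> S" and y: "y \<in> I" for x y
  proof -
    obtain k where k: "k \<in> K" "x - k \<in> J" using J(3)[OF x] by blast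
    have "bracket (x - k) y \<in> K" using stableD[OF lie_ideal_stable[OF K], of "x - k" y] y k sub
      by blast
    moreover have "bracket (x - k) y \<in> J" using y sub k
      by (intro lie_ideal_bracket_left[OF J(1)]) auto
    ultimately have "bracket (x - k) y = 0" using J(2) by blast
    then have "bracket x y = bracket k y" by (simp add: bracket_diff_left)
    then show ?thesis using I(1) k y by (auto simp: lie_ideal_def)
  qed
  then have "lie_ideal I S" using sub unfolding lie_ideal_def by auto
  then show ?thesis using solvable_radical_greatest(3)[OF S _ I(2)] ss by blast
qed

text \<open>The Casimir operator of the Killing form is the identity on \<open>S\<close> modulo the radical: if \<open>\<kappa>\<close>
  is the Killing form, then \<open>\<kappa> (c x) y\<close> is the trace of \<open>ad x \<circ> ad y\<close> computed in dual bases.\<close>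

lemma killing_casimir:
  assumes S: "lie_subalgebra S"
  obtains \<beta> E d where "dual_bases scale bracket Basis \<beta> S S (solvable_radical S) E d"
    "\<And>x. x \<in> S \<Longrightarrow> casimir E d x - x \<in> solvable_radical S"
proof -
  let ?Q = "solvable_radical S"
  note Q = solvable_radical_greatest(1)[OF S]
  have QS: "?Q \<subseteq> S" using Q by (simp add: lie_ideal_def)
  obtain \<pi> where sq: "subquotient scale bracket Basis S S ?Q \<pi>"
    using ex_subquotient[OF S stable_subalgebra[OF S] lie_ideal_stable[OF Q]] .
  interpret subquotient scale bracket Basis S S ?Q \<pi> by (fact sq)
  let ?k = trace_form
  have nondeg: "x \<in> ?Q" if "x \<in> S" "\<And>y. y \<in> S \<Longrightarrow> ?k x y = 0" for x
    using isotropic_ideal_subset_radical[OF sq lie_ideal_orthogonal[OF lie_ideal_self[OF S]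
        lie_ideal_self[OF S]]]
      that by blast
  obtain E d where D: "dual_bases scale bracket Basis ?k S S ?Q E d"
    by (rule ex_dual_bases[OF lie_ideal_self[OF S] Q QS lie_ideal_bracket_left[OF Q] nondeg])
  then interpret D: dual_bases scale bracket Basis ?k S S ?Q E d .
  have br: "bracket x y \<in> S" if "x \<in> S" "y \<in> S" for x y using bracket_subalgebra[OF S that] .
  have "casimir E d x - x \<in> ?Q" if x: "x \<in> S" for x
  proof (rule nondeg)
    have c: "casimir E d x \<in> S"
      by (rule casimir_stable[OF stable_subalgebra[OF S]]) (use D.ES x in auto)
    then show "casimir E d x - x \<in> S" using x D.subspaces by (auto intro: subspace_diff)
    fix y assume y: "y \<in> S"
    let ?f = "act_quot x \<circ> act_quot y"
    have f: "lin ?f" by (intro lin_comp lin_act_quot)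
    have fQ: "?f q = 0" if "q \<in> ?Q" for q
      using proj_P[OF that] lin_0[OF lin_act_quot]
        by (simp add: act_quot_def lin_0[OF lin_bracket] lin_0[OF lin_proj])
    \<comment> \<open>\<open>?f\<close> vanishes on \<open>Q\<close>, so it is the sum of rank one operators given by the dual bases.\<close>
    have fv: "?f v = (\<Sum>e\<in>E. scale (?k (d e) (\<pi> v)) (?f e))" for v
    proof -
      have "?f (\<pi> v - (\<Sum>e\<in>E. scale (?k (d e) (\<pi> v)) e)) = 0"
        by (rule fQ[OF D.expand[OF proj_mem]])
      moreover have "?f (\<pi> v) = ?f v" by (simp add: act_quot_def proj_idem)
      ultimately show ?thesis
        by (simp only: lin_diff[OF f] lin_sum[OF f] lin_scale[OF f]) simp
    qed
    have trace_fe: "?k (d e) (\<pi> (?f e)) = ?k (bracket e (bracket (d e) x)) y" if e: "e \<in> E" for e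
    proof -
      note eS = D.ES[OF e]
      have "\<pi> (?f e) = \<pi> (bracket x (bracket y (\<pi> e)))"
        using act_quot_comp[OF x y] by (simp add: proj_idem)
      also have "\<dots> = \<pi> (bracket x (bracket y e))"
      proof (rule proj_cong)
        have "\<pi> e - e \<in> ?Q" using proj_mod[OF eS(1)] D.subspaces(3)
          by (metis minus_diff_eq subspace_neg)
        then have "bracket x (bracket y (\<pi> e - e)) \<in> ?Q" using Q x y by (auto simp: lie_ideal_def)
        then show "bracket x (bracket y (\<pi> e)) - bracket x (bracket y e) \<in> ?Q"
          by (simp add: bracket_diff_right)
      qed
      finally have "\<pi> (?f e) = \<pi> (bracket x (bracket y e))" .
      moreover have "?k (d e) (\<pi> u) = ?k (d e) u" if "u \<in> S" for u
        using D.form_kernel[OF proj_mod[OF that], of "d e"] trace_form_sym[of "d e"]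
          by (simp add: D.form_diff)
      ultimately have "?k (d e) (\<pi> (?f e)) = ?k (d e) (bracket x (bracket y e))"
        using br x y eS by simp
      also have "\<dots> = - ?k (d e) (bracket x (bracket e y))"
        using bracket_skew[of y e] D.form_scale_right[of "d e" "- 1"]
          by (simp add: bracket_neg_right)
      also have "\<dots> = - ?k (bracket (d e) x) (bracket e y)"
        using trace_form_invariant[OF eS(2) x br[OF eS(1) y]] by simp
      also have "\<dots> = - ?k (bracket (bracket (d e) x) e) y"
        using trace_form_invariant[OF br[OF eS(2) x] eS(1) y] by simp
      also have "\<dots> = ?k (bracket e (bracket (d e) x)) y"
        using bracket_skew[of "bracket (d e) x" e] by (simp add: D.form_neg)
      finally show ?thesis .
    qed
    have "?k x y = trace (\<lambda>v. \<Sum>e\<in>E. scale (?k (d e) (\<pi> v)) (?f e))"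
      unfolding trace_form_def[of x y] by (intro arg_cong[where f = trace] ext fv)
    also have "\<dots> = (\<Sum>e\<in>E. ?k (d e) (\<pi> (?f e)))"
      unfolding trace_sum
      by (intro sum.cong refl trace_rank_one)
        (simp_all add: lin_add[OF lin_proj] lin_scale[OF lin_proj] trace_form_add_right
            trace_form_scale_right)
    also have "\<dots> = ?k (casimir E d x) y"
      unfolding casimir_def D.form_sum by (intro sum.cong refl trace_fe)
    finally show "?k (casimir E d x - x) y = 0" by (simp add: D.form_diff)
  qed
  then show thesis using that[OF D] by blast
qed

definition irreducible_quotient :: "'m set \<Rightarrow> 'm set \<Rightarrow> 'm set \<Rightarrow> bool"
  where "irreducible_quotient S W P \<longleftrightarrow>
    (\<forall>U. stable S U \<longrightarrow> P \<subseteq> U \<longrightarrow> U \<subseteq> W \<longrightarrow> U = P \<or> U = W)"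

lemma ex_irreducible_quotient:
  assumes "stable S W" "stable S P" "P \<subset> W"
  obtains U where "stable S U" "P \<subseteq> U" "U \<subset> W" "irreducible_quotient S W U"
proof -
  let ?A = "\<lambda>U. stable S U \<and> P \<subseteq> U \<and> U \<subset> W"
  obtain U where U: "?A U" and max: "\<And>V. ?A V \<Longrightarrow> dim V \<le> dim U"
    using ex_has_greatest_nat[of ?A P dim "Suc dimension"] dim_subset_UNIV assms
    by (auto simp: less_Suc_eq_le)
  have "irreducible_quotient S W U" unfolding irreducible_quotient_def
  proof (intro allI impI)
    fix V assume V: "stable S V" "U \<subseteq> V" "V \<subseteq> W"
    show "V = U \<or> V = W"
    proof (rule disjCI)
      assume "V \<noteq> W"
      then have "?A V" using V U by blast
      then have "dim V \<le> dim U" by (rule max)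
      then have "U = V" using V U by (intro subspace_dim_equal) (auto simp: stable_def)
      then show "V = U" by simp
    qed
  qed
  then show thesis using that U by blast
qed

text \<open>On a nontrivial irreducible subquotient the Casimir operator of its own trace form, taken over
  the ideal complementary to the kernel of the action, is bijective by Schur's lemma, because its
  trace is the dimension of that ideal modulo the radical.\<close>

lemma ex_bijective_casimir:
  assumes S: "lie_subalgebra S" and W: "stable S W" and P: "stable S P" and PW: "P \<subseteq> W"
    and QW: "\<And>q w. q \<in> solvable_radical S \<Longrightarrow> w \<in> W \<Longrightarrow> bracket q w \<in> P"
    and irr: "irreducible_quotient S W P"
    and nontriv: "\<exists>x\<in>S. \<exists>w\<in>W. bracket x w \<notin> P"
  obtains \<beta> J E d where "dual_bases scale bracket Basis \<beta> S J (solvable_radical S) E d"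
    "\<And>v. v \<in> W \<Longrightarrow> \<exists>u\<in>W. casimir E d u - v \<in> P"
    "\<And>u. u \<in> W \<Longrightarrow> casimir E d u \<in> P \<Longrightarrow> u \<in> P"
proof -
  let ?Q = "solvable_radical S"
  note Q = solvable_radical_greatest(1)[OF S]
  have QS: "?Q \<subseteq> S" using Q by (simp add: lie_ideal_def)
  have subP: "subspace P" and subW: "subspace W" using P W by (auto simp: stable_def)
  define K where "K = {x \<in> S. \<forall>w\<in>W. bracket x w \<in> P}"
  have K: "lie_ideal K S" unfolding lie_ideal_def
  proof (intro conjI ballI)
    show "subspace K" using subspace_subalgebra[OF S] subP unfolding K_def subspace_def
      by (simp add: bracket_zero_left bracket_add_left bracket_scale_left)
    show "K \<subseteq> S" unfolding K_def by blast
    fix x y assume x: "x \<in> S" and y: "y \<in> K"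
    have "bracket (bracket x y) w \<in> P" if w: "w \<in> W" for w
      unfolding bracket_bracket using x y w P W
      by (intro subspace_diff[OF subP]) (auto simp: K_def stable_def)
    then show "bracket x y \<in> K" using x y bracket_subalgebra[OF S] by (auto simp: K_def)
  qed
  have QK: "?Q \<subseteq> K" using QW QS unfolding K_def by blast
  obtain J where J: "lie_ideal J S" "J \<inter> K = ?Q" "\<And>x. x \<in> S \<Longrightarrow> \<exists>k\<in>K. x - k \<in> J"
    using ex_ideal_complement[OF S K QK] by blast
  have JS: "J \<subseteq> S" and QJ: "?Q \<subseteq> J" using J by (auto simp: lie_ideal_def)
  obtain \<pi> where sq: "subquotient scale bracket Basis S W P \<pi>" using ex_subquotient[OF S W P] .
  interpret subquotient scale bracket Basis S W P \<pi> by (fact sq)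
  have nondeg: "x \<in> ?Q" if x: "x \<in> J" "\<And>y. y \<in> J \<Longrightarrow> trace_form x y = 0" for x
  proof -
    let ?I = "{x \<in> J. \<forall>y\<in>J. trace_form x y = 0}"
    have I: "lie_ideal ?I S" by (rule lie_ideal_orthogonal[OF J(1) J(1)])
    have IS: "?I \<subseteq> S" using JS by blast
    obtain n where n: "\<forall>x\<in>derived_series ?I n. \<forall>w\<in>W. bracket x w \<in> P"
      using isotropic_acts_solvably[OF lie_ideal_imp_subalgebra[OF I] IS] by blast
    have "derived_series ?I n \<subseteq> ?I"
      by (rule derived_series_subset[OF lie_ideal_imp_subalgebra[OF I]])
    then have "derived_series ?I n \<subseteq> ?Q" using n IS J(2) unfolding K_def by blast
    then have "?I \<subseteq> ?Q" by (rule subset_radical_if_derived_subset[OF S I])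
    then show ?thesis using x by blast
  qed
  obtain E d where D: "dual_bases scale bracket Basis trace_form S J ?Q E d"
    by (rule ex_dual_bases[OF J(1) Q QJ QW nondeg])
  then interpret D: dual_bases scale bracket Basis trace_form S J ?Q E d .
  let ?c = "casimir E d"
  have lc: "lin ?c" by (rule lin_casimir)
  have cW: "?c w \<in> W" if "w \<in> W" for w using casimir_stable[OF W _ _ that] D.ES by blast
  have cP: "?c w \<in> P" if "w \<in> P" for w using casimir_stable[OF P _ _ that] D.ES by blast
  have comm: "bracket x (?c v) - ?c (bracket x v) \<in> P" if "x \<in> S" "v \<in> W" for x v
    by (rule D.casimir_commutes[OF W P QW that])
  have c_nonzero: "\<exists>w\<in>W. ?c w \<notin> P"
  proof (rule ccontr)
    assume "\<not> ?thesis"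
    then have c0: "\<pi> (?c (\<pi> v)) = 0" for v using proj_mem proj_P by blast
    have "(\<Sum>e\<in>E. act_quot e (act_quot (d e) v)) = \<pi> (?c (\<pi> v))" for v
      unfolding casimir_def lin_sum[OF lin_proj] by (intro sum.cong refl act_quot_comp D.ES)
    then have "trace (\<lambda>v. \<Sum>e\<in>E. (act_quot e \<circ> act_quot (d e)) v) = 0"
      using c0 trace_0 by simp
    then have "(\<Sum>e\<in>E. trace_form e (d e)) = 0" unfolding trace_sum trace_form_def .
    then have "(\<Sum>e\<in>E. (1::'f)) = 0" using D.dual trace_form_sym
      by (metis (no_types, lifting) sum.cong)
    then have "E = {}" using D.finite_E by simp
    then have "J \<subseteq> ?Q" using D.spanning by fastforce
    then have "S \<subseteq> K"
      using J(3) QK K subspace_add unfolding lie_ideal_def by (metis diff_add_cancel subset_iff)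
    then show False using nontriv unfolding K_def by blast
  qed
  have inj: "u \<in> P" if "u \<in> W" "?c u \<in> P" for u
  proof -
    let ?U = "{w \<in> W. ?c w \<in> P}"
    have "stable S ?U" unfolding stable_def
    proof (intro conjI ballI)
      have "?U = W \<inter> {w. ?c w \<in> P}" by blast
      then show "subspace ?U" using subspace_inter[OF subW subspace_lin_preimage[OF lc subP]]
        by simp
      fix x w assume x: "x \<in> S" and w: "w \<in> ?U"
      have "bracket x (?c w) - (bracket x (?c w) - ?c (bracket x w)) \<in> P"
        by (rule subspace_diff[OF subP stableD[OF P x] comm[OF x]]) (use w in auto)
      then show "bracket x w \<in> ?U" using w stableD[OF W x] by simp
    qed
    moreover have "P \<subseteq> ?U" using cP PW by blast
    ultimately have "?U = P \<or> ?U = W" using irr unfolding irreducible_quotient_def by blast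
    then have "?U = P" using c_nonzero by blast
    then show ?thesis using that by blast
  qed
  have surj: "\<exists>u\<in>W. ?c u - v \<in> P" if v: "v \<in> W" for v
  proof -
    let ?U = "{w \<in> W. \<exists>u\<in>W. ?c u - w \<in> P}"
    have "stable S ?U" unfolding stable_def
    proof (intro conjI ballI)
      have "?U = W \<inter> {w. \<exists>u\<in>W. ?c u - w \<in> P}" by blast
      then show "subspace ?U"
        using subspace_inter[OF subW subspace_image_modulo[OF lc subW subP]] by simp
      fix x w assume x: "x \<in> S" and "w \<in> ?U"
      then obtain u where w: "w \<in> W" and u: "u \<in> W" "?c u - w \<in> P" by blast
      have "bracket x (?c u - w) - (bracket x (?c u) - ?c (bracket x u)) \<in> P"
        by (rule subspace_diff[OF subP stableD[OF P x u(2)] comm[OF x u(1)]])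
      then have "?c (bracket x u) - bracket x w \<in> P" by (simp add: bracket_diff_right)
      then show "bracket x w \<in> ?U" using stableD[OF W x] w u(1) by blast
    qed
    moreover have "P \<subseteq> ?U"
    proof
      fix p assume p: "p \<in> P"
      have "?c 0 - p \<in> P" using p subspace_neg[OF subP] by (simp add: lin_0[OF lc])
      then show "p \<in> ?U" using p PW subspace_0[OF subW] by blast
    qed
    ultimately have "?U = P \<or> ?U = W" using irr unfolding irreducible_quotient_def by blast
    moreover obtain w where w: "w \<in> W" "?c w \<notin> P" using c_nonzero by blast
    then have "?c w \<in> ?U" using cW subspace_0[OF subP] by (auto intro!: bexI[of _ w])
    ultimately have "?U = W" using w by blast
    then show ?thesis using v by blast
  qed
  show thesis by (rule that[OF D surj inj])
qed

end

section \<open>Whitehead's lemmas\<close>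

context based_lie_algebra
begin

text \<open>The first Whitehead lemma: a cocycle of a semisimple algebra with values in \<open>N/N'\<close> is a
  coboundary. On an irreducible quotient with bijective Casimir operator \<open>c\<close>, the cocycle \<open>D\<close> is the
  coboundary of \<open>c\<inverse> (\<Sum>e. [e, D (d e)])\<close>; on a trivial one it vanishes, because the algebra is
  perfect. The general case follows by shrinking the submodule in which \<open>D\<close> takes its values.\<close>

lemma whitehead_first:
  assumes G: "lie_subalgebra G" and ss: "solvable_radical G = {0}"
    and N: "stable G N" and N': "stable G N'" "N' \<subseteq> N"
    and D: "lin D" and DN: "\<And>x. x \<in> G \<Longrightarrow> D x \<in> N"
    and cocycle: "\<And>x y. x \<in> G \<Longrightarrow> y \<in> G \<Longrightarrow> D (bracket x y) - bracket x (D y) + bracket y (D x) \<in> N'"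
  shows "\<exists>v\<in>N. \<forall>x\<in>G. D x - bracket x v \<in> N'"
proof -
  define A where "A U \<longleftrightarrow> stable G U \<and> N' \<subseteq> U \<and> U \<subseteq> N \<and> (\<exists>v\<in>N. \<forall>x\<in>G. D x - bracket x v \<in> U)" for U
  have "A N" using N N' DN subspace_0[OF stable_subspace[OF N]]
    unfolding A_def by (auto simp: bracket_zero_right intro!: bexI[of _ 0])
  then obtain U where U: "A U" and min: "\<And>V. A V \<Longrightarrow> dim U \<le> dim V"
    using ex_has_least_nat[of A N dim] by blast
  obtain v where v: "v \<in> N" "\<And>x. x \<in> G \<Longrightarrow> D x - bracket x v \<in> U" using U by (auto simp: A_def)
  have stU: "stable G U" and NU: "N' \<subseteq> U" "U \<subseteq> N" using U by (auto simp: A_def)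
  have "U = N'"
  proof (rule ccontr)
    assume "U \<noteq> N'"
    then have "N' \<subset> U" using NU by blast
    then obtain V where V: "stable G V" "N' \<subseteq> V" "V \<subset> U" "irreducible_quotient G U V"
      using ex_irreducible_quotient[OF stU N'(1)] by blast
    note subV = stable_subspace[OF V(1)] and subU = stable_subspace[OF stU]
    define D' where "D' x = D x - bracket x v" for x
    have D': "lin D'" unfolding D'_def
      by (rule linI) (simp_all add: lin_add[OF D] lin_scale[OF D] bracket_add_left
          bracket_scale_left algebra_simps)
    have D'U: "D' x \<in> U" if "x \<in> G" for x using v(2)[OF that] by (simp add: D'_def)
    have cocycle': "D' (bracket x y) - bracket x (D' y) + bracket y (D' x) \<in> N'" if "x \<in> G" "y \<in> G"
        for x y
      using cocycle[OF that] by (simp add: D'_def bracket_diff_right bracket_bracket algebra_simps)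
    have "\<exists>u\<in>U. \<forall>x\<in>G. D' x - bracket x u \<in> V"
    proof (cases "\<exists>x\<in>G. \<exists>w\<in>U. bracket x w \<notin> V")
      case False
      have "D' x \<in> V" if x: "x \<in> G" for x
      proof (rule lin_span_mem[OF D' subV])
        show "x \<in> span {bracket a b | a b. a \<in> G \<and> b \<in> G}"
          using x semisimple_perfect[OF G ss] by simp
        fix s assume "s \<in> {bracket a b | a b. a \<in> G \<and> b \<in> G}"
        then obtain a b where ab: "s = bracket a b" "a \<in> G" "b \<in> G" by blast
        have Vab: "bracket a (D' b) \<in> V" "bracket b (D' a) \<in> V" using False ab D'U by blast+
        have "(D' s - bracket a (D' b) + bracket b (D' a)) + bracket a (D' b) - bracket b (D' a) \<in>
            V"
          unfolding ab(1)
          by (rule subspace_diff[OF subV subspace_add[OF subV subsetD[OF V(2) cocycle'[OF ab(2,3)]]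
              Vab(1)] Vab(2)])
        then show "D' s \<in> V" by simp
      qed
      then show ?thesis
        using subspace_0[OF subU] by (intro bexI[of _ 0]) (auto simp: bracket_zero_right)
    next
      case True
      have ssU: "bracket q w \<in> V" if "q \<in> solvable_radical G" for q w
        using that ss subspace_0[OF subV] by (simp add: bracket_zero_left)
      obtain \<beta> J E d where db: "dual_bases scale bracket Basis \<beta> G J (solvable_radical G) E d"
        and surj: "\<And>v. v \<in> U \<Longrightarrow> \<exists>u\<in>U. casimir E d u - v \<in> V"
        and inj: "\<And>u. u \<in> U \<Longrightarrow> casimir E d u \<in> V \<Longrightarrow> u \<in> V"
        using ex_bijective_casimir[OF G stU V(1) psubset_imp_subset[OF V(3)] ssU V(4) True] by metis
      interpret db: dual_bases scale bracket Basis \<beta> G J "solvable_radical G" E d by (fact db)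
      let ?c = "casimir E d"
      define \<tau> where "\<tau> = (\<Sum>e\<in>E. bracket e (D' (d e)))"
      have \<tau>U: "\<tau> \<in> U" unfolding \<tau>_def
        using db.ES D'U stableD[OF stU] by (intro subspace_sum[OF subU]) blast
      have \<tau>: "bracket x \<tau> - ?c (D' x) \<in> V" if x: "x \<in> G" for x
      proof -
        let ?A = "(\<Sum>e\<in>E. bracket (bracket x e) (D' (d e)) + bracket e (D' (bracket x (d e))))"
          and ?B = "(\<Sum>e\<in>E. bracket e (D' (bracket x (d e)) - bracket x (D' (d e)) +
              bracket (d e) (D' x)))"
        have "?A \<in> V"
          by (rule db.dual_tensor_invariant[where \<Phi> = "\<lambda>a b. bracket a (D' b)"])
            (use subV x ss subspace_0[OF subV] in \<open>auto simp: bracket_add_left bracket_add_right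
                bracket_scale_left
              bracket_scale_right lin_add[OF D'] lin_scale[OF D'] lin_0[OF D'] bracket_zero_left
                  bracket_zero_right\<close>)
        moreover have "?B \<in> V"
          using cocycle'[OF x] db.ES V(2) stableD[OF V(1)] by (intro subspace_sum[OF subV]) blast
        ultimately have "?A - ?B \<in> V"
          by (rule subspace_diff[OF subV])
        also have "?A - ?B = bracket x \<tau> - ?c (D' x)"
          unfolding \<tau>_def casimir_def bracket_sum_right sum_subtractf[symmetric]
          by (intro sum.cong refl) (simp add: bracket_bracket bracket_diff_right bracket_add_right
              algebra_simps)
        finally show ?thesis .
      qed
      obtain u where u: "u \<in> U" "?c u - \<tau> \<in> V" using surj[OF \<tau>U] by blast
      have "D' x - bracket x u \<in> V" if x: "x \<in> G" for x
      proof -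
        have "?c (bracket x u - D' x) = bracket x (?c u - \<tau>) + (bracket x \<tau> - ?c (D' x))
            - (bracket x (?c u) - ?c (bracket x u))"
          by (simp add: lin_diff[OF lin_casimir] bracket_diff_right)
        also have "\<dots> \<in> V"
          by (rule subspace_diff[OF subV subspace_add[OF subV stableD[OF V(1) x u(2)] \<tau>[OF x]]
                db.casimir_commutes[OF stU V(1) ssU x u(1)]])
        finally have "?c (bracket x u - D' x) \<in> V" .
        then have "bracket x u - D' x \<in> V"
          using inj stableD[OF stU x u(1)] D'U[OF x] subspace_diff[OF subU] by blast
        then have "- (bracket x u - D' x) \<in> V" by (rule subspace_neg[OF subV])
        then show ?thesis by simp
      qed
      then show ?thesis using u(1) by blast
    qed
    then obtain u where u: "u \<in> U" "\<And>x. x \<in> G \<Longrightarrow> D' x - bracket x u \<in> V" by blast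
    have "D x - bracket x (v + u) \<in> V" if "x \<in> G" for x
      using u(2)[OF that] by (simp add: D'_def bracket_add_right algebra_simps)
    moreover have "v + u \<in> N" using v(1) u(1) NU subspace_add[OF stable_subspace[OF N]] by blast
    ultimately have "A V" using V NU unfolding A_def by blast
    then have "dim U \<le> dim V" by (rule min)
    then have "V = U" using V(3) subV subU by (intro subspace_dim_equal) auto
    then show False using V(3) by blast
  qed
  then show ?thesis using v by blast
qed

text \<open>If the abelian quotient \<open>Q/Q'\<close> of the radical \<open>Q\<close> is a trivial module, then \<open>S\<close> acts on
  \<open>S/Q'\<close> through a semisimple algebra, and the Casimir operator of the Killing form is a projection
  that commutes with this action and has kernel \<open>Q/Q'\<close>; its image is a complement.\<close>

lemma ex_complement_if_trivial:
  assumes S: "lie_subalgebra S" and Q': "stable S Q'" "Q' \<subseteq> solvable_radical S"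
    and triv: "\<And>x q. x \<in> S \<Longrightarrow> q \<in> solvable_radical S \<Longrightarrow> bracket x q \<in> Q'"
  obtains T where "lie_subalgebra T" "T \<subseteq> S" "T \<inter> solvable_radical S = Q'"
    "\<And>x. x \<in> S \<Longrightarrow> \<exists>q\<in>solvable_radical S. x + q \<in> T"
proof -
  let ?Q = "solvable_radical S"
  note Q = solvable_radical_greatest(1)[OF S]
  have subS: "subspace S" and subQ: "subspace ?Q" and subQ': "subspace Q'" and QS: "?Q \<subseteq> S"
    using S Q Q'(1) by (auto simp: lie_subalgebra_def lie_ideal_def stable_def)
  obtain \<beta> E d where db: "dual_bases scale bracket Basis \<beta> S S ?Q E d"
    and c: "\<And>x. x \<in> S \<Longrightarrow> casimir E d x - x \<in> ?Q"
    using killing_casimir[OF S] by blast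
  interpret db: dual_bases scale bracket Basis \<beta> S S ?Q E d by (fact db)
  let ?c = "casimir E d"
  have QSQ': "bracket q x \<in> Q'" if "q \<in> ?Q" "x \<in> S" for q x
    using triv[OF that(2,1)] bracket_skew[of q x] subspace_neg[OF subQ'] by simp
  have cS: "?c x \<in> S" if "x \<in> S" for x
    using casimir_stable[OF stable_subalgebra[OF S] _ _ that] db.ES by blast
  have cQ: "?c q \<in> Q'" if "q \<in> ?Q" for q
    unfolding casimir_def using triv[OF _ that] db.ES stableD[OF Q'(1)]
      by (intro subspace_sum[OF subQ']) blast
  define T where "T = {y. \<exists>x\<in>S. ?c x - y \<in> Q'}"
  have cT: "?c x \<in> T" if "x \<in> S" for x unfolding T_def using that subspace_0[OF subQ']
    by (auto intro!: bexI[of _ x])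
  have TS: "T \<subseteq> S"
  proof
    fix y assume "y \<in> T"
    then obtain x where "x \<in> S" "?c x - y \<in> Q'" by (auto simp: T_def)
    then have "?c x - (?c x - y) \<in> S" using cS Q'(2) QS by (blast intro: subspace_diff[OF subS])
    then show "y \<in> S" by simp
  qed
  have "subspace T" unfolding T_def by (rule subspace_image_modulo[OF lin_casimir subS subQ'])
  moreover have "bracket z y \<in> T" if z: "z \<in> S" and "y \<in> T" for z y
  proof -
    obtain x where x: "x \<in> S" "?c x - y \<in> Q'" using \<open>y \<in> T\<close> by (auto simp: T_def)
    have "bracket z (?c x - y) - (bracket z (?c x) - ?c (bracket z x)) \<in> Q'"
      by (rule subspace_diff[OF subQ' stableD[OF Q'(1) z x(2)]
            db.casimir_commutes[OF stable_subalgebra[OF S] Q'(1) QSQ' z x(1)]])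
    then have "?c (bracket z x) - bracket z y \<in> Q'" by (simp add: bracket_diff_right)
    then show ?thesis using bracket_subalgebra[OF S z x(1)] unfolding T_def by blast
  qed
  ultimately have "lie_subalgebra T" using TS unfolding lie_subalgebra_def by blast
  moreover have "T \<inter> ?Q \<subseteq> Q'"
  proof
    fix y assume "y \<in> T \<inter> ?Q"
    then obtain x where x: "x \<in> S" "?c x - y \<in> Q'" "y \<in> ?Q" by (auto simp: T_def)
    have "(y + (?c x - y)) - (?c x - x) \<in> ?Q"
      by (rule subspace_diff[OF subQ subspace_add[OF subQ x(3) subsetD[OF Q'(2) x(2)]] c[OF x(1)]])
    then have "?c x \<in> Q'" using cQ by simp
    then have "?c x - (?c x - y) \<in> Q'" using x(2) by (rule subspace_diff[OF subQ'])
    then show "y \<in> Q'" by simp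
  qed
  moreover have "Q' \<subseteq> T"
    using subspace_0[OF subS] subspace_neg[OF subQ'] unfolding T_def
    by (auto simp: lin_0[OF lin_casimir] intro!: bexI[of _ 0])
  moreover have "\<exists>q\<in>?Q. x + q \<in> T" if "x \<in> S" for x
    using c[OF that] cT[OF that] by (intro bexI[of _ "?c x - x"]) auto
  ultimately show thesis using that TS Q'(2) by blast
qed

text \<open>The second Whitehead lemma, for a nontrivial irreducible abelian quotient \<open>Q/Q'\<close>. Let
  \<open>\<omega> x y\<close> be the \<open>Q\<close>-component of the bracket of the components of \<open>x\<close> and \<open>y\<close> in a linear
  complement of \<open>Q\<close>. Contracting the cocycle identity of \<open>\<omega>\<close> with the invariant tensor
  \<open>\<Sum>e. e \<otimes> d e\<close> shows that the Casimir multiple \<open>c \<omega>\<close> is the coboundary of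
  \<open>\<tau> x = (\<Sum>e. [e, \<omega> (d e) x])\<close>. Since \<open>c\<close> is bijective modulo \<open>Q'\<close>, the graph of \<open>- c\<inverse> \<tau>\<close> over
  the linear complement is the subalgebra sought; it is written here without inverting \<open>c\<close>.\<close>

lemma ex_complement_if_nontrivial:
  assumes S: "lie_subalgebra S" and Q': "stable S Q'" "Q' \<subseteq> solvable_radical S"
    and abelian: "\<And>x y. x \<in> solvable_radical S \<Longrightarrow> y \<in> solvable_radical S \<Longrightarrow> bracket x y \<in> Q'"
    and irr: "irreducible_quotient S (solvable_radical S) Q'"
    and nontriv: "\<exists>x\<in>S. \<exists>q\<in>solvable_radical S. bracket x q \<notin> Q'"
  obtains T where "lie_subalgebra T" "T \<subseteq> S" "T \<inter> solvable_radical S = Q'"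
    "\<And>x. x \<in> S \<Longrightarrow> \<exists>q\<in>solvable_radical S. x + q \<in> T"
proof -
  let ?Q = "solvable_radical S"
  note Q = solvable_radical_greatest(1)[OF S]
  have subS: "subspace S" and subQ: "subspace ?Q" and subQ': "subspace Q'" and QS: "?Q \<subseteq> S"
    using S Q Q'(1) by (auto simp: lie_subalgebra_def lie_ideal_def stable_def)
  note stQ = lie_ideal_stable[OF Q]
  obtain \<beta> J E d where db: "dual_bases scale bracket Basis \<beta> S J ?Q E d"
    and surj: "\<And>v. v \<in> ?Q \<Longrightarrow> \<exists>u\<in>?Q. casimir E d u - v \<in> Q'"
    and inj: "\<And>u. u \<in> ?Q \<Longrightarrow> casimir E d u \<in> Q' \<Longrightarrow> u \<in> Q'"
    using ex_bijective_casimir[OF S stQ Q' abelian irr nontriv] by metis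
  interpret db: dual_bases scale bracket Basis \<beta> S J ?Q E d by (fact db)
  let ?c = "casimir E d"
  have cQ': "?c q \<in> Q'" if "q \<in> Q'" for q using casimir_stable[OF Q'(1) _ _ that] db.ES by blast
  have cQ: "?c q \<in> ?Q" if "q \<in> ?Q" for q using casimir_stable[OF stQ _ _ that] db.ES by blast
  have brS: "bracket x y \<in> S" if "x \<in> S" "y \<in> S" for x y using bracket_subalgebra[OF S that] .
  have brQ: "bracket x q \<in> ?Q" if "x \<in> S" "q \<in> ?Q" for x q using stableD[OF stQ that] .
  have brQ2: "bracket q x \<in> ?Q" if "x \<in> S" "q \<in> ?Q" for x q
    using lie_ideal_bracket_left[OF Q that(2,1)] .
  have brQ': "bracket x q \<in> Q'" if "x \<in> S" "q \<in> Q'" for x q using stableD[OF Q'(1) that] .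
  obtain p where p: "lin p" and pQ: "\<And>v. p v \<in> ?Q" and pq0: "\<And>b. b \<in> ?Q \<Longrightarrow> b - p b \<in> {0}"
    using ex_projection[OF subspace_single_0 subQ] by metis
  have pq: "p b = b" if "b \<in> ?Q" for b using pq0[OF that] by simp
  define s where "s x = x - p x" for x
  have ls: "lin s" unfolding s_def
    by (rule linI) (simp_all add: lin_add[OF p] lin_scale[OF p] algebra_simps)
  have sS: "s x \<in> S" if "x \<in> S" for x using that pQ QS unfolding s_def
    by (auto intro: subspace_diff[OF subS])
  have sQ: "s q = 0" if "q \<in> ?Q" for q using pq[OF that] by (simp add: s_def)
  have ss: "s (s x) = s x" for x using pq[OF pQ[of x]] by (simp add: s_def lin_diff[OF p])
  define \<omega> where "\<omega> x y = p (bracket (s x) (s y))" for x y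
  have \<omega>Q: "\<omega> x y \<in> ?Q" for x y unfolding \<omega>_def by (rule pQ)
  have \<omega>_add: "\<omega> (x + y) z = \<omega> x z + \<omega> y z" "\<omega> z (x + y) = \<omega> z x + \<omega> z y" for x y z
    unfolding \<omega>_def by (simp_all add: lin_add[OF ls] lin_add[OF p] bracket_add_left
        bracket_add_right)
  have \<omega>_scale: "\<omega> (scale r x) z = scale r (\<omega> x z)" "\<omega> z (scale r x) = scale r (\<omega> z x)" for r x z
    unfolding \<omega>_def by (simp_all add: lin_scale[OF ls] lin_scale[OF p] bracket_scale_left
        bracket_scale_right)
  have \<omega>_skew: "\<omega> x y = - \<omega> y x" for x y
    unfolding \<omega>_def using bracket_skew[of "s x" "s y"] by (simp add: lin_neg[OF p])
  have \<omega>_neg: "\<omega> x (- y) = - \<omega> x y" for x y using \<omega>_scale(2)[of x "- 1" y] by simp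
  have \<omega>_diff: "\<omega> x (y - z) = \<omega> x y - \<omega> x z" for x y z using \<omega>_add(2)[of x "y - z" z]
    by (simp add: algebra_simps)
  have \<omega>0: "\<omega> q y = 0" "\<omega> y q = 0" if "q \<in> ?Q" for q y
    unfolding \<omega>_def by (simp_all add: sQ[OF that] bracket_zero_left bracket_zero_right lin_0[OF p])
  have \<omega>_cong: "\<omega> x y = \<omega> x z" if "y - z \<in> ?Q" for x y z using \<omega>0(2)[OF that, of x]
    by (simp add: \<omega>_diff)

  have cocycle: "bracket x (\<omega> y z) + bracket y (\<omega> z x) + bracket z (\<omega> x y)
      + \<omega> x (bracket y z) + \<omega> y (bracket z x) + \<omega> z (bracket x y) \<in> Q'"
    if xyz: "x \<in> S" "y \<in> S" "z \<in> S" for x y z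
  proof -
    have step: "bracket x (\<omega> y z) + \<omega> x (bracket y z) - p (bracket (s x) (bracket (s y) (s z))) \<in>
        Q'"
      if xyz: "x \<in> S" "y \<in> S" "z \<in> S" for x y z
    proof -
      have split: "bracket (s y) (s z) = s (bracket (s y) (s z)) + \<omega> y z"
        by (simp add: s_def[of "bracket _ _"] \<omega>_def)
      have "p (bracket (s x) (bracket (s y) (s z))) = \<omega> x (bracket (s y) (s z)) +
          bracket (s x) (\<omega> y z)"
        by (subst split) (simp add: bracket_add_right lin_add[OF p] pq[OF brQ[OF sS[OF xyz(1)] \<omega>Q]]
            \<omega>_def[of x])
      moreover have "\<omega> x (bracket y z) = \<omega> x (bracket (s y) (s z))"
      proof (rule \<omega>_cong)
        have "bracket y z - bracket (s y) (s z) = bracket (p y) z + bracket (s y) (p z)"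
          by (simp add: s_def bracket_diff_left bracket_diff_right)
        also have "\<dots> \<in> ?Q"
          using brQ2[OF xyz(3) pQ] brQ[OF sS[OF xyz(2)] pQ] by (rule subspace_add[OF subQ])
        finally show "bracket y z - bracket (s y) (s z) \<in> ?Q" .
      qed
      moreover have "bracket x (\<omega> y z) = bracket (s x) (\<omega> y z) + bracket (p x) (\<omega> y z)"
        by (simp add: s_def bracket_diff_left)
      ultimately show ?thesis using abelian[OF pQ[of x] \<omega>Q] by simp
    qed
    have "p (bracket (s x) (bracket (s y) (s z))) + p (bracket (s y) (bracket (s z) (s x)))
        + p (bracket (s z) (bracket (s x) (s y))) = 0"
      using jacobi[of "s x" "s y" "s z"] by (simp add: lin_0[OF p] flip: lin_add[OF p])
    then have "bracket x (\<omega> y z) + bracket y (\<omega> z x) + bracket z (\<omega> x y)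
      + \<omega> x (bracket y z) + \<omega> y (bracket z x) + \<omega> z (bracket x y) =
      (bracket x (\<omega> y z) + \<omega> x (bracket y z) - p (bracket (s x) (bracket (s y) (s z)))) +
      (bracket y (\<omega> z x) + \<omega> y (bracket z x) - p (bracket (s y) (bracket (s z) (s x)))) +
      (bracket z (\<omega> x y) + \<omega> z (bracket x y) - p (bracket (s z) (bracket (s x) (s y))))"
      by (simp add: algebra_simps)
    also have "\<dots> \<in> Q'" using xyz by (intro subspace_add[OF subQ'] step)
    finally show ?thesis .
  qed

  define \<tau> where "\<tau> x = (\<Sum>e\<in>E. bracket e (\<omega> (d e) x))" for x
  have l\<tau>: "lin \<tau>" unfolding \<tau>_def
    by (rule linI) (simp_all add: \<omega>_add \<omega>_scale bracket_add_right bracket_scale_right sum.distrib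
        scale_sum_right)
  have \<tau>Q: "\<tau> x \<in> ?Q" for x unfolding \<tau>_def using db.ES \<omega>Q brQ
    by (intro subspace_sum[OF subQ]) blast
  have \<tau>0: "\<tau> q = 0" if "q \<in> ?Q" for q unfolding \<tau>_def by (simp add: \<omega>0[OF that] bracket_zero_right)
  have coboundary: "?c (\<omega> x y) - bracket x (\<tau> y) + bracket y (\<tau> x) + \<tau> (bracket x y) \<in> Q'"
    if xy: "x \<in> S" "y \<in> S" for x y
  proof -
    let ?J = "\<lambda>e. bracket x (\<omega> y (d e)) + bracket y (\<omega> (d e) x) + bracket (d e) (\<omega> x y)
      + \<omega> x (bracket y (d e)) + \<omega> y (bracket (d e) x) + \<omega> (d e) (bracket x y)"
    let ?I = "\<lambda>x y e. bracket (bracket x e) (\<omega> (d e) y) + bracket e (\<omega> (bracket x (d e)) y)"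
    let ?h = "?c (\<omega> x y) - bracket x (\<tau> y) + bracket y (\<tau> x) + \<tau> (bracket x y)"
    have inv: "(\<Sum>e\<in>E. ?I x y e) \<in> Q'" if x: "x \<in> S" for x y
      by (rule db.dual_tensor_invariant[where \<Phi> = "\<lambda>a b. bracket a (\<omega> b y)"])
        (use subQ' x abelian \<omega>Q \<omega>0 subspace_0[OF subQ'] in \<open>auto simp: bracket_add_left
            bracket_add_right
          bracket_scale_left bracket_scale_right \<omega>_add \<omega>_scale bracket_zero_right\<close>)
    have J: "(\<Sum>e\<in>E. bracket e (?J e)) \<in> Q'"
      using cocycle[OF xy] db.ES brQ' by (intro subspace_sum[OF subQ']) blast
    have "bracket e (?J e) =
      bracket e (bracket (d e) (\<omega> x y)) - bracket x (bracket e (\<omega> (d e) y)) + bracket y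
          (bracket e (\<omega> (d e) x))
      + bracket e (\<omega> (d e) (bracket x y))
      + ?I x y e - ?I y x e" for e
    proof -
      have "\<omega> y (d e) = - \<omega> (d e) y" "\<omega> x (bracket y (d e)) = - \<omega> (bracket y (d e)) x"
        by (rule \<omega>_skew)+
      moreover have "\<omega> y (bracket (d e) x) = \<omega> (bracket x (d e)) y"
        using bracket_skew[of "d e" x] \<omega>_neg[of y "bracket x (d e)"] \<omega>_skew[of y "bracket x (d e)"]
          by simp
      ultimately show ?thesis
        by (simp add: bracket_add_right bracket_diff_right bracket_neg_right bracket_bracket
            algebra_simps)
    qed
    then have "(\<Sum>e\<in>E. bracket e (?J e)) = ?h + (\<Sum>e\<in>E. ?I x y e) - (\<Sum>e\<in>E. ?I y x e)"
      unfolding \<tau>_def casimir_def bracket_sum_right by (simp only: sum.distrib sum_subtractf)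
    then have "?h = (\<Sum>e\<in>E. bracket e (?J e)) - (\<Sum>e\<in>E. ?I x y e) + (\<Sum>e\<in>E. ?I y x e)"
      by (simp only: algebra_simps)
    also have "\<dots> \<in> Q'"
      by (rule subspace_add[OF subQ' subspace_diff[OF subQ' J inv[OF xy(1)]] inv[OF xy(2)]])
    finally show ?thesis .
  qed

  define T where "T = {z \<in> S. ?c (p z) + \<tau> z \<in> Q'}"
  have lT: "lin (\<lambda>z. ?c (p z) + \<tau> z)"
    by (rule linI) (simp_all add: lin_add[OF p] lin_scale[OF p] lin_add[OF lin_casimir]
        lin_scale[OF lin_casimir]
        lin_add[OF l\<tau>] lin_scale[OF l\<tau>] algebra_simps)
  have "subspace T"
    unfolding subspace_def T_def
    using subS subQ' by (auto simp: lin_add[OF lT] lin_scale[OF lT] lin_0[OF lT] subspace_0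
        subspace_add subspace_scale)
  moreover have "bracket z w \<in> T" if z: "z \<in> T" and w: "w \<in> T" for z w
  proof -
    have zS: "z \<in> S" "w \<in> S" using z w by (auto simp: T_def)
    have prod: "p (bracket z w) = \<omega> z w + bracket z (p w) - bracket w (p z) - bracket (p z) (p w)"
    proof -
      have "bracket z w = bracket (s z + p z) (s w + p w)" by (simp add: s_def)
      also have "\<dots> = bracket (s z) (s w) +
          (bracket z (p w) + bracket (p z) w - bracket (p z) (p w))"
        by (simp add: s_def bracket_add_left bracket_add_right bracket_diff_left bracket_diff_right)
      finally have *: "bracket z w = \<dots>" .
      have "bracket z (p w) + bracket (p z) w - bracket (p z) (p w) \<in> ?Q"
        using brQ[OF zS(1) pQ] brQ2[OF zS(2) pQ] brQ2[OF _ pQ, of "p w" z] pQ QS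
        by (intro subspace_diff[OF subQ] subspace_add[OF subQ]) auto
      then have "p (bracket z w) = \<omega> z w +
          (bracket z (p w) + bracket (p z) w - bracket (p z) (p w))"
        by (subst *) (simp only: lin_add[OF p] pq \<omega>_def)
      then show ?thesis using bracket_skew[of "p z" w] by simp
    qed
    have comm: "bracket x (?c q) - ?c (bracket x q) \<in> Q'" if "x \<in> S" "q \<in> ?Q" for x q
      by (rule db.casimir_commutes[OF stQ Q'(1) abelian that])
    have "?c (p (bracket z w)) + \<tau> (bracket z w) =
      (?c (\<omega> z w) - bracket z (\<tau> w) + bracket w (\<tau> z) + \<tau> (bracket z w))
      - (bracket z (?c (p w)) - ?c (bracket z (p w))) +
          (bracket w (?c (p z)) - ?c (bracket w (p z)))
      + bracket z (?c (p w) + \<tau> w) - bracket w (?c (p z) + \<tau> z) - ?c (bracket (p z) (p w))"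
      unfolding prod by (simp add: lin_add[OF lin_casimir] lin_diff[OF lin_casimir]
          bracket_add_right algebra_simps)
    also have "\<dots> \<in> Q'"
    proof -
      have zw: "?c (p z) + \<tau> z \<in> Q'" "?c (p w) + \<tau> w \<in> Q'" using z w by (simp_all add: T_def)
      note diff = subspace_diff[OF subQ'] and add = subspace_add[OF subQ']
      show ?thesis
        by (rule diff[OF diff[OF add[OF add[OF diff[OF coboundary[OF zS] comm[OF zS(1) pQ]]
          comm[OF zS(2) pQ]] brQ'[OF zS(1) zw(2)]] brQ'[OF zS(2) zw(1)]] cQ'[OF abelian[OF pQ pQ]]])
    qed
    finally show ?thesis using brS[OF zS] unfolding T_def by blast
  qed
  ultimately have "lie_subalgebra T" unfolding lie_subalgebra_def by blast
  moreover have "T \<inter> ?Q = Q'"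
  proof -
    have "?c (p q) + \<tau> q = ?c q" if "q \<in> ?Q" for q using that by (simp add: pq \<tau>0)
    then show ?thesis using inj cQ' Q'(2) QS unfolding T_def by auto
  qed
  moreover have "\<exists>q\<in>?Q. x + q \<in> T" if x: "x \<in> S" for x
  proof -
    have "- (?c (p x) + \<tau> x) \<in> ?Q" using cQ[OF pQ] \<tau>Q
      by (intro subspace_neg[OF subQ] subspace_add[OF subQ])
    then obtain q where q: "q \<in> ?Q" "?c q - - (?c (p x) + \<tau> x) \<in> Q'" using surj by blast
    have "?c (p (x + q)) + \<tau> (x + q) = ?c q - - (?c (p x) + \<tau> x)"
      using q(1) by (simp add: lin_add[OF p] lin_add[OF lin_casimir] lin_add[OF l\<tau>] pq \<tau>0
          algebra_simps)
    moreover have "x + q \<in> S" using x q(1) QS subspace_add[OF subS] by blast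
    ultimately show ?thesis using q unfolding T_def by auto
  qed
  ultimately show thesis using that T_def by blast
qed

end

section \<open>Levi subalgebras containing a given semisimple subalgebra\<close>

context based_lie_algebra
begin

text \<open>One step towards a Levi subalgebra. Whitehead's second lemma gives a subalgebra \<open>T\<close> that
  cuts down the radical to \<open>Q'\<close>. The projection of \<open>G\<close> to \<open>Q/Q'\<close> along \<open>T\<close> is a cocycle, hence of
  the form \<open>g \<mapsto> [g, v]\<close>, and the preimage of \<open>T\<close> under \<open>1 + ad v\<close>, which is an automorphism modulo
  \<open>Q'\<close>, contains \<open>G\<close>.\<close>

lemma ex_smaller_supplement:
  assumes S: "lie_subalgebra S" and G: "lie_subalgebra G" "solvable_radical G = {0}" and GS: "G \<subseteq> S"
    and "solvable_radical S \<noteq> {0}"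
  obtains T where "lie_subalgebra T" "G \<subseteq> T" "T \<subset> S"
    "\<And>x. x \<in> S \<Longrightarrow> \<exists>q\<in>solvable_radical S. x + q \<in> T"
proof -
  let ?Q = "solvable_radical S"
  note Q = solvable_radical_greatest(1)[OF S]
  have subS: "subspace S" and subQ: "subspace ?Q" and QS: "?Q \<subseteq> S"
    using S Q by (auto simp: lie_subalgebra_def lie_ideal_def)
  note stQ = lie_ideal_stable[OF Q]
  let ?D = "derived_series ?Q (Suc 0)"
  have DQ: "?D \<subseteq> ?Q" by (rule derived_series_subset[OF lie_ideal_imp_subalgebra[OF Q]])
  have "?D \<noteq> ?Q"
  proof
    assume D: "?D = ?Q"
    have "derived_series ?Q n = ?Q" for n
    proof (induction n)
      case (Suc n)
      have "derived_series ?Q (Suc n) = derived_series ?D n"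
        using derived_series_add[of ?Q "Suc 0" n] by (simp only: plus_1_eq_Suc add_Suc add_0)
      then show ?case unfolding D Suc .
    qed simp
    moreover obtain n where "derived_series ?Q n = {0}"
      using solvable_radical_greatest(2)[OF S] unfolding solvable_def by blast
    ultimately show False using assms(5) by blast
  qed
  then have DQ': "?D \<subset> ?Q" using DQ by blast
  have stD: "stable S ?D" unfolding stable_def
  proof (intro conjI ballI)
    show "subspace ?D" by simp
    fix x y assume x: "x \<in> S" and y: "y \<in> ?D"
    show "bracket x y \<in> ?D"
    proof (rule lin_span_mem[OF lin_bracket _ _ y[unfolded derived_series.simps]])
      show "subspace ?D" by simp
      fix u assume "u \<in> {bracket a b | a b. a \<in> ?Q \<and> b \<in> ?Q}"
      then obtain a b where ab: "u = bracket a b" "a \<in> ?Q" "b \<in> ?Q" by blast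
      have "bracket x u = bracket (bracket x a) b + bracket a (bracket x b)"
        unfolding ab(1) by (simp add: bracket_bracket)
      moreover have "bracket (bracket x a) b \<in> ?D" "bracket a (bracket x b) \<in> ?D"
        using ab stableD[OF stQ x] by (auto intro: span_base)
      ultimately show "bracket x u \<in> ?D" using subspace_add[OF \<open>subspace ?D\<close>] by simp
    qed
  qed
  obtain Q' where Q': "stable S Q'" "?D \<subseteq> Q'" "Q' \<subset> ?Q" "irreducible_quotient S ?Q Q'"
    using ex_irreducible_quotient[OF stQ stD DQ'] by blast
  have Q'Q: "Q' \<subseteq> ?Q" using Q'(3) by blast
  note subQ' = stable_subspace[OF Q'(1)]
  have abelian: "bracket x y \<in> Q'" if "x \<in> ?Q" "y \<in> ?Q" for x y
  proof -
    have "bracket x y \<in> ?D" using that by (auto intro: span_base)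
    then show ?thesis using Q'(2) by blast
  qed
  obtain T where T: "lie_subalgebra T" "T \<subseteq> S" "T \<inter> ?Q = Q'"
    "\<And>x. x \<in> S \<Longrightarrow> \<exists>q\<in>?Q. x + q \<in> T"
  proof (cases "\<exists>x\<in>S. \<exists>q\<in>?Q. bracket x q \<notin> Q'")
    case True
    then show ?thesis
      using ex_complement_if_nontrivial[OF S Q'(1) Q'Q abelian Q'(4) True] that by metis
  next
    case False
    then have "\<And>x q. x \<in> S \<Longrightarrow> q \<in> ?Q \<Longrightarrow> bracket x q \<in> Q'" by blast
    then show ?thesis using ex_complement_if_trivial[OF S Q'(1) Q'Q] that by metis
  qed
  have subT: "subspace T" using T(1) by (rule subspace_subalgebra)
  have Q'T: "Q' \<subseteq> T" using T(3) by blast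
  obtain p where p: "lin p" and pQ: "\<And>v. p v \<in> ?Q" and pT: "\<And>a. a \<in> T \<Longrightarrow> p a = 0"
    and qp: "\<And>b. b \<in> ?Q \<Longrightarrow> b - p b \<in> T"
    using ex_projection[OF subT subQ] by metis
  have xp: "x - p x \<in> T" if x: "x \<in> S" for x
  proof -
    obtain q where q: "q \<in> ?Q" "x + q \<in> T" using T(4)[OF x] by blast
    have "(x + q) - (q - p q) \<in> T" by (rule subspace_diff[OF subT q(2) qp[OF q(1)]])
    moreover have "p x = - p q" using pT[OF q(2)] by (simp add: lin_add[OF p] eq_neg_iff_add_eq_0)
    ultimately show ?thesis by simp
  qed
  have pq': "b - p b \<in> Q'" if "b \<in> ?Q" for b
    using qp[OF that] subspace_diff[OF subQ that pQ] T(3) by blast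
  \<comment> \<open>\<open>p\<close> is a cocycle modulo \<open>Q'\<close> because \<open>x - p x\<close> ranges over a subalgebra.\<close>
  have "\<exists>v\<in>?Q. \<forall>x\<in>G. p x - bracket x v \<in> Q'"
  proof (rule whitehead_first[OF G stable_subset[OF stQ GS] stable_subset[OF Q'(1) GS] Q'Q p pQ])
    fix x y assume "x \<in> G" "y \<in> G"
    then have xy: "x \<in> S" "y \<in> S" using GS by auto
    let ?b = "bracket x (p y) - bracket y (p x)"
    have bQ: "?b \<in> ?Q" by (rule subspace_diff[OF subQ stableD[OF stQ xy(1) pQ]
        stableD[OF stQ xy(2) pQ]])
    have "bracket x y - ?b + bracket (p x) (p y) = bracket (x - p x) (y - p y)"
      using bracket_skew[of y "p x"]
        by (simp add: bracket_diff_left bracket_diff_right algebra_simps)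
    then have "bracket x y - ?b + bracket (p x) (p y) \<in> T"
      using bracket_subalgebra[OF T(1) xp[OF xy(1)] xp[OF xy(2)]] by simp
    then have "(bracket x y - ?b + bracket (p x) (p y)) - bracket (p x) (p y) \<in> T"
      using abelian[OF pQ pQ] Q'T by (blast intro: subspace_diff[OF subT])
    then have "p (bracket x y - ?b) = 0" using pT by simp
    then have "p (bracket x y) = p ?b" by (simp add: lin_diff[OF p])
    moreover have "- (?b - p ?b) \<in> Q'" using pq'[OF bQ] by (rule subspace_neg[OF subQ'])
    ultimately show "p (bracket x y) - bracket x (p y) + bracket y (p x) \<in> Q'"
      by (simp add: algebra_simps)
  qed
  then obtain v where v: "v \<in> ?Q" "\<And>x. x \<in> G \<Longrightarrow> p x - bracket x v \<in> Q'" by blast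
  have vS: "v \<in> S" using v(1) QS by blast
  have vQ: "bracket v z \<in> ?Q" if "z \<in> S" for z using lie_ideal_bracket_left[OF Q v(1) that] .
  let ?a = "\<lambda>z. z + bracket v z"
  have la: "lin ?a" by (rule linI) (simp_all add: bracket_add_right bracket_scale_right
      algebra_simps)
  define T' where "T' = {z \<in> S. ?a z \<in> T}"
  have "T' = S \<inter> {z. ?a z \<in> T}" by (auto simp: T'_def)
  then have "subspace T'" using subspace_inter[OF subS subspace_lin_preimage[OF la subT]] by simp
  moreover have "bracket z w \<in> T'" if z: "z \<in> T'" and w: "w \<in> T'" for z w
  proof -
    have zw: "z \<in> S" "w \<in> S" "?a z \<in> T" "?a w \<in> T" using z w by (auto simp: T'_def)
    have "?a (bracket z w) = bracket (?a z) (?a w) - bracket (bracket v z) (bracket v w)"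
      using bracket_bracket[of v z w]
        by (simp add: bracket_add_left bracket_add_right algebra_simps)
    also have "\<dots> \<in> T"
      using bracket_subalgebra[OF T(1) zw(3,4)] abelian[OF vQ[OF zw(1)] vQ[OF zw(2)]] Q'T
      by (blast intro: subspace_diff[OF subT])
    finally show ?thesis using bracket_subalgebra[OF S zw(1,2)] unfolding T'_def by blast
  qed
  ultimately have T': "lie_subalgebra T'" unfolding lie_subalgebra_def by blast
  have "G \<subseteq> T'"
  proof
    fix x assume x: "x \<in> G"
    have "(x - p x) + (p x - bracket x v) \<in> T"
      using xp x GS v(2)[OF x] Q'T by (blast intro: subspace_add[OF subT])
    then show "x \<in> T'" using x GS bracket_skew[of v x] unfolding T'_def by auto
  qed
  moreover have "\<exists>q\<in>?Q. x + q \<in> T'" if x: "x \<in> S" for x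
  proof -
    have "?a x \<in> S" using x QS vQ[OF x] by (blast intro: subspace_add[OF subS])
    then obtain q where q: "q \<in> ?Q" "?a x + q \<in> T" using T(4) by blast
    have "bracket v q \<in> T" using abelian[OF v(1) q(1)] Q'T by blast
    then have "(?a x + q) + bracket v q \<in> T" by (rule subspace_add[OF subT q(2)])
    then have "?a (x + q) \<in> T" by (simp add: bracket_add_right algebra_simps)
    moreover have "x + q \<in> S" using x q(1) QS by (blast intro: subspace_add[OF subS])
    ultimately show ?thesis using q(1) unfolding T'_def by blast
  qed
  moreover have "T' \<subset> S"
  proof -
    obtain q where q: "q \<in> ?Q" "q \<notin> Q'" using Q'(3) by blast
    have "q \<notin> T'"
    proof
      assume "q \<in> T'"
      then have "?a q - bracket v q \<in> T"
        using abelian[OF v(1) q(1)] Q'T unfolding T'_def by (blast intro: subspace_diff[OF subT])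
      then show False using q T(3) by auto
    qed
    then show ?thesis using q(1) QS unfolding T'_def by blast
  qed
  ultimately show thesis using that T' by blast
qed

lemma lie_subalgebra_UNIV: "lie_subalgebra UNIV"
  by (simp add: lie_subalgebra_def)

text \<open>Adding the radical of the whole algebra to a solvable ideal of a supplement \<open>S\<close> gives a
  solvable ideal of the whole algebra.\<close>

lemma radical_of_supplement:
  assumes S: "lie_subalgebra S" and sup: "\<And>x. \<exists>r\<in>solvable_radical UNIV. x + r \<in> S"
  shows "solvable_radical S = S \<inter> solvable_radical UNIV"
proof
  let ?R = "solvable_radical UNIV" and ?I = "solvable_radical S"
  note R = solvable_radical_greatest(1)[OF lie_subalgebra_UNIV]
    and I = solvable_radical_greatest(1)[OF S]
  have sub: "subspace S" "subspace ?R" "subspace ?I" "?I \<subseteq> S"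
    using S R I by (auto simp: lie_subalgebra_def lie_ideal_def)
  have "lie_ideal (S \<inter> ?R) S"
    using S R sub unfolding lie_ideal_def lie_subalgebra_def by (auto intro: subspace_inter)
  moreover have "solvable (S \<inter> ?R)"
    using solvable_subset[OF solvable_radical_greatest(2)[OF lie_subalgebra_UNIV]] sub
    by (auto intro: subspace_inter)
  ultimately show "S \<inter> ?R \<subseteq> ?I" by (rule solvable_radical_greatest(3)[OF S])
  let ?K = "{x + y | x y. x \<in> ?I \<and> y \<in> ?R}"
  have subK: "subspace ?K" by (rule subspace_sums[OF sub(3,2)])
  have IK: "?I \<subseteq> ?K" using subspace_0[OF sub(2)]
    by (metis (mono_tags, lifting) add.right_neutral mem_Collect_eq subsetI)
  have RU: "bracket r u \<in> ?R" "bracket u r \<in> ?R" if "r \<in> ?R" for r u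
    using lie_ideal_bracket_left[OF R that, of u] R that by (auto simp: lie_ideal_def)
  have K: "lie_ideal ?K UNIV" unfolding lie_ideal_def
  proof (intro conjI ballI)
    fix m u assume "u \<in> ?K"
    then obtain x y where u: "u = x + y" "x \<in> ?I" "y \<in> ?R" by blast
    obtain r where r: "r \<in> ?R" "m + r \<in> S" using sup by blast
    have "bracket m u = bracket (m + r) x + (bracket m y - bracket r x)"
      unfolding u(1) by (simp add: bracket_add_left bracket_add_right)
    moreover have "bracket (m + r) x \<in> ?I" using I r u by (auto simp: lie_ideal_def)
    moreover have "bracket m y - bracket r x \<in> ?R" using RU u(3) r(1)
      by (blast intro: subspace_diff[OF sub(2)])
    ultimately show "bracket m u \<in> ?K" by blast
  qed (use subK in auto)
  have "derived_series ?K n \<subseteq> {x + y | x y. x \<in> derived_series ?I n \<and> y \<in> ?R}" for n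
  proof (induction n)
    case (Suc n)
    let ?T = "{x + y | x y. x \<in> derived_series ?I (Suc n) \<and> y \<in> ?R}"
    have "bracket u v \<in> ?T" if uv: "u \<in> derived_series ?K n" "v \<in> derived_series ?K n" for u v
    proof -
      obtain a b c d where ab: "u = a + b" "v = c + d" "a \<in> derived_series ?I n" "b \<in> ?R"
        "c \<in> derived_series ?I n" "d \<in> ?R"
        using subsetD[OF Suc uv(1)] subsetD[OF Suc uv(2)] by blast
      have "bracket u v = bracket a c + (bracket a d + bracket b v)"
        unfolding ab(1,2) by (simp add: bracket_add_left bracket_add_right add_ac)
      moreover have "bracket a c \<in> derived_series ?I (Suc n)" using ab by (auto intro: span_base)
      moreover have "bracket a d + bracket b v \<in> ?R" using RU ab
        by (blast intro: subspace_add[OF sub(2)])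
      ultimately show ?thesis by blast
    qed
    moreover have "subspace ?T" by (intro subspace_sums sub subspace_derived_series)
    ultimately show ?case unfolding derived_series.simps(2)[of ?K] by (intro span_minimal) blast+
  qed simp
  moreover obtain m where "derived_series ?I m = {0}"
    using solvable_radical_greatest(2)[OF S] by (auto simp: solvable_def)
  ultimately have "derived_series ?K m \<subseteq> ?R" by fastforce
  then have "?K \<subseteq> ?R" by (rule subset_radical_if_derived_subset[OF lie_subalgebra_UNIV K])
  then show "?I \<subseteq> S \<inter> ?R" using IK sub by blast
qed

text \<open>The theorems of Levi and Malcev in one statement: a supplement of the radical that contains
  \<open>G\<close> and has minimal dimension is a complement.\<close>

theorem ex_levi_subalgebra:
  assumes G: "lie_subalgebra G" "solvable_radical G = {0}"
  obtains S where "lie_subalgebra S" "G \<subseteq> S" "solvable_radical S = {0}"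
    "S \<inter> solvable_radical UNIV = {0}" "\<And>x. \<exists>r\<in>solvable_radical UNIV. x + r \<in> S"
proof -
  let ?R = "solvable_radical UNIV"
  have subR: "subspace ?R"
    using solvable_radical_greatest(1)[OF lie_subalgebra_UNIV] by (simp add: lie_ideal_def)
  define A where "A S \<longleftrightarrow> lie_subalgebra S \<and> G \<subseteq> S \<and> (\<forall>x. \<exists>r\<in>?R. x + r \<in> S)" for S
  have "A UNIV" using subspace_0[OF subR] lie_subalgebra_UNIV unfolding A_def by blast
  then obtain S where S: "A S" and min: "\<And>T. A T \<Longrightarrow> dim S \<le> dim T"
    using ex_has_least_nat[of A UNIV dim] by blast
  have S': "lie_subalgebra S" "G \<subseteq> S" "\<And>x. \<exists>r\<in>?R. x + r \<in> S" using S by (auto simp: A_def)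
  have rad: "solvable_radical S = S \<inter> ?R" using radical_of_supplement S' by blast
  have "solvable_radical S = {0}"
  proof (rule ccontr)
    assume "solvable_radical S \<noteq> {0}"
    then obtain T where T: "lie_subalgebra T" "G \<subseteq> T" "T \<subset> S"
      "\<And>x. x \<in> S \<Longrightarrow> \<exists>q\<in>solvable_radical S. x + q \<in> T"
      using ex_smaller_supplement[OF S'(1) G S'(2)] by metis
    have "\<exists>r\<in>?R. x + r \<in> T" for x
    proof -
      obtain r where r: "r \<in> ?R" "x + r \<in> S" using S'(3) by blast
      obtain q where q: "q \<in> ?R" "(x + r) + q \<in> T" using T(4)[OF r(2)] rad by blast
      have "x + (r + q) \<in> T" using q(2) by (simp add: add.assoc)
      then show ?thesis using r(1) q(1) subspace_add[OF subR] by blast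
    qed
    then have "A T" using T unfolding A_def by blast
    then have "dim S \<le> dim T" by (rule min)
    then have "T = S" using T S' by (intro subspace_dim_equal) (auto simp: lie_subalgebra_def)
    then show False using T(3) by blast
  qed
  then show thesis using that S' rad by blast
qed

end

lemma (in fin_dim_lie_algebra) ex_finite_basis:
  "\<exists>Basis. finite_dimensional_vector_space scale Basis"
proof -
  obtain A where A: "finite A" "span A = UNIV" using finite_dimensional by blast
  obtain B where B: "B \<subseteq> A" "independent B" "A \<subseteq> span B"
    using maximal_independent_subset[of A] by blast
  have "span B = UNIV" using span_minimal[OF B(3) subspace_span] A(2) by auto
  moreover have "finite B" using A(1) B(1) by (rule rev_finite_subset)
  ultimately have "finite_dimensional_vector_space scale B" using B(2) by unfold_locales
  then show ?thesis by blast
qed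

section \<open>The semidirect product\<close>

lemma derived_series_image:
  assumes "lie_algebra s\<^sub>1 b\<^sub>1" "lie_algebra s\<^sub>2 b\<^sub>2" "Vector_Spaces.linear s\<^sub>1 s\<^sub>2 f"
    and hom: "\<And>x y. f (b\<^sub>1 x y) = b\<^sub>2 (f x) (f y)"
  shows "lie_algebra.derived_series s\<^sub>2 b\<^sub>2 (f ` X) n = f ` lie_algebra.derived_series s\<^sub>1 b\<^sub>1 X n"
proof -
  interpret A: lie_algebra s\<^sub>1 b\<^sub>1 by fact
  interpret B: lie_algebra s\<^sub>2 b\<^sub>2 by fact
  interpret f: Vector_Spaces.linear s\<^sub>1 s\<^sub>2 f by fact
  show ?thesis
  proof (induction n)
    case (Suc n)
    let ?D = "A.derived_series X n"
    have "{b\<^sub>2 u v | u v. u \<in> f ` ?D \<and> v \<in> f ` ?D} = f ` {b\<^sub>1 x y | x y. x \<in> ?D \<and> y \<in> ?D}"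
      using hom by (auto simp: image_iff) metis
    then show ?case unfolding A.derived_series.simps B.derived_series.simps Suc
      by (simp only: f.span_image)
  qed simp
qed

locale semisimple_lie_action =
  lie_action_by_derivations scale\<^sub>\<gg> bracket\<^sub>\<gg> scale\<^sub>L bracket\<^sub>L act +
  \<gg>: fin_dim_lie_algebra scale\<^sub>\<gg> bracket\<^sub>\<gg> + L: fin_dim_lie_algebra scale\<^sub>L bracket\<^sub>L
  for scale\<^sub>\<gg> :: "'f::{alg_closed_field, field_char_0} \<Rightarrow> 'g::ab_group_add \<Rightarrow> 'g"
    and bracket\<^sub>\<gg> :: "'g \<Rightarrow> 'g \<Rightarrow> 'g"
    and scale\<^sub>L :: "'f \<Rightarrow> 'l::ab_group_add \<Rightarrow> 'l"
    and bracket\<^sub>L :: "'l \<Rightarrow> 'l \<Rightarrow> 'l"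
    and act :: "'g \<Rightarrow> 'l \<Rightarrow> 'l" +
  assumes semisimple: "\<gg>.semisimple UNIV"
begin

definition scale_semidirect :: "'f \<Rightarrow> 'g \<times> 'l \<Rightarrow> 'g \<times> 'l"
  where "scale_semidirect c u = (scale\<^sub>\<gg> c (fst u), scale\<^sub>L c (snd u))"

definition bracket_semidirect :: "'g \<times> 'l \<Rightarrow> 'g \<times> 'l \<Rightarrow> 'g \<times> 'l"
  where "bracket_semidirect u v = (bracket\<^sub>\<gg> (fst u) (fst v),
    act (fst u) (snd v) - act (fst v) (snd u) + bracket\<^sub>L (snd u) (snd v))"

lemma act_lin: "Vector_Spaces.linear scale\<^sub>L scale\<^sub>L (act g)"
  and act_leibniz: "act g (bracket\<^sub>L x y) = bracket\<^sub>L (act g x) y + bracket\<^sub>L x (act g y)"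
  using act_derivation[of g] by (simp_all add: L.derivation_def)

lemma act_add_right: "act g (x + y) = act g x + act g y"
  and act_scale_right: "act g (scale\<^sub>L c x) = scale\<^sub>L c (act g x)"
  using act_lin[of g] by (simp_all add: Vector_Spaces.linear_iff)

lemma act_zero_right: "act g 0 = 0"
  using act_add_right[of g 0 0] by simp

lemma act_diff_right: "act g (x - y) = act g x - act g y"
  using act_add_right[of g "x - y" y] by (simp add: algebra_simps)

lemma act_zero_left: "act 0 x = 0"
  using act_add[of 0 0 x] by simp

sublocale M: lie_algebra scale_semidirect bracket_semidirect
proof
  have g0: "bracket\<^sub>\<gg> x x = 0" for x by (rule \<gg>.bracket_self)
  fix a b c u v w r s
  show "scale_semidirect r (u + v) = scale_semidirect r u + scale_semidirect r v"
    "scale_semidirect (r + s) u = scale_semidirect r u + scale_semidirect s u"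
    "scale_semidirect r (scale_semidirect s u) = scale_semidirect (r * s) u"
    "scale_semidirect 1 u = u"
    by (simp_all add: scale_semidirect_def prod_eq_iff \<gg>.scale_right_distrib L.scale_right_distrib
        \<gg>.scale_left_distrib L.scale_left_distrib)
  show "bracket_semidirect (u + v) w = bracket_semidirect u w + bracket_semidirect v w"
    "bracket_semidirect u (v + w) = bracket_semidirect u v + bracket_semidirect u w"
    by (simp_all add: bracket_semidirect_def prod_eq_iff \<gg>.bracket_add_left \<gg>.bracket_add_right
        L.bracket_add_left L.bracket_add_right act_add act_add_right algebra_simps)
  show "bracket_semidirect (scale_semidirect r u) v = scale_semidirect r (bracket_semidirect u v)"
    "bracket_semidirect u (scale_semidirect r v) = scale_semidirect r (bracket_semidirect u v)"
    by (simp_all add: bracket_semidirect_def scale_semidirect_def prod_eq_iff \<gg>.bracket_scale_left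
        \<gg>.bracket_scale_right L.bracket_scale_left L.bracket_scale_right act_scale act_scale_right
        L.scale_right_distrib L.scale_right_diff_distrib)
  show "bracket_semidirect u u = 0"
    by (simp add: bracket_semidirect_def prod_eq_iff \<gg>.bracket_self L.bracket_self)
  obtain g x h y k z where uvw: "u = (g, x)" "v = (h, y)" "w = (k, z)" by (metis surj_pair)
  have diff: "bracket\<^sub>L a (b - c) = bracket\<^sub>L a b - bracket\<^sub>L a c" for a b c
    using L.bracket_add_right[of a "b - c" c] by (simp add: algebra_simps)
  show "bracket_semidirect u (bracket_semidirect v w) +
      bracket_semidirect v (bracket_semidirect w u)
      + bracket_semidirect w (bracket_semidirect u v) = 0"
    using \<gg>.jacobi[of g h k] L.jacobi[of x y z] L.bracket_skew[of z "act g y"]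
      L.bracket_skew[of "act h z" x] L.bracket_skew[of "act k x" y]
    by (simp add: uvw bracket_semidirect_def act_add_right act_diff_right act_bracket act_leibniz
        L.bracket_add_right diff) (simp add: prod_eq_iff algebra_simps)
qed

sublocale M: fin_dim_lie_algebra scale_semidirect bracket_semidirect
proof
  obtain A where A: "finite A" "\<gg>.span A = UNIV" using \<gg>.finite_dimensional by blast
  obtain B where B: "finite B" "L.span B = UNIV" using L.finite_dimensional by blast
  let ?S = "(\<lambda>g. (g, 0)) ` A \<union> (\<lambda>x. (0, x)) ` B"
  have "\<gg>.subspace {g. (g, 0) \<in> M.span ?S}" unfolding \<gg>.subspace_def
  proof (intro conjI ballI allI; clarsimp)
    show "(0, 0) \<in> M.span ?S" using M.span_zero[of ?S] by (simp add: zero_prod_def)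
    show "(a + b, 0) \<in> M.span ?S" if "(a, 0) \<in> M.span ?S" "(b, 0) \<in> M.span ?S" for a b
      using M.span_add[OF that] by simp
    show "(scale\<^sub>\<gg> c a, 0) \<in> M.span ?S" if "(a, 0) \<in> M.span ?S" for c a
      using M.span_scale[OF that, of c] by (simp add: scale_semidirect_def)
  qed
  then have 1: "\<gg>.span A \<subseteq> {g. (g, 0) \<in> M.span ?S}"
    by (intro \<gg>.span_minimal) (auto intro: M.span_base)
  have "L.subspace {x. (0, x) \<in> M.span ?S}" unfolding L.subspace_def
  proof (intro conjI ballI allI; clarsimp)
    show "(0, 0) \<in> M.span ?S" using M.span_zero[of ?S] by (simp add: zero_prod_def)
    show "(0, a + b) \<in> M.span ?S" if "(0, a) \<in> M.span ?S" "(0, b) \<in> M.span ?S" for a b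
      using M.span_add[OF that] by simp
    show "(0, scale\<^sub>L c a) \<in> M.span ?S" if "(0, a) \<in> M.span ?S" for c a
      using M.span_scale[OF that, of c] by (simp add: scale_semidirect_def)
  qed
  then have 2: "L.span B \<subseteq> {x. (0, x) \<in> M.span ?S}"
    by (intro L.span_minimal) (auto intro: M.span_base)
  have "(g, x) \<in> M.span ?S" for g x
    using M.span_add[of "(g, 0)" ?S "(0, x)"] 1 2 A(2) B(2) by auto
  then show "\<exists>S. finite S \<and> M.span S = UNIV" using A(1) B(1) by (intro exI[of _ ?S]) auto
qed

lemma bracket_semidirect_simps:
  "bracket_semidirect (g, 0) (h, 0) = (bracket\<^sub>\<gg> g h, 0)"
  "bracket_semidirect (g, 0) (0, x) = (0, act g x)"
  "bracket_semidirect (0, x) (0, y) = (0, bracket\<^sub>L x y)"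
proof -
  have "bracket\<^sub>\<gg> h 0 = 0" "bracket\<^sub>\<gg> 0 h = 0" for h
    using \<gg>.bracket_add_right[of h 0 0] \<gg>.bracket_add_left[of 0 0 h] by simp_all
  moreover have "bracket\<^sub>L h 0 = 0" "bracket\<^sub>L 0 h = 0" for h
    using L.bracket_add_right[of h 0 0] L.bracket_add_left[of 0 0 h] by simp_all
  ultimately show
  "bracket_semidirect (g, 0) (h, 0) = (bracket\<^sub>\<gg> g h, 0)"
  "bracket_semidirect (g, 0) (0, x) = (0, act g x)"
  "bracket_semidirect (0, x) (0, y) = (0, bracket\<^sub>L x y)"
    by (simp_all add: bracket_semidirect_def act_zero_right act_zero_left)
qed

lemma lin_fst: "Vector_Spaces.linear scale_semidirect scale\<^sub>\<gg> fst"
  and lin_inclusion: "Vector_Spaces.linear scale\<^sub>L scale_semidirect (\<lambda>x. (0, x))"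
  by (simp_all add: Vector_Spaces.linear_iff M.vector_space_axioms \<gg>.vector_space_axioms
      L.vector_space_axioms scale_semidirect_def)

lemmas module_hom_fst = lin_fst[folded module_hom_iff_linear]
lemmas module_hom_inclusion = lin_inclusion[folded module_hom_iff_linear]

lemmas subspace_fst = module_hom.subspace_image[OF module_hom_fst]
lemmas subspace_inclusion = module_hom.subspace_image[OF module_hom_inclusion]
lemmas subspace_preimage = module_hom.subspace_linear_preimage[OF module_hom_inclusion]

lemma derived_series_fst: "\<gg>.derived_series (fst ` X) n = fst ` M.derived_series X n"
  by (rule derived_series_image[OF M.lie_algebra_axioms \<gg>.lie_algebra_axioms lin_fst])
    (simp add: bracket_semidirect_def)

lemma solvable_inclusion: "M.solvable ((\<lambda>x. (0, x)) ` X) \<longleftrightarrow> L.solvable X"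
proof -
  have "M.derived_series ((\<lambda>x. (0, x)) ` X) n = (\<lambda>x. (0, x)) ` L.derived_series X n" for n
    by (rule derived_series_image[OF L.lie_algebra_axioms M.lie_algebra_axioms lin_inclusion])
      (simp add: bracket_semidirect_simps)
  moreover have "(\<lambda>x. (0::'g, x)) ` Y = {0} \<longleftrightarrow> Y = {0}" for Y :: "'l set"
    by (auto simp: zero_prod_def image_iff)
  ultimately show ?thesis by (simp add: M.solvable_def L.solvable_def)
qed

text \<open>A solvable ideal of \<open>\<gg> \<times> L\<close>, or of \<open>\<gg> \<times> {0}\<close>, projects to a solvable ideal of \<open>\<gg>\<close>.\<close>

lemma fst_solvable_ideal_eq_0:
  assumes I: "M.subspace I" "M.solvable I"
    and ideal: "\<And>g u. u \<in> I \<Longrightarrow> bracket_semidirect (g, 0) u \<in> I"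
    and u: "u \<in> I"
  shows "fst u = 0"
proof -
  obtain n where "M.derived_series I n = {0}" using I(2) by (auto simp: M.solvable_def)
  then have "\<gg>.derived_series (fst ` I) n = {0}" using derived_series_fst[of I n] by simp
  then have "\<gg>.solvable (fst ` I)" by (auto simp: \<gg>.solvable_def)
  moreover have "\<gg>.lie_ideal (fst ` I) UNIV" unfolding \<gg>.lie_ideal_def
  proof (intro conjI ballI)
    fix g h assume "h \<in> fst ` I"
    then obtain v where v: "v \<in> I" "h = fst v" by blast
    have "fst (bracket_semidirect (g, 0) v) \<in> fst ` I" using ideal[OF v(1)] by (rule imageI)
    then show "bracket\<^sub>\<gg> g h \<in> fst ` I" by (simp add: bracket_semidirect_def v(2))
  qed (use subspace_fst[OF I(1)] in auto)
  ultimately have "fst ` I \<subseteq> \<gg>.solvable_radical UNIV"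
    using \<gg>.solvable_radical_greatest(3) semisimple by (auto simp: \<gg>.semisimple_def)
  then show ?thesis using u semisimple by (auto simp: \<gg>.semisimple_def)
qed

text \<open>The Levi subalgebra \<open>S\<close> of the semidirect product contains \<open>\<gg>\<close>, so its intersection \<open>B\<close> with
  \<open>L\<close> is \<open>\<gg>\<close>-stable, and the radical of the semidirect product lies in \<open>L\<close>, so \<open>B\<close> is a complement
  to it in \<open>L\<close>. As an ideal of \<open>S\<close>, \<open>B\<close> is semisimple; it therefore misses the radical of \<open>L\<close> as
  well, and the two radicals agree.\<close>

lemma ex_stable_levi_complement:
  "\<exists>B. L.maximal_semisimple_subalgebra B \<and> direct_sum_of_submodules B (L.solvable_radical UNIV)"
proof -
  obtain Basis where "finite_dimensional_vector_space scale_semidirect Basis"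
    using M.ex_finite_basis by blast
  then interpret fd: finite_dimensional_vector_space scale_semidirect Basis .
  interpret N: based_lie_algebra scale_semidirect bracket_semidirect Basis
    by unfold_locales
  let ?i = "\<lambda>x. (0::'g, x)"
  let ?R = "M.solvable_radical UNIV" and ?R\<^sub>L = "L.solvable_radical UNIV"
  define G where "G = {(g::'g, 0::'l) | g. True}"
  have G: "M.lie_subalgebra G"
  proof -
    have "M.subspace G" unfolding M.subspace_def G_def
      by (auto simp: zero_prod_def scale_semidirect_def)
    then show ?thesis unfolding M.lie_subalgebra_def by (auto simp: G_def bracket_semidirect_simps)
  qed
  have "M.solvable_radical G = {0}"
  proof -
    note rad = M.solvable_radical_greatest[OF G]
    have "u = 0" if u: "u \<in> M.solvable_radical G" for u
    proof -
      have "fst u = 0"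
        by (rule fst_solvable_ideal_eq_0[OF _ rad(2) _ u])
          (use rad(1) in \<open>auto simp: M.lie_ideal_def G_def\<close>)
      moreover have "u \<in> G" using u rad(1) by (auto simp: M.lie_ideal_def)
      ultimately show ?thesis by (auto simp: G_def zero_prod_def)
    qed
    moreover have "0 \<in> M.solvable_radical G" using rad(1) M.subspace_0
      by (auto simp: M.lie_ideal_def)
    ultimately show ?thesis by blast
  qed
  then obtain S where S: "M.lie_subalgebra S" "G \<subseteq> S" "M.solvable_radical S = {0}" "S \<inter> ?R = {0}"
    "\<And>u. \<exists>r\<in>?R. u + r \<in> S"
    using N.ex_levi_subalgebra[OF G] by blast
  note R = M.solvable_radical_greatest(1,2)[OF N.lie_subalgebra_UNIV]
  have subR: "M.subspace ?R" and RI: "\<And>u r. r \<in> ?R \<Longrightarrow> bracket_semidirect u r \<in> ?R"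
    using R(1) by (auto simp: M.lie_ideal_def)
  have R0: "fst r = 0" if "r \<in> ?R" for r
    by (rule fst_solvable_ideal_eq_0[OF subR R(2) RI that])
  define R1 where "R1 = {x. ?i x \<in> ?R}"
  have iR1: "?i ` R1 = ?R" using R0 unfolding R1_def by (force simp: image_iff prod_eq_iff)
  have LU: "L.lie_subalgebra UNIV" by (simp add: L.lie_subalgebra_def)
  note RL = L.solvable_radical_greatest[OF LU]
  have subRL: "L.subspace ?R\<^sub>L" and RLI: "\<And>x r. r \<in> ?R\<^sub>L \<Longrightarrow> bracket\<^sub>L x r \<in> ?R\<^sub>L"
    using RL(1) by (auto simp: L.lie_ideal_def)
  have subR1: "L.subspace R1" unfolding R1_def by (rule subspace_preimage[OF subR])
  have R1_ideal: "L.lie_ideal R1 UNIV" unfolding L.lie_ideal_def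
  proof (intro conjI ballI)
    fix x y assume "y \<in> R1"
    then show "bracket\<^sub>L x y \<in> R1" using RI[of "?i y" "?i x"]
      by (simp add: R1_def bracket_semidirect_simps)
  qed (use subR1 in auto)
  have R1_RL: "R1 \<subseteq> ?R\<^sub>L" using RL(3)[OF R1_ideal] R(2) solvable_inclusion[of R1] iR1 by simp
  define B where "B = {x. ?i x \<in> S}"
  have subS: "M.subspace S" using S(1) by (simp add: M.lie_subalgebra_def)
  have subB: "L.subspace B" unfolding B_def by (rule subspace_preimage[OF subS])
  have B: "L.lie_subalgebra B" unfolding L.lie_subalgebra_def
  proof (intro conjI ballI)
    fix x y assume "x \<in> B" "y \<in> B"
    then show "bracket\<^sub>L x y \<in> B"
      using S(1) bracket_semidirect_simps(3)[of x y] unfolding B_def M.lie_subalgebra_def by force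
  qed (fact subB)
  have B_ideal: "M.lie_ideal (?i ` B) S" unfolding M.lie_ideal_def
  proof (intro conjI ballI)
    show "M.subspace (?i ` B)" using subB by (rule subspace_inclusion)
    show "?i ` B \<subseteq> S" unfolding B_def by blast
    fix u v assume u: "u \<in> S" and v: "v \<in> ?i ` B"
    then have "bracket_semidirect u v \<in> S" using S(1) unfolding B_def M.lie_subalgebra_def by blast
    moreover have "fst (bracket_semidirect u v) = 0"
      using v \<gg>.bracket_zero_right by (auto simp: bracket_semidirect_def)
    ultimately have "?i (snd (bracket_semidirect u v)) \<in> S" "bracket_semidirect u v =
        ?i (snd (bracket_semidirect u v))"
      by (metis prod.collapse)+
    then show "bracket_semidirect u v \<in> ?i ` B" unfolding B_def by blast
  qed
  have B_no_ideal: "I \<subseteq> {0}" if I: "L.lie_ideal I B" "L.solvable I" for I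
  proof -
    have "M.lie_ideal (?i ` I) (?i ` B)"
      using I(1) subspace_inclusion unfolding M.lie_ideal_def L.lie_ideal_def
      by (auto simp: bracket_semidirect_simps)
    then have "?i ` I \<subseteq> {0}"
      using N.ideal_of_semisimple[OF S(1,3) B_ideal] I(2) solvable_inclusion by blast
    then show ?thesis by (auto simp: zero_prod_def)
  qed
  have B_ss: "L.semisimple B"
  proof -
    note rad = L.solvable_radical_greatest[OF B]
    have "0 \<in> L.solvable_radical B" using rad(1) L.subspace_0 by (auto simp: L.lie_ideal_def)
    then show ?thesis using B_no_ideal[OF rad(1,2)] B unfolding L.semisimple_def by blast
  qed
  have RL_inter: "L.lie_ideal (C \<inter> ?R\<^sub>L) C \<and> L.solvable (C \<inter> ?R\<^sub>L)" if C: "L.lie_subalgebra C" for C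
  proof
    have subC: "L.subspace C" using C by (simp add: L.lie_subalgebra_def)
    show "L.lie_ideal (C \<inter> ?R\<^sub>L) C"
      using C RLI L.subspace_inter[OF subC subRL] unfolding L.lie_ideal_def L.lie_subalgebra_def
        by auto
    show "L.solvable (C \<inter> ?R\<^sub>L)"
      using L.solvable_subset[OF RL(2)] L.subspace_inter[OF subC subRL] by blast
  qed
  have BR: "B \<inter> ?R\<^sub>L = {0}"
    using B_no_ideal RL_inter[OF B] L.subspace_0[OF subB] L.subspace_0[OF subRL] by blast
  have sup: "\<exists>r\<in>R1. x + r \<in> B" for x
  proof -
    obtain r where r: "r \<in> ?R" "?i x + r \<in> S" using S(5) by blast
    then obtain y where "r = ?i y" "y \<in> R1" using iR1 by blast
    then show ?thesis using r(2) by (auto simp: B_def)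
  qed
  have RL_R1: "?R\<^sub>L = R1"
  proof
    show "?R\<^sub>L \<subseteq> R1"
    proof
      fix x assume x: "x \<in> ?R\<^sub>L"
      obtain r where r: "r \<in> R1" "x + r \<in> B" using sup by blast
      have "x + r \<in> ?R\<^sub>L" using x r(1) R1_RL L.subspace_add[OF subRL] by blast
      then have "x + r = 0" using r(2) BR by blast
      then have "x = - r" by (simp add: eq_neg_iff_add_eq_0)
      then show "x \<in> R1" using r(1) L.subspace_neg[OF subR1] by simp
    qed
  qed (fact R1_RL)
  have max: "C = B" if C: "L.semisimple C" "B \<subseteq> C" for C
  proof
    have C': "L.lie_subalgebra C" "L.subspace C" using C
      by (auto simp: L.semisimple_def L.lie_subalgebra_def)
    have CR: "C \<inter> ?R\<^sub>L \<subseteq> {0}"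
      using L.solvable_radical_greatest(3)[OF C'(1)] RL_inter[OF C'(1)] C(1)
        unfolding L.semisimple_def by blast
    show "C \<subseteq> B"
    proof
      fix x assume x: "x \<in> C"
      obtain r where r: "r \<in> R1" "x + r \<in> B" using sup by blast
      have "(x + r) - x \<in> C" using r(2) x C(2) L.subspace_diff[OF C'(2)] by blast
      then have "r = 0" using r(1) R1_RL CR by auto
      then show "x \<in> B" using r(2) by simp
    qed
  qed (fact C(2))
  have "submodule B" unfolding submodule_def
  proof (intro conjI allI ballI)
    fix g x assume "x \<in> B"
    then have "bracket_semidirect (g, 0) (?i x) \<in> S"
      using S(1,2) unfolding B_def M.lie_subalgebra_def G_def by blast
    then show "act g x \<in> B" by (simp add: B_def bracket_semidirect_simps)
  qed (fact subB)
  moreover have "submodule ?R\<^sub>L" unfolding submodule_def RL_R1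
  proof (intro conjI allI ballI)
    fix g x assume "x \<in> R1"
    then show "act g x \<in> R1" using RI[of "?i x" "(g, 0)"]
      by (simp add: R1_def bracket_semidirect_simps)
  qed (fact subR1)
  moreover have "{x + y | x y. x \<in> B \<and> y \<in> ?R\<^sub>L} = UNIV"
  proof -
    have "x \<in> {x + y | x y. x \<in> B \<and> y \<in> ?R\<^sub>L}" for x
    proof -
      obtain r where r: "r \<in> R1" "x + r \<in> B" using sup by blast
      have "- r \<in> ?R\<^sub>L" using L.subspace_neg[OF subR1 r(1)] R1_RL by blast
      moreover have "x = (x + r) + - r" by simp
      ultimately show ?thesis using r(2) by blast
    qed
    then show ?thesis by blast
  qed
  ultimately have "direct_sum_of_submodules B ?R\<^sub>L"
    using BR unfolding direct_sum_of_submodules_def by blast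
  moreover have "L.maximal_semisimple_subalgebra B"
    using B_ss max unfolding L.maximal_semisimple_subalgebra_def by blast
  ultimately show ?thesis by blast
qed

end

theorem theorem5:
  fixes scale\<^sub>\<gg> :: "'f::{alg_closed_field, field_char_0} \<Rightarrow> 'g::ab_group_add \<Rightarrow> 'g"
    and bracket\<^sub>\<gg> :: "'g \<Rightarrow> 'g \<Rightarrow> 'g"
    and scale\<^sub>L :: "'f \<Rightarrow> 'l::ab_group_add \<Rightarrow> 'l"
    and bracket\<^sub>L :: "'l \<Rightarrow> 'l \<Rightarrow> 'l"
    and act :: "'g \<Rightarrow> 'l \<Rightarrow> 'l"
  assumes "fin_dim_lie_algebra scale\<^sub>L bracket\<^sub>L"
    and "fin_dim_lie_algebra scale\<^sub>\<gg> bracket\<^sub>\<gg>"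
    and "lie_algebra.semisimple scale\<^sub>\<gg> bracket\<^sub>\<gg> UNIV"
    and "lie_action_by_derivations scale\<^sub>\<gg> bracket\<^sub>\<gg> scale\<^sub>L bracket\<^sub>L act"
  shows "\<exists>B. lie_algebra.maximal_semisimple_subalgebra scale\<^sub>L bracket\<^sub>L B \<and>
    lie_action_by_derivations.direct_sum_of_submodules scale\<^sub>L act
      B (lie_algebra.solvable_radical scale\<^sub>L bracket\<^sub>L UNIV)"
proof -
  interpret semisimple_lie_action scale\<^sub>\<gg> bracket\<^sub>\<gg> scale\<^sub>L bracket\<^sub>L act
    using assms by (simp add: semisimple_lie_action_def semisimple_lie_action_axioms_def)
  show ?thesis by (rule ex_stable_levi_complement)
qed

end
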